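(* Let $B$ be the open unit ball of $\mathbb{C}^n$ and let $M\subset B$ be a properly embedded smooth real submanifold of real codimension $m$. Assume that $M$ is generating, i.e. $T_p(M)+J\,T_p(M)=\mathbb{C}^n$ for all $p\in M$. For $t>0$ let $U_t$ be the set of points whose distance to $M$ is less than $t$. Let $0<r<1$, and let $t_0>0$ be fixed and sufficiently small. Then there is a constant $C_{r,M}$ (depending on $r$, $M$ and the fixed number $t_0$, but not on $\theta$ or $t$) such that for every closed positive current $\theta$ of bidegree $(1,1)$ in $B$ and every $0<t\le t_0$, $$ \int_{U_t\cap rB}\theta\wedge\frac{\beta^{n-1}}{(n-1)!}\;\le\; C_{r,M}\,|\theta|\,t^{m-1}, \qquad\text{where}\qquad |\theta|=\int_{U_{t_0}\cap B}\theta\wedge\frac{\beta^{n-1}}{(n-1)!}. $$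
   Context: $J$ denotes the complex structure on $\mathbb{C}^n$ (multiplication by $i$ on tangent vectors), $T_p(M)$ is the real tangent space of $M$ at $p$ viewed as a real subspace of $\mathbb{C}^n$, and $\beta=i\partial\bar\partial|z|^2$ is the standard Kähler form on $\mathbb{C}^n$. $rB$ is the ball of radius $r$ centered at the origin. "Sufficiently small" means: there is $\tau>0$ depending only on $M$ and $r$ such that the statement holds for each fixed $t_0\in(0,\tau]$. The positive measure $\theta\wedge\beta^{n-1}/(n-1)!$ is the trace (mass) measure of $\theta$; $|\theta|$ may be $+\infty$, in which case the inequality is vacuous. *)

theory Defs
  imports "HOL-Analysis.Analysis" "HOL-Combinatorics.Permutations"
begin

section \<open>Smooth maps and submanifolds\<close>

primrec iterated_deriv ::
  "'a list \<Rightarrow> ('a::real_normed_vector \<Rightarrow> 'b::real_normed_vector) \<Rightarrow> 'a \<Rightarrow> 'b" where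
  "iterated_deriv [] f = f"
| "iterated_deriv (d # ds) f = iterated_deriv ds (\<lambda>x. frechet_derivative f (at x) d)"

text \<open>For open \<open>S\<close> this is \<open>C\<^sup>\<infinity>\<close>: all iterated directional derivatives exist and are
  Frechet differentiable, hence continuous.\<close>

definition smooth_on ::
  "'a::real_normed_vector set \<Rightarrow> ('a \<Rightarrow> 'b::real_normed_vector) \<Rightarrow> bool" where
  "smooth_on S f \<longleftrightarrow> (\<forall>ds. \<forall>x\<in>S. iterated_deriv ds f differentiable (at x))"

text \<open>A properly embedded submanifold of an open set \<open>\<Omega>\<close> is an embedded submanifold that is
  relatively closed in \<open>\<Omega>\<close>; embedded submanifolds of real codimension \<open>m\<close> are
  locally the common zero sets of \<open>m\<close> smooth real functions with independent differentials.\<close>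

definition embedded_submanifold :: "nat \<Rightarrow> 'a::euclidean_space set \<Rightarrow> bool" where
  "embedded_submanifold m M \<longleftrightarrow>
    (\<forall>p\<in>M. \<exists>U (\<rho> :: nat \<Rightarrow> 'a \<Rightarrow> real).
       open U \<and> p \<in> U \<and> (\<forall>j<m. smooth_on U (\<rho> j)) \<and>
       M \<inter> U = {x \<in> U. \<forall>j<m. \<rho> j x = 0} \<and>
       (\<forall>c :: nat \<Rightarrow> real.
          (\<forall>v. (\<Sum>j<m. c j * frechet_derivative (\<rho> j) (at p) v) = 0) \<longrightarrow> (\<forall>j<m. c j = 0)))"

definition properly_embedded_submanifold ::
  "'a::euclidean_space set \<Rightarrow> nat \<Rightarrow> 'a set \<Rightarrow> bool" where
  "properly_embedded_submanifold \<Omega> m M \<longleftrightarrow>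
    embedded_submanifold m M \<and> closedin (top_of_set \<Omega>) M"

definition tangent_space :: "'a::real_normed_vector set \<Rightarrow> 'a \<Rightarrow> 'a set" where
  "tangent_space M p = {v. \<exists>\<gamma> :: real \<Rightarrow> 'a. \<exists>e>0.
     smooth_on {-e<..<e} \<gamma> \<and> \<gamma> ` {-e<..<e} \<subseteq> M \<and> \<gamma> 0 = p \<and> (\<gamma> has_vector_derivative v) (at 0)}"

definition generating :: "(complex ^ 'n::finite) set \<Rightarrow> bool" where
  "generating M \<longleftrightarrow>
    (\<forall>p\<in>M. {u + \<i> *s w | u w. u \<in> tangent_space M p \<and> w \<in> tangent_space M p} = UNIV)"

text \<open>Not phrased with \<^const>\<open>infdist\<close>, which is \<open>0\<close> for empty \<open>M\<close>.\<close>

definition tube :: "'a::metric_space set \<Rightarrow> real \<Rightarrow> 'a set" where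
  "tube M t = {z. \<exists>p\<in>M. dist z p < t}"


section \<open>Differential forms on \<open>\<complex>\<^sup>n\<close>\<close>

text \<open>A complex-valued alternating \<open>k\<close>-covector is a function of a sequence of tangent vectors
  that only depends on the first \<open>k\<close> of them.\<close>

type_synonym 'n covec = "(nat \<Rightarrow> complex ^ 'n) \<Rightarrow> complex"

definition alternating :: "nat \<Rightarrow> 'n::finite covec \<Rightarrow> bool" where
  "alternating k \<omega> \<longleftrightarrow>
    (\<forall>v w. (\<forall>i<k. v i = w i) \<longrightarrow> \<omega> v = \<omega> w) \<and>
    (\<forall>v. \<forall>i<k. linear (\<lambda>x. \<omega> (v(i := x)))) \<and>
    (\<forall>v. \<forall>i<k. \<forall>j<k. i \<noteq> j \<and> v i = v j \<longrightarrow> \<omega> v = 0)"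

definition wedge :: "nat \<Rightarrow> nat \<Rightarrow> 'n::finite covec \<Rightarrow> 'n covec \<Rightarrow> 'n covec" where
  "wedge k l \<omega> \<eta> = (\<lambda>v.
     (\<Sum>\<sigma> | \<sigma> permutes {..<k+l}.
        of_int (sign \<sigma>) * \<omega> (\<lambda>i. v (\<sigma> i)) * \<eta> (\<lambda>i. v (\<sigma> (k + i)))) / (fact k * fact l))"

text \<open>\<open>wedge_seq d a k\<close> is \<open>a 0 \<and> \<dots> \<and> a (k - 1)\<close>, each factor having degree \<open>d\<close>.\<close>

primrec wedge_seq :: "nat \<Rightarrow> (nat \<Rightarrow> 'n::finite covec) \<Rightarrow> nat \<Rightarrow> 'n covec" where
  "wedge_seq d a 0 = (\<lambda>v. 1)"
| "wedge_seq d a (Suc k) = wedge (d * k) d (wedge_seq d a k) (a k)"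

definition covec1 :: "(complex ^ 'n::finite \<Rightarrow> complex) \<Rightarrow> 'n covec" where
  "covec1 \<alpha> = (\<lambda>v. \<alpha> (v 0))"

definition complex_linear :: "(complex ^ 'n::finite \<Rightarrow> complex) \<Rightarrow> bool" where
  "complex_linear \<alpha> \<longleftrightarrow> Vector_Spaces.linear (*s) (*) \<alpha>"

definition complex_antilinear :: "(complex ^ 'n::finite \<Rightarrow> complex) \<Rightarrow> bool" where
  "complex_antilinear \<alpha> \<longleftrightarrow> complex_linear (\<lambda>x. cnj (\<alpha> x))"

definition of_bidegree :: "nat \<Rightarrow> nat \<Rightarrow> 'n::finite covec \<Rightarrow> bool" where
  "of_bidegree p q \<omega> \<longleftrightarrow>
    (\<exists>(N::nat) (c :: nat \<Rightarrow> complex) \<alpha>.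
       (\<forall>s<N. (\<forall>i<p. complex_linear (\<alpha> s i)) \<and> (\<forall>i<q. complex_antilinear (\<alpha> s (p + i)))) \<and>
       \<omega> = (\<lambda>v. \<Sum>s<N. c s * wedge_seq 1 (\<lambda>i. covec1 (\<alpha> s i)) (p + q) v))"

text \<open>The \<open>(1,1)\<close>-covector \<open>i \<alpha> \<and> \<alpha>\<^sup>*\<close>, where \<open>\<alpha>\<^sup>*\<close> is the complex conjugate of \<open>\<alpha>\<close>.\<close>

definition i_wedge_cnj :: "(complex ^ 'n::finite \<Rightarrow> complex) \<Rightarrow> 'n covec" where
  "i_wedge_cnj \<alpha> = (\<lambda>v. \<i> * wedge 1 1 (covec1 \<alpha>) (covec1 (\<lambda>x. cnj (\<alpha> x))) v)"

text \<open>The convex cone of strongly positive \<open>(k,k)\<close>-covectors.\<close>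

definition strongly_positive :: "nat \<Rightarrow> 'n::finite covec \<Rightarrow> bool" where
  "strongly_positive k \<omega> \<longleftrightarrow>
    (\<exists>(N::nat) (c :: nat \<Rightarrow> real) \<alpha>.
       (\<forall>s<N. c s \<ge> 0 \<and> (\<forall>j<k. complex_linear (\<alpha> s j))) \<and>
       \<omega> = (\<lambda>v. \<Sum>s<N. complex_of_real (c s) * wedge_seq 2 (\<lambda>j. i_wedge_cnj (\<alpha> s j)) k v))"

type_synonym 'n form = "complex ^ 'n \<Rightarrow> 'n covec"

definition ext_deriv :: "nat \<Rightarrow> 'n::finite form \<Rightarrow> 'n form" where
  "ext_deriv k \<omega> = (\<lambda>x v. \<Sum>i<Suc k. (-1) ^ i *
     frechet_derivative (\<lambda>y. \<omega> y (\<lambda>j. v (if j < i then j else Suc j))) (at x) (v i))"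

definition kahler_form :: "'n::finite covec" where
  "kahler_form = (\<lambda>v. \<Sum>j\<in>UNIV. i_wedge_cnj (\<lambda>z. z $ j) v)"

definition dbar :: "(complex ^ 'n::finite \<Rightarrow> complex) \<Rightarrow> 'n form" where
  "dbar f = (\<lambda>x v. (frechet_derivative f (at x) (v 0) +
                    \<i> * frechet_derivative f (at x) (\<i> *s v 0)) / 2)"

lemma wedge_1_1:
  "wedge 1 1 (covec1 \<alpha>) (covec1 \<gamma>) v = \<alpha> (v 0) * \<gamma> (v 1) - \<alpha> (v 1) * \<gamma> (v 0)"
proof -
  let ?t = "Transposition.transpose (0::nat) 1"
  have "{..<1 + (1::nat)} = {0, 1}" by auto
  then have P: "{\<sigma>. \<sigma> permutes {..<1 + (1::nat)}} = {id, ?t}"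
    by (auto simp only: permutes_doubleton_iff)
  have "id \<noteq> ?t" by (metis id_apply transpose_apply_first zero_neq_one)
  then show ?thesis
    unfolding wedge_def P by (simp add: sign_swap_id sign_id covec1_def)
qed

lemma kahler_form_expand:
  "kahler_form v = \<i> * (\<Sum>j\<in>UNIV. v 0 $ j * cnj (v 1 $ j) - v 1 $ j * cnj (v 0 $ j))"
  unfolding kahler_form_def i_wedge_cnj_def wedge_1_1 by (simp add: sum_distrib_left)

text \<open>With \<open>dbar\<close> the Cauchy-Riemann operator and \<open>\<partial>\<close> its conjugate, \<open>d = \<partial> + dbar\<close> and
  \<open>dbar \<circ> dbar = 0\<close>, so the right-hand side below is \<open>i \<partial> dbar |z|\<^sup>2\<close>.\<close>

lemma kahler_form_eq:
  fixes x :: "complex ^ 'n::finite"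
  shows "kahler_form v = \<i> * ext_deriv 1 (dbar (\<lambda>z. complex_of_real ((norm z)\<^sup>2))) x v"
proof -
  have "((\<lambda>z. complex_of_real (z \<bullet> z)) has_derivative (\<lambda>h. of_real (2 * (y \<bullet> h)))) (at y)"
    for y :: "complex ^ 'n"
    by (auto intro!: derivative_eq_intros simp: inner_commute)
  then have 1: "frechet_derivative (\<lambda>z. complex_of_real ((norm z)\<^sup>2)) (at y) =
      (\<lambda>h. of_real (2 * (y \<bullet> h)))" for y :: "complex ^ 'n"
    unfolding power2_norm_eq_inner by (rule frechet_derivative_at[symmetric])
  have 2: "complex_of_real (y \<bullet> w) + \<i> * complex_of_real (y \<bullet> (\<i> *s w)) =
      (\<Sum>j\<in>UNIV. y $ j * cnj (w $ j))" for y w :: "complex ^ 'n"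
    unfolding inner_vec_def of_real_sum sum_distrib_left sum.distrib[symmetric]
    by (rule sum.cong) (auto simp: complex_eq_iff inner_complex_def algebra_simps)
  have 3: "dbar (\<lambda>z. complex_of_real ((norm z)\<^sup>2)) =
      (\<lambda>(y :: complex ^ 'n) w. \<Sum>j\<in>UNIV. y $ j * cnj (w 0 $ j))"
    unfolding dbar_def 1 2[symmetric] by (auto simp: fun_eq_iff field_simps)
  have 4: "frechet_derivative (\<lambda>y. \<Sum>j\<in>UNIV. y $ j * cnj (w $ j)) (at x) =
      (\<lambda>h. \<Sum>j\<in>UNIV. h $ j * cnj (w $ j))" for w :: "complex ^ 'n"
    unfolding 2[symmetric]
    by (rule frechet_derivative_at[symmetric]) (auto intro!: derivative_eq_intros)
  show ?thesis
    unfolding kahler_form_expand ext_deriv_def 3 by (simp add: 4 sum_subtractf)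
qed


section \<open>Currents\<close>

definition test_function :: "'a::real_normed_vector set \<Rightarrow> ('a \<Rightarrow> real) \<Rightarrow> bool" where
  "test_function \<Omega> \<phi> \<longleftrightarrow> smooth_on UNIV \<phi> \<and>
     compact (closure {x. \<phi> x \<noteq> 0}) \<and> closure {x. \<phi> x \<noteq> 0} \<subseteq> \<Omega>"

definition form_support :: "'n::finite form \<Rightarrow> (complex ^ 'n::finite) set" where
  "form_support \<omega> = closure {x. \<exists>v. \<omega> x v \<noteq> 0}"

definition test_form :: "(complex ^ 'n::finite) set \<Rightarrow> nat \<Rightarrow> 'n form \<Rightarrow> bool" where
  "test_form \<Omega> k \<omega> \<longleftrightarrow>
     (\<forall>x. alternating k (\<omega> x)) \<and> (\<forall>v. smooth_on UNIV (\<lambda>x. \<omega> x v)) \<and>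
     compact (form_support \<omega>) \<and> form_support \<omega> \<subseteq> \<Omega>"

text \<open>Currents of degree \<open>2\<close> on \<open>\<Omega> \<subseteq> \<complex>\<^sup>n\<close> are the continuous linear functionals on the test forms of
  degree \<open>2n - 2\<close>; only the values on those matter. Continuity is sequential: supports in a fixed
  compact set and uniform convergence of all derivatives of all coefficients.\<close>

definition current2 :: "(complex ^ 'n::finite) set \<Rightarrow> ('n form \<Rightarrow> complex) \<Rightarrow> bool" where
  "current2 \<Omega> \<theta> \<longleftrightarrow>
     (let k = 2 * CARD('n) - 2 in
       (\<forall>\<omega> \<eta>. test_form \<Omega> k \<omega> \<and> test_form \<Omega> k \<eta> \<longrightarrow> \<theta> (\<lambda>x v. \<omega> x v + \<eta> x v) = \<theta> \<omega> + \<theta> \<eta>) \<and>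
       (\<forall>c \<omega>. test_form \<Omega> k \<omega> \<longrightarrow> \<theta> (\<lambda>x v. c * \<omega> x v) = c * \<theta> \<omega>) \<and>
       (\<forall>K (\<omega> :: nat \<Rightarrow> 'n form).
          compact K \<and> K \<subseteq> \<Omega> \<and> (\<forall>i. test_form \<Omega> k (\<omega> i) \<and> form_support (\<omega> i) \<subseteq> K) \<and>
          (\<forall>ds v. uniform_limit UNIV (\<lambda>i. iterated_deriv ds (\<lambda>x. \<omega> i x v)) (\<lambda>x. 0) sequentially)
          \<longrightarrow> (\<lambda>i. \<theta> (\<omega> i)) \<longlonglongrightarrow> 0))"

text \<open>A degree \<open>2\<close> current has bidegree \<open>(1,1)\<close> if only the \<open>(n-1,n-1)\<close>-component of a test form
  contributes.\<close>

definition current11 :: "(complex ^ 'n::finite) set \<Rightarrow> ('n form \<Rightarrow> complex) \<Rightarrow> bool" where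
  "current11 \<Omega> \<theta> \<longleftrightarrow> current2 \<Omega> \<theta> \<and>
     (\<forall>p q \<omega>. p + q = 2 * CARD('n) - 2 \<and> (p, q) \<noteq> (CARD('n) - 1, CARD('n) - 1) \<and>
        test_form \<Omega> (p + q) \<omega> \<and> (\<forall>x. of_bidegree p q (\<omega> x)) \<longrightarrow> \<theta> \<omega> = 0)"

definition positive_current11 :: "(complex ^ 'n::finite) set \<Rightarrow> ('n form \<Rightarrow> complex) \<Rightarrow> bool" where
  "positive_current11 \<Omega> \<theta> \<longleftrightarrow> current11 \<Omega> \<theta> \<and>
     (\<forall>\<omega>. test_form \<Omega> (2 * CARD('n) - 2) \<omega> \<and> (\<forall>x. strongly_positive (CARD('n) - 1) (\<omega> x)) \<longrightarrow>
        \<theta> \<omega> \<in> \<real>\<^sub>\<ge>\<^sub>0)"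

text \<open>\<open>d\<theta> = 0\<close>; for \<open>n = 1\<close> there are no test forms of degree \<open>2n - 3\<close> and every current is closed.\<close>

definition closed_current2 :: "(complex ^ 'n::finite) set \<Rightarrow> ('n form \<Rightarrow> complex) \<Rightarrow> bool" where
  "closed_current2 \<Omega> \<theta> \<longleftrightarrow>
     (\<forall>k \<eta>. Suc k = 2 * CARD('n) - 2 \<and> test_form \<Omega> k \<eta> \<longrightarrow> \<theta> (ext_deriv k \<eta>) = 0)"

definition closed_positive_current11 ::
  "(complex ^ 'n::finite) set \<Rightarrow> ('n form \<Rightarrow> complex) \<Rightarrow> bool" where
  "closed_positive_current11 \<Omega> \<theta> \<longleftrightarrow> positive_current11 \<Omega> \<theta> \<and> closed_current2 \<Omega> \<theta>"

text \<open>The positive Radon measure \<open>\<theta> \<and> \<beta>\<^bsup>n-1\<^esup>/(n-1)!\<close> on \<open>\<Omega>\<close>, which exists and is unique by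
  the Riesz representation theorem.\<close>

definition is_trace_measure ::
  "(complex ^ 'n::finite) set \<Rightarrow> ('n form \<Rightarrow> complex) \<Rightarrow> (complex ^ 'n) measure \<Rightarrow> bool" where
  "is_trace_measure \<Omega> \<theta> \<mu> \<longleftrightarrow>
     sets \<mu> = sets (restrict_space borel \<Omega>) \<and>
     (\<forall>K. compact K \<and> K \<subseteq> \<Omega> \<longrightarrow> emeasure \<mu> K < \<infinity>) \<and>
     (\<forall>\<phi>. test_function \<Omega> \<phi> \<longrightarrow>
        complex_of_real (\<integral>x. \<phi> x \<partial>\<mu>) =
        \<theta> (\<lambda>x v. complex_of_real (\<phi> x) *
              (wedge_seq 2 (\<lambda>_. kahler_form) (CARD('n) - 1) v / fact (CARD('n) - 1))))"

definition trace_measure ::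
  "(complex ^ 'n::finite) set \<Rightarrow> ('n form \<Rightarrow> complex) \<Rightarrow> (complex ^ 'n) measure" where
  "trace_measure \<Omega> \<theta> = (THE \<mu>. is_trace_measure \<Omega> \<theta> \<mu>)"

end

theory Submission
  imports Defs
begin

text \<open>
  Near a point of \<open>M\<close> let \<open>q\<^sub>j\<close>, \<open>j < m\<close>, be compactly supported smooth real functions that define
  \<open>M\<close> there, put \<open>S = (\<Sum>q\<^sub>j\<^sup>2 + t\<^sup>2)\<^bsup>1/2\<^esup>\<close> and \<open>v = A |z|\<^sup>2 + S - t\<close>. By the Cauchy-Schwarz inequality
  the Levi form of \<open>S\<close> is at least \<open>(t\<^sup>2/S\<^sup>3) \<Sum>|\<partial>q\<^sub>j|\<^sup>2\<close> up to a multiple of \<open>\<beta>\<close> that does not depend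
  on \<open>t\<close>, so \<open>v\<close> is plurisubharmonic for a suitable \<open>A\<close>. Since \<open>S - t\<close> has compact support,
  \<open>(i\<partial>\<partial>\<^bsup>-\<^esup>v)\<^bsup>n-1\<^esup> - (A\<beta>)\<^bsup>n-1\<^esup>\<close> is the exterior derivative of a test form and the closed current
  \<open>\<theta>\<close> annihilates it. Because \<open>M\<close> is generating, the covectors \<open>\<partial>q\<^sub>j\<close> are linearly independent over
  the complex numbers. Any \<open>n - 1\<close> members of a frame of covectors containing them include at least
  \<open>m - 1\<close> of them, and \<open>t\<^sup>2/S\<^sup>3\<close> is comparable to \<open>1/t\<close> on the tube, whence
  \<open>(i\<partial>\<partial>\<^bsup>-\<^esup>v)\<^bsup>n-1\<^esup> \<ge> c t\<^bsup>1-m\<^esup> \<beta>\<^bsup>n-1\<^esup>\<close> there, while the left-hand side is nonnegative everywhere.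
  Positivity of \<open>\<theta>\<close> turns this into the estimate near the point, and compactness of \<open>M\<close> in smaller
  balls does the rest. For \<open>m \<le> 1\<close> the estimate is monotonicity of the trace measure.
\<close>

section \<open>Calculus of smooth functions\<close>

text \<open>\<open>trace_measure\<close> is a definite description, so no estimate can start before
  existence and uniqueness of a Radon measure are known. The functional lives on smooth functions
  only, which is why the Riesz theorem is built on covers by smooth test functions. Two descriptions
  of i\<partial>\<partial>bar u compete: positivity wants a Hermitian form, exactness wants the
  derivative of an explicit one-form. Exterior products are therefore alternating sums of products
  of arbitrary bilinear forms; only the antisymmetric part of each factor matters, which makes the
  two descriptions interchangeable. A current on the ball can be tested only on compactly supported
  forms, so the defining functions of M are cut off. Where the cutoff spoils transversality, the
  lower bound degrades to nonnegativity. Where the potential vanishes, the power equals that of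
  A\<beta> exactly, so the comparison costs only A^(n-1) times the mass of a slightly larger ball.
  That ball lies in the tube of radius t0, and this is how |\<theta>| enters.\<close>

primrec diff_upto ::
  "nat \<Rightarrow> 'a::real_normed_vector set \<Rightarrow> ('a \<Rightarrow> 'b::real_normed_vector) \<Rightarrow> bool" where
  "diff_upto 0 S f \<longleftrightarrow> (\<forall>x\<in>S. f differentiable at x)"
| "diff_upto (Suc k) S f \<longleftrightarrow> (\<forall>x\<in>S. f differentiable at x) \<and>
     (\<forall>d. diff_upto k S (\<lambda>x. frechet_derivative f (at x) d))"

text \<open>\<open>iterated_deriv\<close> peels directions from the head of the list, so fixing the
  length turns smoothness into a recursion on the order. Closure properties are proved at each
  order: the derivative of a product or composite again contains the original functions, at one
  order less.\<close>

lemma diff_upto_iff: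
  "diff_upto k S f \<longleftrightarrow> (\<forall>ds. length ds \<le> k \<longrightarrow> (\<forall>x\<in>S. iterated_deriv ds f differentiable at x))"
proof (induction k arbitrary: f)
  case 0
  then show ?case by simp
next
  case (Suc k)
  show ?case
    unfolding diff_upto.simps Suc
  proof safe
    fix ds :: "'a list" and x
    assume "\<forall>x\<in>S. f differentiable at x" "length ds \<le> Suc k" "x \<in> S"
      "\<forall>d ds. length ds \<le> k \<longrightarrow> (\<forall>x\<in>S. iterated_deriv ds (\<lambda>x. frechet_derivative f (at x) d) differentiable at x)"
    then show "iterated_deriv ds f differentiable at x"
      by (cases ds) auto
  next
    fix x assume "\<forall>ds. length ds \<le> Suc k \<longrightarrow> (\<forall>x\<in>S. iterated_deriv ds f differentiable at x)" "x \<in> S"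
    then show "f differentiable at x" by (metis iterated_deriv.simps(1) le0 list.size(3))
  next
    fix d x and ds :: "'a list"
    assume *: "\<forall>ds. length ds \<le> Suc k \<longrightarrow> (\<forall>x\<in>S. iterated_deriv ds f differentiable at x)"
      "x \<in> S" "length ds \<le> k"
    then show "iterated_deriv ds (\<lambda>x. frechet_derivative f (at x) d) differentiable at x"
      using *(1)[rule_format, of "d # ds" x] by simp
  qed
qed

lemma smooth_on_iff_diff_upto: "smooth_on S f \<longleftrightarrow> (\<forall>k. diff_upto k S f)"
  unfolding smooth_on_def diff_upto_iff by blast

lemma diff_upto_differentiable: "diff_upto k S f \<Longrightarrow> x \<in> S \<Longrightarrow> f differentiable at x"
  by (cases k) auto

lemma diff_upto_Suc_D: "diff_upto (Suc k) S f \<Longrightarrow> diff_upto k S f"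
  unfolding diff_upto_iff by auto

lemma diff_upto_subset: "diff_upto k T f \<Longrightarrow> S \<subseteq> T \<Longrightarrow> diff_upto k S f"
  unfolding diff_upto_iff by blast

text \<open>Derivatives at points of an open set depend only on the values there. This permits
  replacing \<open>frechet_derivative\<close> by an explicit formula valid on \<open>S\<close>
  alone.\<close>

lemma diff_upto_cong:
  assumes "open S" "\<And>x. x \<in> S \<Longrightarrow> f x = g x" "diff_upto k S f"
  shows "diff_upto k S g"
  using assms(2,3)
proof (induction k arbitrary: f g)
  case 0
  then show ?case
    using assms(1) unfolding diff_upto.simps differentiable_def
    by (metis has_derivative_transform_within_open)
next
  case (Suc k)
  have "g differentiable at x" if "x \<in> S" for x
    using Suc.prems that assms(1) unfolding diff_upto.simps differentiable_def
    by (metis has_derivative_transform_within_open)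
  moreover have "diff_upto k S (\<lambda>x. frechet_derivative g (at x) d)" for d
  proof (rule Suc.IH)
    show "diff_upto k S (\<lambda>x. frechet_derivative f (at x) d)" using Suc.prems by simp
    show "frechet_derivative f (at x) d = frechet_derivative g (at x) d" if "x \<in> S" for x
      using frechet_derivative_transform_within_open[OF diff_upto_differentiable[OF Suc.prems(2) that] assms(1) that Suc.prems(1)]
      by simp
  qed
  ultimately show ?case by simp
qed

text \<open>The induction step behind all closure properties: exhibit some derivative on
  \<open>S\<close> and check its directional values at one order less.\<close>

lemma diff_upto_SucI:
  assumes "open S" "\<And>x. x \<in> S \<Longrightarrow> (f has_derivative f' x) (at x)" "\<And>d. diff_upto k S (\<lambda>x. f' x d)"
  shows "diff_upto (Suc k) S f"
  unfolding diff_upto.simps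
proof (intro conjI ballI allI)
  show "f differentiable at x" if "x \<in> S" for x using assms(2)[OF that] by (auto simp: differentiable_def)
  show "diff_upto k S (\<lambda>x. frechet_derivative f (at x) d)" for d
    by (rule diff_upto_cong[OF assms(1) _ assms(3)]) (simp add: frechet_derivative_at[OF assms(2), symmetric])
qed

lemma diff_upto_has_derivative:
  "diff_upto k S f \<Longrightarrow> x \<in> S \<Longrightarrow> (f has_derivative frechet_derivative f (at x)) (at x)"
  using diff_upto_differentiable frechet_derivative_works by blast

lemma diff_upto_const: "diff_upto k S (\<lambda>x. c)"
  by (induction k arbitrary: c) auto

lemma diff_upto_bounded_linear:
  assumes "bounded_linear f"
  shows "diff_upto k S f"
proof -
  have "(f has_derivative f) (at x)" for x using assms by (rule bounded_linear_imp_has_derivative)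
  then have "f differentiable at x" "frechet_derivative f (at x) = f" for x
    by (auto simp: differentiable_def frechet_derivative_at[symmetric])
  then show ?thesis by (cases k) (auto simp: diff_upto_const)
qed

lemma diff_upto_add:
  assumes "open S" "diff_upto k S f" "diff_upto k S g"
  shows "diff_upto k S (\<lambda>x. f x + g x)"
  using assms(2,3)
proof (induction k arbitrary: f g)
  case (Suc k)
  note D = diff_upto_has_derivative[OF Suc.prems(1)] diff_upto_has_derivative[OF Suc.prems(2)]
  show ?case
    by (rule diff_upto_SucI[OF assms(1) has_derivative_add[OF D]]) (use Suc in auto)
qed auto

text \<open>Leibniz rule: in each of the two terms one factor is differentiated and the other merely
  loses an order, so the induction hypothesis applies to both. The bilinear form covers real and
  complex products, inner products and scalar multiplication at once.\<close>

lemma diff_upto_bilinear: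
  assumes "bounded_bilinear prd" "open S" "diff_upto k S f" "diff_upto k S g"
  shows "diff_upto k S (\<lambda>x. prd (f x) (g x))"
  using assms(3,4)
proof (induction k arbitrary: f g)
  case 0
  then show ?case
    unfolding diff_upto.simps differentiable_def by (blast intro: bounded_bilinear.FDERIV[OF assms(1)])
next
  case (Suc k)
  note D = diff_upto_has_derivative[OF Suc.prems(1)] diff_upto_has_derivative[OF Suc.prems(2)]
  show ?case
  proof (rule diff_upto_SucI[OF assms(2) bounded_bilinear.FDERIV[OF assms(1) D]])
    fix d
    have "diff_upto k S (\<lambda>x. frechet_derivative f (at x) d)" "diff_upto k S (\<lambda>x. frechet_derivative g (at x) d)"
      using Suc.prems by simp_all
    then show "diff_upto k S (\<lambda>x. prd (f x) (frechet_derivative g (at x) d) + prd (frechet_derivative f (at x) d) (g x))"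
      using Suc.prems[THEN diff_upto_Suc_D] by (intro diff_upto_add[OF assms(2)] Suc.IH)
  qed
qed

text \<open>With a scalar outer function the chain rule is a product of \<open>g\<close>'s
  derivative and a number, and that number is again a composite with \<open>g\<close>, now of the
  derivative of \<open>F\<close>.\<close>

lemma diff_upto_compose:
  fixes F :: "real \<Rightarrow> real"
  assumes "open S" "open T" "diff_upto k T F" "diff_upto k S g" "g ` S \<subseteq> T"
  shows "diff_upto k S (\<lambda>x. F (g x))"
  using assms(3,4)
proof (induction k arbitrary: F)
  case 0
  show ?case
    unfolding diff_upto.simps
  proof
    fix x assume "x \<in> S"
    then have "g differentiable at x" "F differentiable at (g x)"
      using 0 assms(5) by auto
    then show "(\<lambda>x. F (g x)) differentiable at x"
      using differentiable_compose[of F g x UNIV] by simp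
  qed
next
  case (Suc k)
  have D: "((\<lambda>x. F (g x)) has_derivative
      (\<lambda>d. frechet_derivative F (at (g x)) 1 * frechet_derivative g (at x) d)) (at x)" if "x \<in> S" for x
  proof -
    have 1: "(F has_derivative frechet_derivative F (at (g x))) (at (g x))"
      using diff_upto_has_derivative[OF Suc.prems(1), of "g x"] that assms(5) by blast
    have "linear (frechet_derivative F (at (g x)))" using has_derivative_linear[OF 1] .
    then have "frechet_derivative F (at (g x)) y = frechet_derivative F (at (g x)) 1 * y" for y
      using linear_scale[of "frechet_derivative F (at (g x))" y 1] by (simp add: mult.commute)
    then have "(\<lambda>d. frechet_derivative F (at (g x)) (frechet_derivative g (at x) d)) =
        (\<lambda>d. frechet_derivative F (at (g x)) 1 * frechet_derivative g (at x) d)" by blast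
    then show ?thesis
      using has_derivative_compose[OF diff_upto_has_derivative[OF Suc.prems(2) that] 1] by argo
  qed
  show ?case
  proof (rule diff_upto_SucI[OF assms(1) D])
    fix d
    have "diff_upto k S (\<lambda>x. frechet_derivative F (at (g x)) 1)"
      using Suc.IH[of "\<lambda>y. frechet_derivative F (at y) 1", OF _ diff_upto_Suc_D[OF Suc.prems(2)]] Suc.prems(1) by simp
    then show "diff_upto k S (\<lambda>x. frechet_derivative F (at (g x)) 1 * frechet_derivative g (at x) d)"
      using Suc.prems(2) by (intro diff_upto_bilinear[OF bounded_bilinear_mult] assms) simp_all
  qed
qed

section \<open>Smooth functions: localisation and algebra\<close>

lemma smooth_on_differentiable: "smooth_on S f \<Longrightarrow> x \<in> S \<Longrightarrow> f differentiable at x"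
  using diff_upto_differentiable smooth_on_iff_diff_upto by blast

lemma smooth_on_has_derivative:
  "smooth_on S f \<Longrightarrow> x \<in> S \<Longrightarrow> (f has_derivative frechet_derivative f (at x)) (at x)"
  using frechet_derivative_works smooth_on_differentiable by blast

lemma smooth_on_isCont: "smooth_on S f \<Longrightarrow> x \<in> S \<Longrightarrow> isCont f x"
  using smooth_on_differentiable differentiable_imp_continuous_within by blast

lemma smooth_on_continuous_on: "smooth_on S f \<Longrightarrow> continuous_on S f"
  by (meson continuous_at_imp_continuous_on smooth_on_isCont)

lemma smooth_on_deriv: "smooth_on S f \<Longrightarrow> smooth_on S (\<lambda>x. frechet_derivative f (at x) d)"
  unfolding smooth_on_iff_diff_upto by (metis diff_upto.simps(2))

lemma smooth_on_subset: "smooth_on T f \<Longrightarrow> S \<subseteq> T \<Longrightarrow> smooth_on S f"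
  unfolding smooth_on_def by blast

lemma smooth_on_Un: "smooth_on S f \<Longrightarrow> smooth_on T f \<Longrightarrow> smooth_on (S \<union> T) f"
  unfolding smooth_on_def by blast

lemma smooth_on_cong: "open S \<Longrightarrow> (\<And>x. x \<in> S \<Longrightarrow> f x = g x) \<Longrightarrow> smooth_on S f \<Longrightarrow> smooth_on S g"
  unfolding smooth_on_iff_diff_upto using diff_upto_cong by blast

lemma smooth_on_const: "smooth_on S (\<lambda>x. c)"
  unfolding smooth_on_iff_diff_upto by (simp add: diff_upto_const)

lemma smooth_on_bounded_linear: "bounded_linear f \<Longrightarrow> smooth_on S f"
  unfolding smooth_on_iff_diff_upto by (simp add: diff_upto_bounded_linear)

lemma smooth_on_ident: "smooth_on S (\<lambda>x. x)"
  by (rule smooth_on_bounded_linear[OF bounded_linear_ident])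

lemma smooth_on_add:
  "open S \<Longrightarrow> smooth_on S f \<Longrightarrow> smooth_on S g \<Longrightarrow> smooth_on S (\<lambda>x. f x + g x)"
  unfolding smooth_on_iff_diff_upto by (simp add: diff_upto_add)

lemma smooth_on_bilinear:
  "bounded_bilinear prd \<Longrightarrow> open S \<Longrightarrow> smooth_on S f \<Longrightarrow> smooth_on S g \<Longrightarrow>
    smooth_on S (\<lambda>x. prd (f x) (g x))"
  unfolding smooth_on_iff_diff_upto by (simp add: diff_upto_bilinear)

lemma smooth_on_mult:
  fixes f g :: "'a::real_normed_vector \<Rightarrow> 'b::real_normed_algebra"
  shows "open S \<Longrightarrow> smooth_on S f \<Longrightarrow> smooth_on S g \<Longrightarrow> smooth_on S (\<lambda>x. f x * g x)"
  using smooth_on_bilinear[OF bounded_bilinear_mult, of S f g] by blast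

lemma smooth_on_compose:
  fixes F :: "real \<Rightarrow> real"
  shows "open S \<Longrightarrow> open T \<Longrightarrow> smooth_on T F \<Longrightarrow> smooth_on S g \<Longrightarrow> g ` S \<subseteq> T \<Longrightarrow>
    smooth_on S (\<lambda>x. F (g x))"
  unfolding smooth_on_iff_diff_upto using diff_upto_compose by blast

lemma smooth_on_linear_compose:
  assumes "bounded_linear L" "open S" "smooth_on S f"
  shows "smooth_on S (\<lambda>x. L (f x))"
proof -
  \<comment> \<open>Scaling by the constant function 1 turns a linear map into a bilinear
    operation.\<close>
  have "bounded_bilinear (\<lambda>(r::real) y. r *\<^sub>R L y)"
    using bounded_bilinear.comp[OF bounded_bilinear_scaleR bounded_linear_ident assms(1)] .
  from smooth_on_bilinear[OF this assms(2) smooth_on_const[of S 1] assms(3)] show ?thesis by simp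
qed

lemma smooth_on_minus: "open S \<Longrightarrow> smooth_on S f \<Longrightarrow> smooth_on S (\<lambda>x. - f x)"
  by (rule smooth_on_linear_compose[OF bounded_linear_minus[OF bounded_linear_ident]])

lemma smooth_on_diff:
  "open S \<Longrightarrow> smooth_on S f \<Longrightarrow> smooth_on S g \<Longrightarrow> smooth_on S (\<lambda>x. f x - g x)"
  using smooth_on_add[OF _ _ smooth_on_minus, of S f g] by simp

lemma smooth_on_of_real:
  fixes f :: "'a::real_normed_vector \<Rightarrow> real"
  shows "open S \<Longrightarrow> smooth_on S f \<Longrightarrow>
    smooth_on S (\<lambda>x. of_real (f x) :: 'b::{real_normed_algebra_1})"
  by (rule smooth_on_linear_compose[OF bounded_linear_of_real])

lemma smooth_on_sum:
  "open S \<Longrightarrow> (\<And>i. i \<in> I \<Longrightarrow> smooth_on S (f i)) \<Longrightarrow> smooth_on S (\<lambda>x. \<Sum>i\<in>I. f i x)"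
  by (induction I rule: infinite_finite_induct) (auto simp: smooth_on_const intro!: smooth_on_add)

lemma smooth_on_prod:
  fixes f :: "'i \<Rightarrow> 'a::real_normed_vector \<Rightarrow> 'b::{real_normed_algebra_1,comm_ring_1}"
  shows "open S \<Longrightarrow> (\<And>i. i \<in> I \<Longrightarrow> smooth_on S (f i)) \<Longrightarrow> smooth_on S (\<lambda>x. \<Prod>i\<in>I. f i x)"
  by (induction I rule: infinite_finite_induct) (auto simp: smooth_on_const intro!: smooth_on_mult)

lemma smooth_on_power:
  fixes f :: "'a::real_normed_vector \<Rightarrow> 'b::{real_normed_algebra_1}"
  shows "open S \<Longrightarrow> smooth_on S f \<Longrightarrow> smooth_on S (\<lambda>x. f x ^ n)"
  by (induction n) (auto simp: smooth_on_const intro!: smooth_on_mult)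

text \<open>The derivative of \<open>inverse\<close> is minus a product of two copies of
  \<open>inverse\<close>, so differentiability to order k of the function yields order k + 1. The
  square root is treated the same way, its derivative being half its own reciprocal.\<close>

lemma smooth_on_inverse_real: "smooth_on {0<..} (inverse :: real \<Rightarrow> real)"
proof -
  have "diff_upto k {0<..} (inverse :: real \<Rightarrow> real)" for k
  proof (induction k)
    case 0
    then show ?case by (auto intro: differentiable_inverse)
  next
    case (Suc k)
    show ?case
    proof (rule diff_upto_SucI)
      show "(inverse has_derivative (\<lambda>h. - (inverse x * h * inverse x))) (at x)" if "x \<in> {0<..}" for x :: real
        using that by (intro has_derivative_inverse') auto
      have "diff_upto k {0<..} (\<lambda>x. (- d) * (inverse x * inverse x))" for d :: real
        by (intro diff_upto_bilinear[OF bounded_bilinear_mult] diff_upto_const Suc) auto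
      then show "diff_upto k {0<..} (\<lambda>x. - (inverse x * d * inverse x))" for d :: real
        by (simp add: algebra_simps)
    qed auto
  qed
  then show ?thesis unfolding smooth_on_iff_diff_upto by blast
qed

lemma smooth_on_inverse:
  fixes f :: "'a::real_normed_vector \<Rightarrow> real"
  shows "open S \<Longrightarrow> smooth_on S f \<Longrightarrow> (\<And>x. x \<in> S \<Longrightarrow> f x > 0) \<Longrightarrow> smooth_on S (\<lambda>x. inverse (f x))"
  by (rule smooth_on_compose[OF _ _ smooth_on_inverse_real]) auto

lemma smooth_on_sqrt_real: "smooth_on {0<..} sqrt"
proof -
  have "diff_upto k {0<..} sqrt" for k
  proof (induction k)
    case 0
    then show ?case by (auto simp: real_differentiable_def intro: DERIV_real_sqrt)
  next
    case (Suc k)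
    show ?case
    proof (rule diff_upto_SucI)
      show "(sqrt has_derivative (*) (inverse (sqrt x) / 2)) (at x)" if "x \<in> {0<..}" for x :: real
        using DERIV_real_sqrt[of x] that unfolding has_field_derivative_def by simp
      have 1: "diff_upto k {0<..} (\<lambda>x::real. inverse (sqrt x))"
        using smooth_on_inverse_real unfolding smooth_on_iff_diff_upto
        by (intro diff_upto_compose[OF _ open_greaterThan _ Suc]) auto
      have "diff_upto k {0<..} (\<lambda>x. inverse (sqrt x) * (1 / 2 * d))" for d :: real
        by (intro diff_upto_bilinear[OF bounded_bilinear_mult] diff_upto_const 1) auto
      then show "diff_upto k {0<..} (\<lambda>x. inverse (sqrt x) / 2 * d)" for d :: real
        by (simp add: algebra_simps)
    qed auto
  qed
  then show ?thesis unfolding smooth_on_iff_diff_upto by blast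
qed

lemma smooth_on_sqrt:
  fixes f :: "'a::real_normed_vector \<Rightarrow> real"
  shows "open S \<Longrightarrow> smooth_on S f \<Longrightarrow> (\<And>x. x \<in> S \<Longrightarrow> f x > 0) \<Longrightarrow> smooth_on S (\<lambda>x. sqrt (f x))"
  by (rule smooth_on_compose[OF _ _ smooth_on_sqrt_real]) auto

lemma smooth_on_norm_diff_sq:
  fixes p :: "'a::real_inner"
  shows "smooth_on S (\<lambda>x. (norm (x - p))\<^sup>2)"
proof (rule smooth_on_subset)
  have 1: "smooth_on UNIV (\<lambda>x::'a. x - p)"
    by (intro smooth_on_diff smooth_on_const smooth_on_ident) auto
  show "smooth_on UNIV (\<lambda>x. (norm (x - p))\<^sup>2)"
    unfolding power2_norm_eq_inner by (intro smooth_on_bilinear[OF bounded_bilinear_inner] 1) auto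
qed auto

section \<open>Flat functions, smooth steps and smooth bumps\<close>

definition flat_exp :: "nat \<Rightarrow> real \<Rightarrow> real" where
  "flat_exp n s = (if s \<le> 0 then 0 else inverse s ^ n * exp (- inverse s))"

text \<open>Differentiation only raises the power of 1/s in front of exp(-1/s). The family over all
  \<open>n\<close> is therefore closed under derivatives, and smoothness of all members follows by
  one induction on the order.\<close>

lemma flat_exp_has_derivative:
  "(flat_exp n has_derivative (\<lambda>h. (flat_exp (n + 2) s - n * flat_exp (n + 1) s) * h)) (at s)"
proof (cases s "0::real" rule: linorder_cases)
  case less
  have "((\<lambda>_. 0) has_derivative (\<lambda>h. 0)) (at s)" by simp
  then have "(flat_exp n has_derivative (\<lambda>h. 0)) (at s)"
    by (rule has_derivative_transform_within_open[of _ _ _ _ "{..<0}"]) (use less in \<open>auto simp: flat_exp_def\<close>)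
  then show ?thesis using less by (simp add: flat_exp_def)
next
  case greater
  have "((\<lambda>s. inverse s ^ n * exp (- inverse s)) has_real_derivative
      (real n * inverse s ^ (n - 1) * - (inverse s * inverse s)) * exp (- inverse s) +
      inverse s ^ n * (exp (- inverse s) * (inverse s * inverse s))) (at s)"
    using greater by (auto intro!: derivative_eq_intros)
  also have "(real n * inverse s ^ (n - 1) * - (inverse s * inverse s)) * exp (- inverse s) +
      inverse s ^ n * (exp (- inverse s) * (inverse s * inverse s)) =
      flat_exp (n + 2) s - n * flat_exp (n + 1) s"
    using greater by (cases n) (simp_all add: flat_exp_def algebra_simps)
  finally have "((\<lambda>s. inverse s ^ n * exp (- inverse s)) has_real_derivative
      (flat_exp (n + 2) s - n * flat_exp (n + 1) s)) (at s)" .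
  then have "((\<lambda>s. inverse s ^ n * exp (- inverse s)) has_derivative
      (\<lambda>h. (flat_exp (n + 2) s - n * flat_exp (n + 1) s) * h)) (at s)"
    by (simp add: has_field_derivative_def)
  then show ?thesis
    by (rule has_derivative_transform_within_open[of _ _ _ _ "{0<..}"]) (use greater in \<open>auto simp: flat_exp_def\<close>)
next
  case equal
  \<comment> \<open>With y = 1/h the difference quotient at 0 from the right is y^(n+1) / exp
    y.\<close>
  have "((\<lambda>y::real. y ^ Suc n / exp y) \<longlongrightarrow> 0) at_top" by (rule tendsto_power_div_exp_0)
  then have "((\<lambda>h::real. inverse h ^ Suc n / exp (inverse h)) \<longlongrightarrow> 0) (at_right 0)"
    using filterlim_inverse_at_top_right by (rule filterlim_compose)
  then have R: "((\<lambda>h. flat_exp n h / h) \<longlongrightarrow> 0) (at_right 0)"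
    by (rule Lim_transform_eventually)
       (auto simp: eventually_at_filter flat_exp_def exp_minus field_simps)
  have L: "((\<lambda>h. flat_exp n h / h) \<longlongrightarrow> 0) (at_left 0)"
    by (rule Lim_transform_eventually[of "\<lambda>_. 0"]) (auto simp: eventually_at_filter flat_exp_def)
  have "(flat_exp n has_real_derivative 0) (at 0)"
    unfolding DERIV_def using filterlim_split_at[OF L R] by (simp add: flat_exp_def)
  then show ?thesis using equal by (simp add: flat_exp_def has_field_derivative_def lambda_zero)
qed

lemma smooth_on_flat_exp: "smooth_on S (flat_exp n)"
proof -
  have "diff_upto k UNIV (flat_exp n)" for k
  proof (induction k arbitrary: n)
    case 0
    then show ?case using flat_exp_has_derivative by (auto simp: differentiable_def)
  next
    case (Suc k)
    have "diff_upto k UNIV (\<lambda>s. (flat_exp (n + 2) s + (- real n) * flat_exp (n + 1) s) * d)" for d :: real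
      by (intro diff_upto_bilinear[OF bounded_bilinear_mult] diff_upto_add diff_upto_const Suc) auto
    then show ?case
      by (intro diff_upto_SucI[OF _ flat_exp_has_derivative]) auto
  qed
  then show ?thesis using diff_upto_subset unfolding smooth_on_iff_diff_upto by blast
qed

lemma flat_exp_nonneg: "flat_exp n s \<ge> 0" and flat_exp_pos: "s > 0 \<Longrightarrow> flat_exp n s > 0"
  by (auto simp: flat_exp_def)

text \<open>The quotient f(s-a) / (f(s-a) + f(b-s)) for a flat function f. Its denominator is
  positive because a < b makes at least one of the two arguments positive.\<close>

lemma smooth_step_exists:
  fixes a b :: real
  assumes "a < b"
  obtains S where "smooth_on UNIV S" "\<And>s. 0 \<le> S s" "\<And>s. S s \<le> (1::real)"
    "\<And>s. s \<le> a \<Longrightarrow> S s = 0" "\<And>s. b \<le> s \<Longrightarrow> S s = 1"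
proof -
  define f where "f = flat_exp 0"
  define S where "S s = f (s - a) * inverse (f (s - a) + f (b - s))" for s
  have pos: "f (s - a) + f (b - s) > 0" for s
  proof (cases "s > a")
    case True
    then show ?thesis using flat_exp_pos[of "s - a" 0] flat_exp_nonneg[of 0 "b - s"] by (simp add: f_def)
  next
    case False
    then show ?thesis using assms flat_exp_pos[of "b - s" 0] flat_exp_nonneg[of 0 "s - a"] by (simp add: f_def)
  qed
  have sm: "smooth_on UNIV (\<lambda>s. f (s - a))" "smooth_on UNIV (\<lambda>s. f (b - s))"
    unfolding f_def
    by (rule smooth_on_compose[OF open_UNIV open_UNIV smooth_on_flat_exp smooth_on_diff[OF open_UNIV]],
        simp_all add: smooth_on_ident smooth_on_const)+
  show thesis
  proof
    show "smooth_on UNIV S"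
      unfolding S_def by (intro smooth_on_mult smooth_on_inverse smooth_on_add sm pos) auto
    show "0 \<le> S s" for s
      using pos[of s] flat_exp_nonneg by (simp add: S_def f_def)
    show "S s \<le> 1" for s
      using pos[of s] flat_exp_nonneg[of 0] by (simp add: S_def f_def field_simps)
    show "S s = 0" if "s \<le> a" for s
      using that by (simp add: S_def f_def flat_exp_def)
    show "S s = 1" if "b \<le> s" for s
      using that pos[of s] by (simp add: S_def f_def flat_exp_def)
  qed
qed

lemma smooth_bump_exists:
  fixes p :: "'a::euclidean_space"
  assumes "0 < a" "a < b"
  obtains h where "smooth_on UNIV h" "\<And>x. 0 \<le> h x" "\<And>x. h x \<le> (1::real)"
    "\<And>x. dist p x \<le> a \<Longrightarrow> h x = 1" "\<And>x. b \<le> dist p x \<Longrightarrow> h x = 0"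
    "closure {x. h x \<noteq> 0} \<subseteq> cball p b"
proof -
  from assms have "a\<^sup>2 < b\<^sup>2" by (simp add: power_strict_mono)
  then obtain S where S: "smooth_on UNIV S" "\<And>s. 0 \<le> S s" "\<And>s. S s \<le> (1::real)"
    "\<And>s. s \<le> a\<^sup>2 \<Longrightarrow> S s = 0" "\<And>s. b\<^sup>2 \<le> s \<Longrightarrow> S s = 1"
    using smooth_step_exists by blast
  \<comment> \<open>The squared distance is used because the norm itself is not differentiable at
    \<open>p\<close>.\<close>
  define h where "h x = 1 - S ((norm (x - p))\<^sup>2)" for x
  have z: "h x = 0" if "b \<le> dist p x" for x
    using that assms S(5)[of "(norm (x - p))\<^sup>2"] by (simp add: h_def dist_norm norm_minus_commute power_mono)
  show thesis
  proof
    show "smooth_on UNIV h"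
      unfolding h_def
      by (intro smooth_on_diff smooth_on_const smooth_on_compose[OF _ _ S(1)] smooth_on_norm_diff_sq) auto
    show "0 \<le> h x" "h x \<le> 1" for x using S(2,3) by (auto simp: h_def)
    show "h x = 1" if "dist p x \<le> a" for x
      using that assms S(4)[of "(norm (x - p))\<^sup>2"] by (simp add: h_def dist_norm norm_minus_commute power_mono)
    show "closure {x. h x \<noteq> 0} \<subseteq> cball p b"
    proof (rule closure_minimal)
      show "{x. h x \<noteq> 0} \<subseteq> cball p b"
        using z by (metis (mono_tags, lifting) linear mem_Collect_eq mem_cball subsetI)
    qed simp
  qed (rule z)
qed

text \<open>Second difference quotients of \<open>u\<close> along \<open>a\<close> and \<open>b\<close> are symmetric and converge to the mixed derivative.\<close>

lemma second_difference_tendsto: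
  fixes u :: "'a::real_normed_vector \<Rightarrow> real"
  assumes S: "open S" "x \<in> S" and d1: "\<And>y. y \<in> S \<Longrightarrow> u differentiable at y"
    and d2: "(\<lambda>y. frechet_derivative u (at y) a) differentiable at x"
  shows "((\<lambda>h. (u (x + h *\<^sub>R a + h *\<^sub>R b) - u (x + h *\<^sub>R a) - u (x + h *\<^sub>R b) + u x) / h\<^sup>2)
    \<longlongrightarrow> frechet_derivative (\<lambda>y. frechet_derivative u (at y) a) (at x) b) (at_right 0)"
proof -
  define g where "g y = frechet_derivative u (at y) a" for y
  define G where "G = frechet_derivative g (at x)"
  have G: "(g has_derivative G) (at x)"
    using d2 frechet_derivative_works unfolding G_def g_def by blast
  interpret G: linear G using G has_derivative_linear by blast
  define N where "N = norm a + norm b + 1"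
  have N: "N > 0" by (simp add: N_def add_nonneg_pos)
  obtain r where r: "r > 0" "ball x r \<subseteq> S" using S openE by blast
  show ?thesis
    unfolding g_def[symmetric] G_def[symmetric]
  proof (rule tendstoI)
    fix e :: real assume "e > 0"
    \<comment> \<open>Two errors of size e' * h * N occur below; they add up to h * e/2.\<close>
    define e' where "e' = e / (4 * N)"
    have "e' > 0" using \<open>e > 0\<close> N by (simp add: e'_def)
    then obtain d where d: "d > 0" "\<And>y. norm (y - x) < d \<Longrightarrow> norm (g y - g x - G (y - x)) \<le> e' * norm (y - x)"
      using G unfolding has_derivative_at_alt by blast
    define \<delta> where "\<delta> = min r d / N"
    have "\<delta> > 0" using r d N by (simp add: \<delta>_def)
    show "\<forall>\<^sub>F h in at_right 0. dist ((u (x + h *\<^sub>R a + h *\<^sub>R b) - u (x + h *\<^sub>R a) - u (x + h *\<^sub>R b) + u x) / h\<^sup>2) (G b) < e"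
    proof (rule eventually_at_rightI[OF _ \<open>\<delta> > 0\<close>])
      fix h assume h: "h \<in> {0<..<\<delta>}"
      then have hN: "h * N < min r d" using N by (simp add: \<delta>_def field_simps)
      have small: "norm (s *\<^sub>R a + c *\<^sub>R b) \<le> h * N" if "0 \<le> s" "s \<le> h" "0 \<le> c" "c \<le> h" for s c
      proof -
        have "norm (s *\<^sub>R a + c *\<^sub>R b) \<le> s * norm a + c * norm b"
          using norm_triangle_ineq[of "s *\<^sub>R a" "c *\<^sub>R b"] that by simp
        also have "\<dots> \<le> h * norm a + h * norm b" using that by (intro add_mono mult_right_mono) auto
        also have "\<dots> \<le> h * N" using h by (simp add: N_def algebra_simps)
        finally show ?thesis .
      qed
      have inS: "x + s *\<^sub>R a + c *\<^sub>R b \<in> S" if "0 \<le> s" "s \<le> h" "0 \<le> c" "c \<le> h" for s c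
      proof -
        have "dist x (x + s *\<^sub>R a + c *\<^sub>R b) = norm (s *\<^sub>R a + c *\<^sub>R b)"
          by (metis add.assoc add_diff_cancel_left' dist_commute dist_norm)
        then show ?thesis using small[OF that] hN r(2) by auto
      qed
      \<comment> \<open>The increment along \<open>b\<close> as a function of the step along
        \<open>a\<close>. The mean value theorem turns its change into a difference of the first
        derivative \<open>g\<close> at two points near \<open>x\<close>, where differentiability of
        \<open>g\<close> at the single point \<open>x\<close> gives the estimate.\<close>
      define f where "f s = u (x + s *\<^sub>R a + h *\<^sub>R b) - u (x + s *\<^sub>R a)" for s
      have f': "(f has_real_derivative (g (x + s *\<^sub>R a + h *\<^sub>R b) - g (x + s *\<^sub>R a))) (at s)"
        if "0 \<le> s" "s \<le> h" for s
      proof -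
        have *: "((\<lambda>s. u (x + s *\<^sub>R a + c *\<^sub>R b)) has_real_derivative g (x + s *\<^sub>R a + c *\<^sub>R b)) (at s)"
          if "0 \<le> c" "c \<le> h" for c
        proof -
          have 1: "(u has_derivative frechet_derivative u (at (x + s *\<^sub>R a + c *\<^sub>R b))) (at (x + s *\<^sub>R a + c *\<^sub>R b))"
            using d1[OF inS] \<open>0 \<le> s\<close> \<open>s \<le> h\<close> that frechet_derivative_works by blast
          have 2: "((\<lambda>s. x + s *\<^sub>R a + c *\<^sub>R b) has_derivative (\<lambda>k. k *\<^sub>R a)) (at s)"
            by (auto intro!: derivative_eq_intros)
          from has_derivative_compose[OF 2 1]
          have "((\<lambda>s. u (x + s *\<^sub>R a + c *\<^sub>R b)) has_derivative
              (\<lambda>k. frechet_derivative u (at (x + s *\<^sub>R a + c *\<^sub>R b)) (k *\<^sub>R a))) (at s)" by simp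
          moreover have "frechet_derivative u (at (x + s *\<^sub>R a + c *\<^sub>R b)) (k *\<^sub>R a) = g (x + s *\<^sub>R a + c *\<^sub>R b) * k" for k
            using linear_scale[OF has_derivative_linear[OF 1]] by (simp add: g_def)
          ultimately show ?thesis by (simp add: has_field_derivative_def)
        qed
        show ?thesis unfolding f_def using *[of h] *[of 0] h by (intro DERIV_diff) auto
      qed
      obtain s where s: "0 < s" "s < h" "f h - f 0 = (h - 0) * (g (x + s *\<^sub>R a + h *\<^sub>R b) - g (x + s *\<^sub>R a))"
        using MVT2[of 0 h f "\<lambda>s. g (x + s *\<^sub>R a + h *\<^sub>R b) - g (x + s *\<^sub>R a)"] f' h by auto
      have est: "norm (g (x + s *\<^sub>R a + c *\<^sub>R b) - g x - G (s *\<^sub>R a + c *\<^sub>R b)) \<le> e' * (h * N)"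
        if "0 \<le> c" "c \<le> h" for c
      proof -
        have sm: "norm (s *\<^sub>R a + c *\<^sub>R b) \<le> h * N" using small s that by auto
        have "norm (g (x + s *\<^sub>R a + c *\<^sub>R b) - g x - G (s *\<^sub>R a + c *\<^sub>R b)) \<le> e' * norm (s *\<^sub>R a + c *\<^sub>R b)"
          using d(2)[of "x + s *\<^sub>R a + c *\<^sub>R b"] sm hN by (simp add: add.assoc)
        also have "\<dots> \<le> e' * (h * N)" using sm \<open>e' > 0\<close> by (intro mult_left_mono) auto
        finally show ?thesis .
      qed
      have "G (s *\<^sub>R a + h *\<^sub>R b) - G (s *\<^sub>R a + 0 *\<^sub>R b) = h * G b"
        by (simp add: G.add G.scale)
      then have "\<bar>(g (x + s *\<^sub>R a + h *\<^sub>R b) - g (x + s *\<^sub>R a)) - h * G b\<bar> \<le> 2 * (e' * (h * N))"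
        using est[of h] est[of 0] h by (simp add: abs_le_iff)
      also have "\<dots> = h * (e / 2)" using N by (simp add: e'_def)
      also have "\<dots> < h * e" using h \<open>e > 0\<close> by simp
      finally have "\<bar>(g (x + s *\<^sub>R a + h *\<^sub>R b) - g (x + s *\<^sub>R a)) - h * G b\<bar> < h * e" .
      moreover have *: "u (x + h *\<^sub>R a + h *\<^sub>R b) - u (x + h *\<^sub>R a) - u (x + h *\<^sub>R b) + u x =
          h * (g (x + s *\<^sub>R a + h *\<^sub>R b) - g (x + s *\<^sub>R a))"
        using s(3) by (simp add: f_def)
      have "(u (x + h *\<^sub>R a + h *\<^sub>R b) - u (x + h *\<^sub>R a) - u (x + h *\<^sub>R b) + u x) / h\<^sup>2 - G b
          = ((g (x + s *\<^sub>R a + h *\<^sub>R b) - g (x + s *\<^sub>R a)) - h * G b) / h"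
        unfolding * using h by (simp add: field_simps power2_eq_square)
      ultimately show "dist ((u (x + h *\<^sub>R a + h *\<^sub>R b) - u (x + h *\<^sub>R a) - u (x + h *\<^sub>R b) + u x) / h\<^sup>2) (G b) < e"
        using h unfolding dist_real_def by (simp only: abs_divide) (simp add: pos_divide_less_eq mult.commute)
    qed
  qed
qed

lemma smooth_on_second_deriv_commute:
  fixes u :: "'a::real_normed_vector \<Rightarrow> real"
  assumes "open S" "x \<in> S" "smooth_on S u"
  shows "frechet_derivative (\<lambda>y. frechet_derivative u (at y) a) (at x) b =
    frechet_derivative (\<lambda>y. frechet_derivative u (at y) b) (at x) a"
proof -
  have t: "((\<lambda>h. (u (x + h *\<^sub>R a + h *\<^sub>R b) - u (x + h *\<^sub>R a) - u (x + h *\<^sub>R b) + u x) / h\<^sup>2)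
      \<longlongrightarrow> frechet_derivative (\<lambda>y. frechet_derivative u (at y) a) (at x) b) (at_right 0)" for a b
    using assms by (intro second_difference_tendsto[of S])
      (auto intro: smooth_on_differentiable smooth_on_deriv)
  have eq: "u (x + h *\<^sub>R b + h *\<^sub>R a) - u (x + h *\<^sub>R b) - u (x + h *\<^sub>R a) + u x =
      u (x + h *\<^sub>R a + h *\<^sub>R b) - u (x + h *\<^sub>R a) - u (x + h *\<^sub>R b) + u x" for h
    by (simp add: add.commute add.left_commute)
  show ?thesis
    using tendsto_unique[OF _ t[of a b] t[of b a, unfolded eq]] by simp
qed

section \<open>Riesz representation for test functions\<close>

lemma test_functionI:
  assumes "smooth_on UNIV f" "compact K" "K \<subseteq> \<Omega>" "\<And>x. x \<notin> K \<Longrightarrow> f x = 0"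
  shows "test_function \<Omega> f"
proof -
  have "closure {x. f x \<noteq> 0} \<subseteq> K"
    using assms by (intro closure_minimal compact_imp_closed) auto
  then have "compact (closure {x. f x \<noteq> 0})" "closure {x. f x \<noteq> 0} \<subseteq> \<Omega>"
    using compact_Int_closed[OF assms(2) closed_closure, of "{x. f x \<noteq> 0}"] assms(3)
    by (auto simp: Int_absorb1)
  then show ?thesis using assms(1) by (simp add: test_function_def)
qed

lemma test_functionE:
  assumes "test_function \<Omega> f"
  obtains K where "smooth_on UNIV f" "compact K" "K \<subseteq> \<Omega>" "\<And>x. x \<notin> K \<Longrightarrow> f x = 0"
proof
  show "f x = 0" if "x \<notin> closure {x. f x \<noteq> 0}" for x
    using that closure_subset[of "{x. f x \<noteq> 0}"] by blast
qed (use assms in \<open>auto simp: test_function_def\<close>)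

lemma test_function_outside: "test_function \<Omega> f \<Longrightarrow> x \<notin> \<Omega> \<Longrightarrow> f x = 0"
  using test_functionE by blast

lemma test_function_zero: "test_function \<Omega> (\<lambda>x. 0)"
  by (rule test_functionI[of _ "{}"]) (auto simp: smooth_on_const)

lemma test_function_mult_smooth:
  assumes "test_function \<Omega> f" "smooth_on UNIV g"
  shows "test_function \<Omega> (\<lambda>x. f x * g x)"
proof -
  obtain K where K: "smooth_on UNIV f" "compact K" "K \<subseteq> \<Omega>" "\<And>x. x \<notin> K \<Longrightarrow> f x = 0"
    using test_functionE[OF assms(1)] by blast
  show ?thesis
    by (rule test_functionI[of _ K]) (use K assms(2) in \<open>auto intro: smooth_on_mult\<close>)
qed

lemma test_function_scale: "test_function \<Omega> f \<Longrightarrow> test_function \<Omega> (\<lambda>x. c * f x)"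
  using test_function_mult_smooth[OF _ smooth_on_const, of \<Omega> f c] by (simp add: mult.commute)

lemma test_function_add:
  assumes "test_function \<Omega> f" "test_function \<Omega> g"
  shows "test_function \<Omega> (\<lambda>x. f x + g x)"
proof -
  obtain K where K: "smooth_on UNIV f" "compact K" "K \<subseteq> \<Omega>" "\<And>x. x \<notin> K \<Longrightarrow> f x = 0"
    using test_functionE[OF assms(1)] by blast
  obtain L where L: "smooth_on UNIV g" "compact L" "L \<subseteq> \<Omega>" "\<And>x. x \<notin> L \<Longrightarrow> g x = 0"
    using test_functionE[OF assms(2)] by blast
  show ?thesis
    by (rule test_functionI[of _ "K \<union> L"]) (use K L in \<open>auto intro!: smooth_on_add\<close>)
qed

lemma test_function_diff:
  "test_function \<Omega> f \<Longrightarrow> test_function \<Omega> g \<Longrightarrow> test_function \<Omega> (\<lambda>x. f x - g x)"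
  using test_function_add[OF _ test_function_scale[of _ _ "-1"], of \<Omega> f g] by simp

lemma test_function_sum:
  "(\<And>i. i \<in> I \<Longrightarrow> test_function \<Omega> (f i)) \<Longrightarrow> test_function \<Omega> (\<lambda>x. \<Sum>i\<in>I. f i x)"
  by (induction I rule: infinite_finite_induct) (auto simp: test_function_zero intro!: test_function_add)

lemma test_function_mono: "test_function G f \<Longrightarrow> G \<subseteq> \<Omega> \<Longrightarrow> test_function \<Omega> f"
  unfolding test_function_def by auto

lemma test_function_smooth: "test_function \<Omega> f \<Longrightarrow> smooth_on UNIV f"
  unfolding test_function_def by auto

lemma test_function_continuous: "test_function \<Omega> f \<Longrightarrow> continuous_on UNIV f"
  using smooth_on_continuous_on test_function_smooth by blast

lemma test_function_bound:
  fixes f :: "'a::euclidean_space \<Rightarrow> real"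
  assumes "test_function \<Omega> f"
  obtains B where "B > 0" "\<And>x. \<bar>f x\<bar> \<le> B"
proof -
  obtain K where K: "smooth_on UNIV f" "compact K" "K \<subseteq> \<Omega>" "\<And>x. x \<notin> K \<Longrightarrow> f x = 0"
    using test_functionE[OF assms] by blast
  have "compact (f ` K)"
    using K(2) continuous_on_subset[OF test_function_continuous[OF assms]]
    by (intro compact_continuous_image) auto
  then have "bounded (f ` K)" by (rule compact_imp_bounded)
  then obtain B where B: "B > 0" "\<And>y. y \<in> f ` K \<Longrightarrow> norm y \<le> B"
    unfolding bounded_pos by blast
  show thesis
  proof
    show "\<bar>f x\<bar> \<le> B" for x
      using B K(4)[of x] by (cases "x \<in> K") auto
  qed (use B in auto)
qed

lemma test_function_Urysohn:
  fixes \<Omega> :: "'a::euclidean_space set"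
  assumes "compact K" "open \<Omega>" "K \<subseteq> \<Omega>"
  obtains f where "test_function \<Omega> f" "\<And>x. 0 \<le> f x" "\<And>x. f x \<le> 1" "\<And>x. x \<in> K \<Longrightarrow> f x = 1"
proof -
  have "\<exists>h r. r > 0 \<and> test_function \<Omega> h \<and> (\<forall>x. 0 \<le> h x \<and> h x \<le> 1) \<and> (\<forall>x\<in>ball p r. h x = 1)"
    if "p \<in> K" for p
  proof -
    obtain r where r: "r > 0" "cball p r \<subseteq> \<Omega>"
      using assms \<open>p \<in> K\<close> open_contains_cball by blast
    then have "0 < r / 2" "r / 2 < r" by auto
    then obtain h where h: "smooth_on UNIV h" "\<And>x. 0 \<le> h x" "\<And>x. h x \<le> (1::real)"
      "\<And>x. dist p x \<le> r / 2 \<Longrightarrow> h x = 1" "\<And>x. r \<le> dist p x \<Longrightarrow> h x = 0"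
      using smooth_bump_exists[of "r / 2" r p] by metis
    have "test_function \<Omega> h"
      by (rule test_functionI[of _ "cball p r"]) (use h r in auto)
    then show ?thesis
      using h r by (intro exI[of _ h] exI[of _ "r / 2"]) auto
  qed
  then obtain h r where hr: "\<And>p. p \<in> K \<Longrightarrow> r p > 0 \<and> test_function \<Omega> (h p) \<and>
      (\<forall>x. 0 \<le> h p x \<and> h p x \<le> 1) \<and> (\<forall>x\<in>ball p (r p). h p x = 1)"
    by metis
  then have "K \<subseteq> (\<Union>p\<in>K. ball p (r p))" by force
  then obtain D where D: "D \<subseteq> K" "finite D" "K \<subseteq> (\<Union>p\<in>D. ball p (r p))"
    using compactE_image[OF assms(1), of K "\<lambda>p. ball p (r p)"] by auto
  \<comment> \<open>This combination stays in [0,1], is smooth, vanishes where all bumps vanish and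
    equals 1 as soon as one bump does.\<close>
  define f where "f x = 1 - (\<Prod>p\<in>D. 1 - h p x)" for x
  have "\<exists>L. compact L \<and> L \<subseteq> \<Omega> \<and> (\<forall>x. x \<notin> L \<longrightarrow> h p x = 0)" if "p \<in> D" for p
  proof -
    have "test_function \<Omega> (h p)" using hr D(1) that by blast
    from test_functionE[OF this] show ?thesis by metis
  qed
  then obtain L where L: "\<And>p. p \<in> D \<Longrightarrow> compact (L p) \<and> L p \<subseteq> \<Omega> \<and> (\<forall>x. x \<notin> L p \<longrightarrow> h p x = 0)"
    by metis
  show thesis
  proof
    show "test_function \<Omega> f"
    proof (rule test_functionI[of _ "\<Union>p\<in>D. L p"])
      show "smooth_on UNIV f"
        unfolding f_def using hr D(1)
        by (intro smooth_on_diff smooth_on_const smooth_on_prod test_function_smooth[of \<Omega>]) auto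
      show "f x = 0" if "x \<notin> (\<Union>p\<in>D. L p)" for x
        using that L by (simp add: f_def)
    qed (use L D in auto)
    show "0 \<le> f x" for x
      unfolding f_def using hr D(1) prod_le_1[of D "\<lambda>p. 1 - h p x"] by (force simp: subset_iff)
    show "f x \<le> 1" for x
      unfolding f_def using hr D(1) prod_nonneg[of D "\<lambda>p. 1 - h p x"] by (force simp: subset_iff)
    show "f x = 1" if x: "x \<in> K" for x
    proof -
      obtain p where "p \<in> D" "x \<in> ball p (r p)" using x D(3) by blast
      then have "1 - h p x = 0" using hr D(1) by auto
      then have "(\<Prod>p\<in>D. 1 - h p x) = 0" using \<open>p \<in> D\<close> D(2) by (metis prod_zero)
      then show ?thesis by (simp add: f_def)
    qed
  qed
qed

section \<open>Positive functionals and their outer measures\<close>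

locale positive_functional =
  fixes \<Omega> :: "'a::euclidean_space set" and \<Lambda> :: "('a \<Rightarrow> real) \<Rightarrow> real"
  assumes open_domain: "open \<Omega>"
    and add: "test_function \<Omega> f \<Longrightarrow> test_function \<Omega> g \<Longrightarrow> \<Lambda> (\<lambda>x. f x + g x) = \<Lambda> f + \<Lambda> g"
    and scale: "test_function \<Omega> f \<Longrightarrow> \<Lambda> (\<lambda>x. c * f x) = c * \<Lambda> f"
    and nonneg: "test_function \<Omega> f \<Longrightarrow> (\<And>x. 0 \<le> f x) \<Longrightarrow> 0 \<le> \<Lambda> f"
begin

lemma zero: "\<Lambda> (\<lambda>x. 0) = 0"
  using scale[OF test_function_zero, of 0] by simp

lemma diff: "test_function \<Omega> f \<Longrightarrow> test_function \<Omega> g \<Longrightarrow> \<Lambda> (\<lambda>x. f x - g x) = \<Lambda> f - \<Lambda> g"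
  using add[OF _ test_function_scale[of _ _ "-1"], of f g] scale[of g "-1"] by simp

lemma mono: "test_function \<Omega> f \<Longrightarrow> test_function \<Omega> g \<Longrightarrow> (\<And>x. f x \<le> g x) \<Longrightarrow> \<Lambda> f \<le> \<Lambda> g"
  using nonneg[OF test_function_diff, of g f] diff[of g f] by auto

lemma sum: "(\<And>i. i \<in> I \<Longrightarrow> test_function \<Omega> (f i)) \<Longrightarrow> \<Lambda> (\<lambda>x. \<Sum>i\<in>I. f i x) = (\<Sum>i\<in>I. \<Lambda> (f i))"
  by (induction I rule: infinite_finite_induct) (auto simp: zero add test_function_sum)

text \<open>A Dini argument. The partial sums are continuous and increase, so on the compact support
  of \<open>f\<close> one of them exceeds f - e' everywhere; a cutoff \<xi> turns the uniform error
  into the test function e' * \<xi>, whose value under \<Lambda> is small.\<close>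

lemma le_suminf:
  assumes f: "test_function \<Omega> f" and g: "\<And>n. test_function \<Omega> (g n)" "\<And>n x. 0 \<le> g n x"
    and le: "\<And>x. ennreal (f x) \<le> (\<Sum>n. ennreal (g n x))"
  shows "ennreal (\<Lambda> f) \<le> (\<Sum>n. ennreal (\<Lambda> (g n)))"
proof (rule ennreal_le_epsilon)
  fix e :: real assume e: "e > 0"
  obtain K where K: "smooth_on UNIV f" "compact K" "K \<subseteq> \<Omega>" "\<And>x. x \<notin> K \<Longrightarrow> f x = 0"
    using test_functionE[OF f] by blast
  obtain \<xi> where \<xi>: "test_function \<Omega> \<xi>" "\<And>x. 0 \<le> \<xi> x" "\<And>x. \<xi> x \<le> 1" "\<And>x. x \<in> K \<Longrightarrow> \<xi> x = 1"
    using test_function_Urysohn[OF K(2) open_domain K(3)] by blast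
  define e' where "e' = e / (\<Lambda> \<xi> + 1)"
  have \<xi>0: "\<Lambda> \<xi> \<ge> 0" using nonneg \<xi> by blast
  then have e': "e' > 0" "e' * \<Lambda> \<xi> \<le> e" using e by (auto simp: e'_def field_simps)
  define U where "U N = {x. f x - e' < (\<Sum>n<N. g n x)}" for N :: nat
  have "open (U N)" for N
    unfolding U_def using test_function_continuous f g
    by (intro open_Collect_less continuous_intros) blast+
  moreover have "K \<subseteq> (\<Union>N\<in>UNIV. U N)"
  proof
    fix x assume "x \<in> K"
    have "\<exists>N. f x - e' < (\<Sum>n<N. g n x)"
    proof (rule ccontr)
      assume "\<nexists>N. f x - e' < (\<Sum>n<N. g n x)"
      then have *: "(\<Sum>n<N. g n x) \<le> f x - e'" for N by (simp add: not_less)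
      have 0: "f x - e' \<ge> 0" using *[of 0] by simp
      have "(\<Sum>n. ennreal (g n x)) \<le> ennreal (f x - e')"
        unfolding suminf_eq_SUP by (intro SUP_least) (use * g(2) in \<open>auto simp: sum_nonneg intro!: ennreal_leI\<close>)
      also have "\<dots> < ennreal (f x)" using e' 0 by (intro ennreal_lessI) auto
      finally show False using le[of x] by simp
    qed
    then show "x \<in> (\<Union>N\<in>UNIV. U N)" by (auto simp: U_def)
  qed
  ultimately obtain D where D: "finite D" "K \<subseteq> (\<Union>N\<in>D. U N)"
    using compactE_image[OF K(2), of UNIV U] by (metis subset_UNIV)
  define N where "N = Max (insert 0 D)"
  have le': "f x \<le> (\<Sum>n<N. g n x) + e' * \<xi> x" for x
  proof (cases "x \<in> K")
    case True
    then obtain N' where N': "N' \<in> D" "x \<in> U N'" using D by blast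
    then have "N' \<le> N" using D by (simp add: N_def)
    then have "(\<Sum>n<N'. g n x) \<le> (\<Sum>n<N. g n x)" using g by (intro sum_mono2) auto
    then show ?thesis using N'(2) \<xi>(4)[OF True] by (simp add: U_def)
  next
    case False
    then show ?thesis using K(4) g e' \<xi>(2) by (simp add: sum_nonneg)
  qed
  have "\<Lambda> f \<le> \<Lambda> (\<lambda>x. (\<Sum>n<N. g n x) + e' * \<xi> x)"
    using f g \<xi> le' by (intro mono test_function_add test_function_sum test_function_scale) auto
  also have "\<dots> = (\<Sum>n<N. \<Lambda> (g n)) + e' * \<Lambda> \<xi>"
    using g \<xi> by (simp add: add sum scale test_function_sum test_function_scale)
  finally have "\<Lambda> f \<le> (\<Sum>n<N. \<Lambda> (g n)) + e" using e' by simp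
  then have "ennreal (\<Lambda> f) \<le> ennreal ((\<Sum>n<N. \<Lambda> (g n)) + e)" by (rule ennreal_leI)
  also have "\<dots> = (\<Sum>n<N. ennreal (\<Lambda> (g n))) + ennreal e"
    using nonneg g e by (simp add: sum_nonneg ennreal_plus)
  also have "\<dots> \<le> (\<Sum>n. ennreal (\<Lambda> (g n))) + ennreal e"
    by (intro add_mono sum_le_suminf) auto
  finally show "ennreal (\<Lambda> f) \<le> (\<Sum>n. ennreal (\<Lambda> (g n))) + ennreal e" .
qed

text \<open>Outer measure in the style of Daniell: sets are covered by countable sums of test functions,
  which makes countable subadditivity immediate.\<close>

definition covers :: "'a set \<Rightarrow> (nat \<Rightarrow> 'a \<Rightarrow> real) set" where
  "covers E = {\<phi>. (\<forall>n. test_function \<Omega> (\<phi> n) \<and> (\<forall>x. 0 \<le> \<phi> n x)) \<and>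
     (\<forall>x\<in>E. 1 \<le> (\<Sum>n. ennreal (\<phi> n x)))}"

definition outer :: "'a set \<Rightarrow> ennreal" where
  "outer E = (INF \<phi>\<in>covers E. \<Sum>n. ennreal (\<Lambda> (\<phi> n)))"

lemma outer_le: "\<phi> \<in> covers E \<Longrightarrow> outer E \<le> (\<Sum>n. ennreal (\<Lambda> (\<phi> n)))"
  unfolding outer_def by (rule INF_lower)

text \<open>Enumerating pairs merges countably many covers into one; countable subadditivity and
  measurability of open sets both rest on this.\<close>

lemma outer_le_double:
  assumes "\<And>i j. test_function \<Omega> (\<phi> i j)" "\<And>i j x. 0 \<le> \<phi> i j x"
    "\<And>x. x \<in> E \<Longrightarrow> 1 \<le> (\<Sum>i. \<Sum>j. ennreal (\<phi> i j x))"
  shows "outer E \<le> (\<Sum>i. \<Sum>j. ennreal (\<Lambda> (\<phi> i j)))"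
proof -
  have *: "(\<Sum>n. ennreal (case prod_decode n of (i, j) \<Rightarrow> F i j)) = (\<Sum>i. \<Sum>j. ennreal (F i j))"
    for F :: "nat \<Rightarrow> nat \<Rightarrow> real"
    using suminf_ennreal_2dimen[of "\<lambda>i. \<Sum>j. ennreal (F i j)" "\<lambda>(i, j). ennreal (F i j)"]
    by (simp add: case_prod_unfold)
  define \<psi> where "\<psi> n = (case prod_decode n of (i, j) \<Rightarrow> \<phi> i j)" for n
  have \<psi>: "\<psi> n x = (case prod_decode n of (i, j) \<Rightarrow> \<phi> i j x)"
    "\<Lambda> (\<psi> n) = (case prod_decode n of (i, j) \<Rightarrow> \<Lambda> (\<phi> i j))" for n x
    by (simp_all add: \<psi>_def case_prod_unfold)
  have "\<psi> \<in> covers E"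
    unfolding covers_def mem_Collect_eq
  proof (intro conjI allI ballI)
    show "test_function \<Omega> (\<psi> n)" for n using assms(1) by (simp add: \<psi>_def case_prod_unfold)
    show "0 \<le> \<psi> n x" for n x using assms(2) by (simp add: \<psi>_def case_prod_unfold)
    show "1 \<le> (\<Sum>n. ennreal (\<psi> n x))" if "x \<in> E" for x
      unfolding \<psi> * using assms(3)[OF that] .
  qed
  from outer_le[OF this] show ?thesis unfolding \<psi> * .
qed

lemma outer_le_single:
  assumes "test_function \<Omega> f" "\<And>x. 0 \<le> f x" "\<And>x. x \<in> E \<Longrightarrow> 1 \<le> f x"
  shows "outer E \<le> ennreal (\<Lambda> f)"
proof -
  have *: "(\<Sum>n. ennreal (if n = (0::nat) then c else 0)) = ennreal c" for c
    using suminf_finite[of "{0::nat}" "\<lambda>n. ennreal (if n = 0 then c else 0)"] by simp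
  define \<phi> where "\<phi> n = (if n = (0::nat) then f else (\<lambda>x. 0))" for n
  have "\<phi> n x = (if n = 0 then f x else 0)" "\<Lambda> (\<phi> n) = (if n = 0 then \<Lambda> f else 0)" for n x
    by (auto simp: \<phi>_def zero)
  moreover have "\<phi> \<in> covers E"
    unfolding covers_def using assms * by (auto simp: \<phi>_def test_function_zero if_distribR)
  ultimately show ?thesis using outer_le[of \<phi> E] * by simp
qed

text \<open>Every cover of \<open>E\<close> dominates \<open>f\<close> pointwise, so
  \<open>le_suminf\<close> applies. With \<open>outer_le_single\<close> it gives the two bounds
  through which values of \<Lambda> meet the measure.\<close>

lemma le_outer:
  assumes "test_function \<Omega> f" "\<And>x. f x \<le> 1" "\<And>x. x \<notin> E \<Longrightarrow> f x \<le> 0"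
  shows "ennreal (\<Lambda> f) \<le> outer E"
  unfolding outer_def
proof (rule INF_greatest)
  fix \<phi> assume \<phi>: "\<phi> \<in> covers E"
  show "ennreal (\<Lambda> f) \<le> (\<Sum>n. ennreal (\<Lambda> (\<phi> n)))"
  proof (rule le_suminf[OF assms(1)])
    show "ennreal (f x) \<le> (\<Sum>n. ennreal (\<phi> n x))" for x
    proof (cases "x \<in> E")
      case True
      have "ennreal (f x) \<le> 1" using assms(2)[of x] ennreal_leI[of "f x" 1] by simp
      also have "1 \<le> (\<Sum>n. ennreal (\<phi> n x))" using \<phi> True by (simp add: covers_def)
      finally show ?thesis .
    qed (use assms(3) in \<open>simp add: ennreal_neg\<close>)
  qed (use \<phi> in \<open>auto simp: covers_def\<close>)
qed

lemma outer_mono: "A \<subseteq> B \<Longrightarrow> outer A \<le> outer B"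
  unfolding outer_def by (rule INF_superset_mono) (auto simp: covers_def)

lemma outer_close:
  assumes "outer E < top" "e > 0"
  obtains \<phi> where "\<phi> \<in> covers E" "(\<Sum>n. ennreal (\<Lambda> (\<phi> n))) \<le> outer E + ennreal e"
proof -
  have "outer E < outer E + ennreal e"
    using assms by (cases "outer E") (auto simp: ennreal_plus[symmetric] ennreal_lessI simp del: ennreal_plus)
  then show thesis unfolding outer_def INF_less_iff using that less_imp_le by (metis outer_def)
qed

lemma outer_measure_space: "outer_measure_space (Pow \<Omega>) outer"
  unfolding outer_measure_space_def
proof (intro conjI)
  have "outer {} \<le> ennreal (\<Lambda> (\<lambda>x. 0))"
    by (rule outer_le_single) (auto simp: test_function_zero)
  then show "positive (Pow \<Omega>) outer" by (simp add: positive_def zero)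
  show "increasing (Pow \<Omega>) outer" by (simp add: increasing_def outer_mono)
  show "countably_subadditive (Pow \<Omega>) outer"
    unfolding countably_subadditive_def
  proof safe
    fix A :: "nat \<Rightarrow> 'a set"
    show "outer (\<Union>i. A i) \<le> (\<Sum>i. outer (A i))"
    proof (rule ennreal_le_epsilon)
      fix e :: real assume e: "0 < e" and fin: "(\<Sum>i. outer (A i)) < top"
      have "outer (A i) < top" for i using fin by (rule ennreal_suminf_lessD)
      then have "\<exists>\<phi>\<in>covers (A i). (\<Sum>n. ennreal (\<Lambda> (\<phi> n))) \<le> outer (A i) + ennreal (e * (1/2) ^ Suc i)" for i
        using outer_close[of "A i" "e * (1/2) ^ Suc i"] e by (metis mult_pos_pos zero_less_power zero_less_divide_1_iff zero_less_numeral)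
      then obtain \<phi> where \<phi>: "\<And>i. \<phi> i \<in> covers (A i)"
        "\<And>i. (\<Sum>n. ennreal (\<Lambda> (\<phi> i n))) \<le> outer (A i) + ennreal (e * (1/2) ^ Suc i)"
        by metis
      have "outer (\<Union>i. A i) \<le> (\<Sum>i. \<Sum>j. ennreal (\<Lambda> (\<phi> i j)))"
      proof (rule outer_le_double)
        fix x assume "x \<in> (\<Union>i. A i)"
        then obtain i where "x \<in> A i" by blast
        then have "1 \<le> (\<Sum>j. ennreal (\<phi> i j x))" using \<phi>(1)[of i] by (simp add: covers_def)
        also have "\<dots> \<le> (\<Sum>i. \<Sum>j. ennreal (\<phi> i j x))"
          using sum_le_suminf[of "\<lambda>i. \<Sum>j. ennreal (\<phi> i j x)" "{i}"] by simp
        finally show "1 \<le> (\<Sum>i. \<Sum>j. ennreal (\<phi> i j x))" .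
      qed (use \<phi>(1) in \<open>auto simp: covers_def\<close>)
      also have "\<dots> \<le> (\<Sum>i. outer (A i) + ennreal (e * (1/2) ^ Suc i))"
        using \<phi>(2) by (intro suminf_le) auto
      also have "\<dots> = (\<Sum>i. outer (A i)) + (\<Sum>i. ennreal (e * (1/2) ^ Suc i))"
        by (simp add: suminf_add)
      also have "(\<Sum>i. ennreal (e * (1/2) ^ Suc i)) = ennreal e"
        using sums_mult[OF power_half_series, of e] e by (intro suminf_ennreal_eq) auto
      finally show "outer (\<Union>i. A i) \<le> (\<Sum>i. outer (A i)) + ennreal e" .
    qed
  qed
qed

text \<open>Take cutoffs c_n for a compact exhaustion of \<open>G\<close>. The products c_j (1 -
  c_0) ... (1 - c_(j-1)) telescope to 1 - (1 - c_0) ... (1 - c_(N-1)), which is exactly 1 at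
  \<open>x\<close> once some factor with c_n(x) = 1 has been included.\<close>

lemma smooth_partition:
  fixes G :: "'a set"
  assumes "open G" "G \<subseteq> \<Omega>"
  obtains d :: "nat \<Rightarrow> 'a \<Rightarrow> real" where "\<And>j. test_function \<Omega> (d j)" "\<And>j x. 0 \<le> d j x"
    "\<And>N x. (\<Sum>j<N. d j x) \<le> 1" "\<And>j x. x \<notin> G \<Longrightarrow> d j x = 0"
    "\<And>x. x \<in> G \<Longrightarrow> (\<Sum>j. ennreal (d j x)) = 1"
proof -
  obtain C :: "nat \<Rightarrow> 'a set" where C: "\<And>n. compact (C n)" "\<And>n. C n \<subseteq> G" "\<Union>(range C) = G"
    using open_Union_compact_subsets[OF assms(1)] by metis
  have "\<exists>c. test_function G c \<and> (\<forall>x. 0 \<le> c x \<and> c x \<le> 1) \<and> (\<forall>x\<in>C n. c x = 1)" for n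
    using test_function_Urysohn[OF C(1) assms(1) C(2), of n] by metis
  then obtain c where c: "\<And>n. test_function G (c n)" "\<And>n x. 0 \<le> c n x" "\<And>n x. c n x \<le> 1"
    "\<And>n x. x \<in> C n \<Longrightarrow> c n x = 1" by metis
  define d where "d j x = c j x * (\<Prod>i<j. 1 - c i x)" for j x
  have sums: "(\<Sum>j<N. d j x) = 1 - (\<Prod>j<N. 1 - c j x)" for N x
    by (induction N) (auto simp: d_def algebra_simps)
  have P: "(\<Prod>j<N. 1 - c j x) \<ge> 0" for N x using c by (simp add: prod_nonneg)
  have pos: "0 \<le> d j x" for j x using c P by (simp add: d_def)
  show thesis
  proof
    show "test_function \<Omega> (d j)" for j
      unfolding d_def
      by (intro test_function_mult_smooth test_function_mono[OF c(1) assms(2)] smooth_on_prod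
          smooth_on_diff smooth_on_const test_function_smooth[OF c(1)]) auto
    show "(\<Sum>j<N. d j x) \<le> 1" for N x using sums P by simp
    show "d j x = 0" if "x \<notin> G" for j x
    proof -
      have "c j x = 0" using test_function_outside[OF c(1) that] .
      then show ?thesis by (simp add: d_def)
    qed
    show "(\<Sum>j. ennreal (d j x)) = 1" if x: "x \<in> G" for x
    proof -
      obtain n where "x \<in> C n" using C(3) x by blast
      then have "c n x = 1" using c by blast
      then have 0: "(\<Prod>j<N. 1 - c j x) = 0" if "n < N" for N using that by (intro prod_zero) auto
      have "(\<lambda>j. d j x) sums 1"
        unfolding sums_def by (rule tendsto_eventually) (use 0 sums in \<open>auto intro!: eventually_sequentiallyI[of "Suc n"]\<close>)
      then show ?thesis by (subst suminf_ennreal_eq[OF pos]) auto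
    qed
  qed (rule pos)
qed

text \<open>A countable smooth partition of unity of \<open>G\<close> splits every cover of \<open>E\<close> into covers of
  \<open>G \<inter> E\<close> and of \<open>E - G\<close> at arbitrarily small extra cost.\<close>

lemma open_in_lambda_system:
  assumes G: "open G" "G \<subseteq> \<Omega>"
  shows "G \<in> lambda_system \<Omega> (Pow \<Omega>) outer"
proof -
  obtain d :: "nat \<Rightarrow> 'a \<Rightarrow> real" where d: "\<And>j. test_function \<Omega> (d j)" "\<And>j x. 0 \<le> d j x"
    "\<And>N x. (\<Sum>j<N. d j x) \<le> 1" "\<And>j x. x \<notin> G \<Longrightarrow> d j x = 0"
    "\<And>x. x \<in> G \<Longrightarrow> (\<Sum>j. ennreal (d j x)) = 1"
    using smooth_partition[OF G] by blast
  have le: "outer (G \<inter> E) + outer ((\<Omega> - G) \<inter> E) \<le> outer E" for E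
  proof (rule ennreal_le_epsilon)
    fix e :: real assume e: "0 < e" and fin: "outer E < top"
    obtain \<phi> where \<phi>: "\<phi> \<in> covers E" "(\<Sum>n. ennreal (\<Lambda> (\<phi> n))) \<le> outer E + ennreal (e / 2)"
      using outer_close[OF fin, of "e / 2"] e by auto
    have \<phi>t: "test_function \<Omega> (\<phi> n)" "0 \<le> \<phi> n x" for n x using \<phi> by (auto simp: covers_def)
    have tf: "test_function \<Omega> (\<lambda>x. \<phi> n x * d j x)" for n j
      using test_function_mult_smooth \<phi>t d(1) test_function_smooth by blast
    \<comment> \<open>The share of the mass of the n-th covering function that the partition assigns
      to \<open>G\<close>.\<close>
    define s where "s n = (\<Sum>j. \<Lambda> (\<lambda>x. \<phi> n x * d j x))" for n
    have pos: "0 \<le> \<Lambda> (\<lambda>x. \<phi> n x * d j x)" for n j using tf \<phi>t d(2) by (intro nonneg) auto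
    have part: "(\<Sum>j<N. \<Lambda> (\<lambda>x. \<phi> n x * d j x)) = \<Lambda> (\<lambda>x. \<phi> n x * (\<Sum>j<N. d j x))" for n N
      using sum[of "{..<N}" "\<lambda>j x. \<phi> n x * d j x"] tf by (simp add: sum_distrib_left)
    have tfs: "test_function \<Omega> (\<lambda>x. \<phi> n x * (\<Sum>j<N. d j x))" for n N
      using test_function_sum[of "{..<N}" \<Omega> "\<lambda>j x. \<phi> n x * d j x"] tf by (simp add: sum_distrib_left)
    have bound: "(\<Sum>j<N. \<Lambda> (\<lambda>x. \<phi> n x * d j x)) \<le> \<Lambda> (\<phi> n)" for n N
      unfolding part using \<phi>t d(3) tfs by (intro mono) (auto intro!: mult_left_le)
    have summable: "summable (\<lambda>j. \<Lambda> (\<lambda>x. \<phi> n x * d j x))" for n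
      using bound pos by (intro summableI_nonneg_bounded)
    have se: "(\<Sum>j. ennreal (\<Lambda> (\<lambda>x. \<phi> n x * d j x))) = ennreal (s n)" for n
      unfolding s_def using pos summable by (intro suminf_ennreal_eq) (auto simp: summable_sums)
    have "\<exists>N. s n - e / 2 * (1/2) ^ Suc n < (\<Sum>j<N. \<Lambda> (\<lambda>x. \<phi> n x * d j x))" for n
    proof -
      have "(\<lambda>N. \<Sum>j<N. \<Lambda> (\<lambda>x. \<phi> n x * d j x)) \<longlonglongrightarrow> s n"
        unfolding s_def using summable by (rule summable_LIMSEQ)
      moreover have "s n - e / 2 * (1/2) ^ Suc n < s n" using e by simp
      ultimately have "\<forall>\<^sub>F N in sequentially. s n - e / 2 * (1/2) ^ Suc n < (\<Sum>j<N. \<Lambda> (\<lambda>x. \<phi> n x * d j x))"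
        by (rule order_tendstoD(1))
      then show ?thesis by (auto simp: eventually_sequentially)
    qed
    then obtain N where N: "\<And>n. s n - e / 2 * (1/2) ^ Suc n < (\<Sum>j<N n. \<Lambda> (\<lambda>x. \<phi> n x * d j x))"
      by metis
    have 1: "outer (G \<inter> E) \<le> (\<Sum>n. ennreal (s n))"
    proof -
      have "outer (G \<inter> E) \<le> (\<Sum>n. \<Sum>j. ennreal (\<Lambda> (\<lambda>x. \<phi> n x * d j x)))"
      proof (rule outer_le_double[OF tf])
        fix x assume x: "x \<in> G \<inter> E"
        then have "(\<Sum>j. ennreal (\<phi> n x * d j x)) = ennreal (\<phi> n x)" for n
          by (simp only: ennreal_mult[OF \<phi>t(2) d(2)] ennreal_suminf_cmult d(5) mult_1_right IntD1)
        then show "1 \<le> (\<Sum>n. \<Sum>j. ennreal (\<phi> n x * d j x))"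
          using \<phi>(1) x by (simp add: covers_def)
      qed (use \<phi>t d in auto)
      then show ?thesis by (simp add: se)
    qed
    \<comment> \<open>Only finitely many pieces are removed, so a test function remains. Outside
      \<open>G\<close> all pieces vanish and nothing is lost; the pieces not removed have mass below
      e/2 * 2^-(n+1).\<close>
    define \<psi> where "\<psi> n x = \<phi> n x - \<phi> n x * (\<Sum>j<N n. d j x)" for n x
    have \<psi>: "\<psi> \<in> covers ((\<Omega> - G) \<inter> E)"
      unfolding covers_def
    proof safe
      show "test_function \<Omega> (\<psi> n)" for n
        unfolding \<psi>_def by (intro test_function_diff \<phi>t tfs)
      show "0 \<le> \<psi> n x" for n x
        using \<phi>t d(3) by (auto simp: \<psi>_def intro!: mult_left_le)
      fix x assume "x \<in> E" "x \<notin> G"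
      then have "\<psi> n x = \<phi> n x" for n by (simp add: \<psi>_def d(4))
      then show "1 \<le> (\<Sum>n. ennreal (\<psi> n x))" using \<phi>(1) \<open>x \<in> E\<close> by (simp add: covers_def)
    qed
    have \<Lambda>\<psi>: "\<Lambda> (\<psi> n) = \<Lambda> (\<phi> n) - (\<Sum>j<N n. \<Lambda> (\<lambda>x. \<phi> n x * d j x))" for n
      unfolding part \<psi>_def by (intro diff \<phi>t tfs)
    have s0: "0 \<le> s n" for n unfolding s_def using pos summable by (intro suminf_nonneg)
    have "outer (G \<inter> E) + outer ((\<Omega> - G) \<inter> E) \<le> (\<Sum>n. ennreal (s n)) + (\<Sum>n. ennreal (\<Lambda> (\<psi> n)))"
      by (intro add_mono 1 outer_le \<psi>)
    also have "\<dots> = (\<Sum>n. ennreal (s n) + ennreal (\<Lambda> (\<psi> n)))" by (simp add: suminf_add)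
    also have "\<dots> \<le> (\<Sum>n. ennreal (\<Lambda> (\<phi> n)) + ennreal (e / 2 * (1/2) ^ Suc n))"
    proof (intro suminf_le allI)
      fix n
      have "0 \<le> \<Lambda> (\<psi> n)" using \<psi> nonneg by (auto simp: covers_def)
      moreover have "0 \<le> \<Lambda> (\<phi> n)" using \<phi>t nonneg by auto
      moreover have "s n + \<Lambda> (\<psi> n) \<le> \<Lambda> (\<phi> n) + e / 2 * (1/2) ^ Suc n"
        using N[of n] by (simp add: \<Lambda>\<psi>)
      ultimately show "ennreal (s n) + ennreal (\<Lambda> (\<psi> n)) \<le> ennreal (\<Lambda> (\<phi> n)) + ennreal (e / 2 * (1/2) ^ Suc n)"
        using s0[of n] e by (simp add: ennreal_plus[symmetric] ennreal_leI del: ennreal_plus)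
    qed auto
    also have "\<dots> = (\<Sum>n. ennreal (\<Lambda> (\<phi> n))) + (\<Sum>n. ennreal (e / 2 * (1/2) ^ Suc n))"
      by (simp add: suminf_add)
    also have "(\<Sum>n. ennreal (e / 2 * (1/2) ^ Suc n)) = ennreal (e / 2)"
      using sums_mult[OF power_half_series, of "e / 2"] e by (intro suminf_ennreal_eq) auto
    also have "(\<Sum>n. ennreal (\<Lambda> (\<phi> n))) + ennreal (e / 2) \<le> (outer E + ennreal (e / 2)) + ennreal (e / 2)"
      by (intro add_mono \<phi>) auto
    also have "\<dots> = outer E + ennreal e"
      using e by (simp add: add.assoc ennreal_plus[symmetric] del: ennreal_plus)
    finally show "outer (G \<inter> E) + outer ((\<Omega> - G) \<inter> E) \<le> outer E + ennreal e" .
  qed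
  have "outer E \<le> outer (G \<inter> E) + outer ((\<Omega> - G) \<inter> E)" if "E \<subseteq> \<Omega>" for E
  proof -
    interpret ring_of_sets \<Omega> "Pow \<Omega>" by (rule ring_of_setsI) auto
    have "subadditive (Pow \<Omega>) outer"
      using outer_measure_space countably_subadditive_subadditive unfolding outer_measure_space_def by blast
    then have "outer ((G \<inter> E) \<union> ((\<Omega> - G) \<inter> E)) \<le> outer (G \<inter> E) + outer ((\<Omega> - G) \<inter> E)"
      unfolding subadditive_def using that G by (elim ballE[of _ _ "G \<inter> E"] ballE[of _ _ "(\<Omega> - G) \<inter> E"]) auto
    moreover have "(G \<inter> E) \<union> ((\<Omega> - G) \<inter> E) = E" using that by blast
    ultimately show ?thesis by simp
  qed
  then show ?thesis
    unfolding lambda_system_def using G le by (auto intro!: antisym)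
qed

end

section \<open>Borel sets of an open domain; uniqueness of Radon measures\<close>

lemma sets_restrict_borel_open:
  fixes \<Omega> :: "'a::topological_space set"
  assumes "open \<Omega>"
  shows "sets (restrict_space borel \<Omega>) = sigma_sets \<Omega> {G. open G \<and> G \<subseteq> \<Omega>}"
proof -
  have "sets (restrict_space borel \<Omega>) = (\<inter>) \<Omega> ` sigma_sets UNIV {S. open S}"
    by (simp add: sets_restrict_space sets_borel)
  also have "\<dots> = sigma_sets \<Omega> ((\<inter>) \<Omega> ` {S. open S})"
    using assms by (intro sigma_sets_Int) auto
  also have "(\<inter>) \<Omega> ` {S. open S} = {G. open G \<and> G \<subseteq> \<Omega>}"
    using assms by (auto simp: image_iff)
  finally show ?thesis .
qed

context positive_functional
begin

definition riesz_measure :: "'a measure" where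
  "riesz_measure = measure_of \<Omega> (sets (restrict_space borel \<Omega>)) outer"

text \<open>Caratheodory: \<open>outer\<close> is a measure on its lambda system, which contains the
  open subsets of \<Omega> and hence all its Borel sets.\<close>

lemma sets_riesz_measure: "sets riesz_measure = sets (restrict_space borel \<Omega>)"
  and emeasure_riesz_measure: "A \<in> sets (restrict_space borel \<Omega>) \<Longrightarrow> emeasure riesz_measure A = outer A"
proof -
  let ?L = "lambda_system \<Omega> (Pow \<Omega>) outer"
  interpret P: sigma_algebra \<Omega> "Pow \<Omega>" by (rule sigma_algebra_Pow)
  have L: "measure_space \<Omega> ?L outer"
    by (rule P.caratheodory_lemma[OF outer_measure_space])
  interpret L: sigma_algebra \<Omega> ?L using L by (simp add: measure_space_def)
  have sub: "sets (restrict_space borel \<Omega>) \<subseteq> ?L"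
    unfolding sets_restrict_borel_open[OF open_domain]
    using open_in_lambda_system by (intro L.sigma_sets_subset) auto
  have sa: "sigma_algebra \<Omega> (sets (restrict_space borel \<Omega>))"
    using sets.sigma_algebra_axioms[of "restrict_space borel \<Omega>"] by (simp add: space_restrict_space)
  then have "sets (restrict_space borel \<Omega>) \<subseteq> Pow \<Omega>"
    by (simp add: sigma_algebra_iff2)
  then show s: "sets riesz_measure = sets (restrict_space borel \<Omega>)"
    unfolding riesz_measure_def using sa by (simp add: sigma_algebra.sigma_sets_eq)
  have "measure_space \<Omega> (sets (restrict_space borel \<Omega>)) outer"
    using measure_down[OF L sa sub] .
  then show "A \<in> sets (restrict_space borel \<Omega>) \<Longrightarrow> emeasure riesz_measure A = outer A"
    unfolding riesz_measure_def measure_space_def by (intro emeasure_measure_of_sigma) auto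
qed

end

lemma test_function_measurable:
  fixes f :: "'a::euclidean_space \<Rightarrow> real"
  assumes "sets M = sets (restrict_space borel \<Omega>)" "test_function \<Omega> f"
  shows "f \<in> borel_measurable M"
proof -
  have "f \<in> borel_measurable borel"
    using test_function_continuous[OF assms(2)] by (rule borel_measurable_continuous_onI)
  then have "f \<in> borel_measurable (restrict_space borel \<Omega>)"
    by (rule measurable_restrict_space1)
  then show ?thesis
    using measurable_cong_sets[OF assms(1) refl] by blast
qed

lemma compact_in_sets_restrict_borel:
  fixes K :: "'a::euclidean_space set"
  assumes "compact K" "K \<subseteq> \<Omega>" "open \<Omega>"
  shows "K \<in> sets (restrict_space borel \<Omega>)"
  using assms by (subst sets_restrict_space_iff) (auto intro: borel_compact)

lemma test_function_integrable:
  fixes f :: "'a::euclidean_space \<Rightarrow> real"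
  assumes "open \<Omega>" "sets M = sets (restrict_space borel \<Omega>)"
    and fin: "\<And>K. compact K \<Longrightarrow> K \<subseteq> \<Omega> \<Longrightarrow> emeasure M K < \<infinity>"
    and "test_function \<Omega> f"
  shows "integrable M f"
proof -
  obtain K where K: "smooth_on UNIV f" "compact K" "K \<subseteq> \<Omega>" "\<And>x. x \<notin> K \<Longrightarrow> f x = 0"
    using test_functionE[OF assms(4)] by blast
  obtain B where B: "B > 0" "\<And>x. \<bar>f x\<bar> \<le> B"
    using test_function_bound[OF assms(4)] by blast
  show ?thesis
  proof (rule integrableI_bounded_set)
    show "K \<in> sets M" using compact_in_sets_restrict_borel K assms by blast
    show "f \<in> borel_measurable M" using test_function_measurable assms by blast
    show "emeasure M K < \<infinity>" using fin K by blast
    show "AE x in M. x \<in> K \<longrightarrow> norm (f x) \<le> B" using B by simp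
    show "AE x in M. x \<notin> K \<longrightarrow> f x = 0" using K by simp
  qed
qed

text \<open>Compact sets generate the Borel sets, are stable under intersection and exhaust
  \<Omega>. The measure of a compact set is a limit of integrals of test functions converging to its
  indicator, so it is determined by such integrals.\<close>

lemma radon_measure_eqI:
  fixes \<Omega> :: "'a::euclidean_space set"
  assumes op: "open \<Omega>"
    and \<mu>: "sets \<mu> = sets (restrict_space borel \<Omega>)" "\<And>K. compact K \<Longrightarrow> K \<subseteq> \<Omega> \<Longrightarrow> emeasure \<mu> K < \<infinity>"
    and \<nu>: "sets \<nu> = sets (restrict_space borel \<Omega>)" "\<And>K. compact K \<Longrightarrow> K \<subseteq> \<Omega> \<Longrightarrow> emeasure \<nu> K < \<infinity>"
    and eq: "\<And>f. test_function \<Omega> f \<Longrightarrow> (\<integral>x. f x \<partial>\<mu>) = (\<integral>x. f x \<partial>\<nu>)"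
  shows "\<mu> = \<nu>"
proof -
  have compact_eq: "emeasure \<mu> K = emeasure \<nu> K" if K: "compact K" "K \<subseteq> \<Omega>" for K
  proof (cases "K = {}")
    case False
    define V where "V n = {x \<in> \<Omega>. infdist x K < 1 / Suc n}" for n
    have "open (V n)" for n
    proof -
      have "open {x. infdist x K < 1 / Suc n}"
        by (intro open_Collect_less continuous_intros)
      then show ?thesis unfolding V_def using op by (simp add: Collect_conj_eq open_Int)
    qed
    moreover have "K \<subseteq> V n" for n using K(2) by (auto simp: V_def)
    ultimately have "\<exists>f. test_function (V n) f \<and> (\<forall>x. 0 \<le> f x \<and> f x \<le> 1) \<and> (\<forall>x\<in>K. f x = 1)" for n
      using test_function_Urysohn[OF K(1), of "V n"] by metis
    then obtain f where f: "\<And>n. test_function (V n) (f n)" "\<And>n x. 0 \<le> f n x" "\<And>n x. f n x \<le> 1"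
      "\<And>n x. x \<in> K \<Longrightarrow> f n x = 1" by metis
    have V\<Omega>: "V n \<subseteq> \<Omega>" for n by (auto simp: V_def)
    \<comment> \<open>The fixed factor \<open>f 0\<close> provides an integrable majorant for
      dominated convergence.\<close>
    define g where "g n x = f 0 x * f n x" for n x
    have f0: "test_function \<Omega> (f 0)" using f(1) V\<Omega> by (rule test_function_mono)
    have g: "test_function \<Omega> (g n)" for n
      unfolding g_def using test_function_mult_smooth[OF f0 test_function_smooth[OF f(1)]] .
    have lim: "(\<lambda>n. g n x) \<longlonglongrightarrow> indicator K x" for x
    proof (cases "x \<in> K")
      case True
      then show ?thesis using f(4) by (simp add: g_def)
    next
      case nin: False
      then have "infdist x K > 0"
        using K(1) False by (metis compact_imp_closed in_closed_iff_infdist_zero infdist_nonneg less_eq_real_def)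
      then obtain N where N: "1 / Suc N < infdist x K"
        using nat_approx_posE by blast
      have "f n x = 0" if "n \<ge> N" for n
      proof -
        have "1 / real (Suc n) \<le> 1 / real (Suc N)" using that by (intro divide_left_mono) auto
        then have "x \<notin> V n" using N by (simp add: V_def)
        then show ?thesis using test_function_outside[OF f(1)] by blast
      qed
      then have "\<forall>\<^sub>F n in sequentially. g n x = indicator K x"
        using nin by (auto simp: g_def eventually_sequentially)
      then show ?thesis by (rule tendsto_eventually)
    qed
    have conv: "(\<lambda>n. \<integral>x. g n x \<partial>M) \<longlonglongrightarrow> measure M K"
      if M: "sets M = sets (restrict_space borel \<Omega>)" "\<And>K. compact K \<Longrightarrow> K \<subseteq> \<Omega> \<Longrightarrow> emeasure M K < \<infinity>" for M
    proof -
      have KM: "K \<in> sets M" using compact_in_sets_restrict_borel[OF K op] M by simp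
      have "(\<lambda>n. \<integral>x. g n x \<partial>M) \<longlonglongrightarrow> (\<integral>x. indicator K x \<partial>M)"
      proof (rule integral_dominated_convergence)
        show "integrable M (f 0)" by (rule test_function_integrable[OF op M f0])
        show "g n \<in> borel_measurable M" for n by (rule test_function_measurable[OF M(1) g])
        show "(\<lambda>x. indicator K x :: real) \<in> borel_measurable M" using KM by simp
        show "AE x in M. (\<lambda>n. g n x) \<longlonglongrightarrow> indicator K x" using lim by simp
        show "AE x in M. norm (g n x) \<le> f 0 x" for n
          using f(2,3) by (simp add: g_def mult_left_le)
      qed
      then show ?thesis using KM by (simp add: sets.Int_space_eq2)
    qed
    have "measure \<mu> K = measure \<nu> K"
      using LIMSEQ_unique[OF conv[OF \<mu>]] conv[OF \<nu>] eq[OF g] by simp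
    then show ?thesis
      using \<mu>(2)[OF K] \<nu>(2)[OF K] by (simp add: emeasure_eq_ennreal_measure less_top)
  qed simp
  obtain C :: "nat \<Rightarrow> 'a set" where C: "\<And>n. compact (C n)" "\<And>n. C n \<subseteq> \<Omega>" "\<Union>(range C) = \<Omega>"
    using open_Union_compact_subsets[OF op] by metis
  have gen: "sets (restrict_space borel \<Omega>) = sigma_sets \<Omega> {K. compact K \<and> K \<subseteq> \<Omega>}"
  proof
    show "sigma_sets \<Omega> {K. compact K \<and> K \<subseteq> \<Omega>} \<subseteq> sets (restrict_space borel \<Omega>)"
      using sets.sigma_sets_subset[of "{K. compact K \<and> K \<subseteq> \<Omega>}" "restrict_space borel \<Omega>"]
        compact_in_sets_restrict_borel[OF _ _ op] by (auto simp: space_restrict_space)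
    have "G \<in> sigma_sets \<Omega> {K. compact K \<and> K \<subseteq> \<Omega>}" if G: "open G" "G \<subseteq> \<Omega>" for G
    proof -
      obtain D :: "nat \<Rightarrow> 'a set" where D: "\<And>n. compact (D n)" "\<And>n. D n \<subseteq> G" "\<Union>(range D) = G"
        using open_Union_compact_subsets[OF G(1)] by metis
      have "(\<Union>n. D n) \<in> sigma_sets \<Omega> {K. compact K \<and> K \<subseteq> \<Omega>}"
        using D(1,2) G(2) by (intro sigma_sets.Union sigma_sets.Basic) blast
      then show ?thesis using D(3) by simp
    qed
    then show "sets (restrict_space borel \<Omega>) \<subseteq> sigma_sets \<Omega> {K. compact K \<and> K \<subseteq> \<Omega>}"
      unfolding sets_restrict_borel_open[OF op] by (intro sigma_sets_mono) auto
  qed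
  show ?thesis
  proof (rule measure_eqI_generator_eq)
    show "Int_stable {K. compact K \<and> K \<subseteq> \<Omega>}"
      by (auto simp: Int_stable_def compact_Int)
    show "range C \<subseteq> {K. compact K \<and> K \<subseteq> \<Omega>}" "(\<Union>i. C i) = \<Omega>" using C by auto
    show "emeasure \<mu> (C i) \<noteq> \<infinity>" for i using \<mu>(2)[OF C(1,2)] by (simp add: less_top)
  qed (use gen \<mu>(1) \<nu>(1) compact_eq in auto)
qed

text \<open>The values \<open>s i\<close> are those of smooth steps from \<open>0\<close> to \<open>1\<close> over \<open>[i/N, (i+1)/N]\<close>.\<close>

lemma sum_of_steps:
  fixes s :: "nat \<Rightarrow> real"
  assumes "0 \<le> y" "y \<le> 1" "N > 0" "\<And>i. 0 \<le> s i" "\<And>i. s i \<le> 1"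
    "\<And>i. y \<le> i / N \<Longrightarrow> s i = 0" "\<And>i. Suc i / N \<le> y \<Longrightarrow> s i = 1"
  shows "\<bar>y - (\<Sum>i<N. s i) / N\<bar> \<le> 1 / N"
proof -
  define j where "j = nat \<lfloor>N * y\<rfloor>"
  have j: "real j \<le> N * y" "N * y < real j + 1" using assms(1) by (auto simp: j_def)
  have "N * y \<le> N" using assms(2) by (simp add: mult_left_le)
  then have jN: "j \<le> N" using j(1) by linarith
  have "real j = (\<Sum>i<N. if i < j then 1 else 0)"
    using jN by (simp add: sum.If_cases lessThan_def[symmetric] Int_absorb1)
  also have "\<dots> \<le> (\<Sum>i<N. s i)"
  proof (rule sum_mono)
    fix i
    have "s i = 1" if "i < j"
    proof (rule assms(7))
      have "real (Suc i) \<le> N * y" using that j(1) by linarith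
      then show "Suc i / N \<le> y" using assms(3) by (simp add: field_simps)
    qed
    then show "(if i < j then 1 else 0) \<le> s i" using assms(4) by simp
  qed
  finally have lo: "real j \<le> (\<Sum>i<N. s i)" .
  have "(\<Sum>i<N. s i) \<le> (\<Sum>i<N. if i < Suc j then 1 else 0)"
  proof (rule sum_mono)
    fix i
    have "s i = 0" if "\<not> i < Suc j"
    proof (rule assms(6))
      have "N * y \<le> real i" using that j(2) by linarith
      then show "y \<le> i / N" using assms(3) by (simp add: field_simps)
    qed
    then show "s i \<le> (if i < Suc j then 1 else 0)" using assms(5) by auto
  qed
  also have "\<dots> = real (card ({..<N} \<inter> {..<Suc j}))"
    by (simp add: sum.If_cases lessThan_def)
  also have "\<dots> \<le> real (card {..<Suc j})" by (intro of_nat_mono card_mono) auto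
  finally have hi: "(\<Sum>i<N. s i) \<le> real j + 1" by simp
  have "\<bar>N * y - (\<Sum>i<N. s i)\<bar> \<le> 1" using lo hi j by linarith
  then have "\<bar>N * y - (\<Sum>i<N. s i)\<bar> / N \<le> 1 / N" using assms(3) by (intro divide_right_mono) auto
  moreover have "\<bar>N * y - (\<Sum>i<N. s i)\<bar> / N = \<bar>y - (\<Sum>i<N. s i) / N\<bar>"
  proof -
    have "y - (\<Sum>i<N. s i) / N = (N * y - (\<Sum>i<N. s i)) / N" using assms(3) by (simp add: diff_divide_distrib)
    then show ?thesis by (simp only: abs_divide abs_of_nat)
  qed
  ultimately show ?thesis by simp
qed

section \<open>Integration against the representing measure\<close>

context positive_functional
begin

lemma emeasure_riesz_compact:
  assumes "compact K" "K \<subseteq> \<Omega>"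
  shows "emeasure riesz_measure K < \<infinity>"
proof -
  obtain \<xi> where \<xi>: "test_function \<Omega> \<xi>" "\<And>x. 0 \<le> \<xi> x" "\<And>x. \<xi> x \<le> 1" "\<And>x. x \<in> K \<Longrightarrow> \<xi> x = 1"
    using test_function_Urysohn[OF assms(1) open_domain assms(2)] by blast
  have "outer K \<le> ennreal (\<Lambda> \<xi>)" using \<xi> by (intro outer_le_single) auto
  then show ?thesis
    using emeasure_riesz_measure[OF compact_in_sets_restrict_borel[OF assms open_domain]]
    by (simp add: le_less_trans)
qed

lemma riesz_integrable: "test_function \<Omega> f \<Longrightarrow> integrable riesz_measure f"
  using test_function_integrable[OF open_domain sets_riesz_measure] emeasure_riesz_compact by blast

text \<open>Both numbers lie between the measures of \<open>B\<close> and of \<open>A\<close>: the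
  functional by \<open>outer_le_single\<close> and \<open>le_outer\<close>, the integral by
  monotonicity.\<close>

lemma sandwich:
  assumes g: "test_function \<Omega> g" "\<And>x. 0 \<le> g x" "\<And>x. g x \<le> 1"
    and A: "A \<in> sets riesz_measure" "emeasure riesz_measure A < \<infinity>" "\<And>x. x \<notin> A \<Longrightarrow> g x = 0"
    and B: "B \<in> sets riesz_measure" "B \<subseteq> A" "\<And>x. x \<in> B \<Longrightarrow> g x = 1"
  shows "\<bar>\<Lambda> g - (\<integral>x. g x \<partial>riesz_measure)\<bar> \<le> measure riesz_measure A - measure riesz_measure B"
proof -
  let ?M = riesz_measure
  have fB: "emeasure ?M B < \<infinity>"
    using A(1,2) B(2) emeasure_mono[OF B(2) A(1)] by (rule_tac le_less_trans)
  have out: "emeasure ?M A = outer A" "emeasure ?M B = outer B"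
    using A(1) B(1) emeasure_riesz_measure by (auto simp: sets_riesz_measure)
  have \<Lambda>0: "0 \<le> \<Lambda> g" using nonneg g by blast
  have "ennreal (\<Lambda> g) \<le> emeasure ?M A"
    unfolding out by (rule le_outer) (use g A in auto)
  then have 1: "\<Lambda> g \<le> measure ?M A"
    using A(2) by (simp add: emeasure_eq_ennreal_measure less_top)
  have "emeasure ?M B \<le> ennreal (\<Lambda> g)"
    unfolding out by (rule outer_le_single) (use g B in auto)
  then have 2: "measure ?M B \<le> \<Lambda> g"
    using fB \<Lambda>0 by (simp add: emeasure_eq_ennreal_measure less_top)
  have int: "integrable ?M g" using g riesz_integrable by blast
  have "(\<integral>x. g x \<partial>?M) \<le> (\<integral>x. indicator A x \<partial>?M)"
    using A g by (intro integral_mono int integrable_real_indicator) (auto simp: indicator_def)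
  then have 3: "(\<integral>x. g x \<partial>?M) \<le> measure ?M A" using A(1) by (simp add: sets.Int_space_eq2)
  have "(\<integral>x. indicator B x \<partial>?M) \<le> (\<integral>x. g x \<partial>?M)"
    using B g fB by (intro integral_mono int integrable_real_indicator) (auto simp: indicator_def)
  then have 4: "measure ?M B \<le> (\<integral>x. g x \<partial>?M)" using B(1) by (simp add: sets.Int_space_eq2)
  show ?thesis using 1 2 3 4 by linarith
qed

text \<open>Layer cake with smooth steps. \<open>f\<close> is within 1/N of the average of N steps
  \<open>g i\<close>, each caught between the indicators of two consecutive superlevel sets. By
  \<open>sandwich\<close> the errors telescope, so the average has error at most the measure of
  \<open>K\<close> divided by N.\<close>

lemma integral_riesz_unit:
  assumes f: "test_function \<Omega> f" "\<And>x. 0 \<le> f x" "\<And>x. f x \<le> 1"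
  shows "(\<integral>x. f x \<partial>riesz_measure) = \<Lambda> f"
proof -
  let ?M = riesz_measure
  let ?I = "\<lambda>f. \<integral>x. f x \<partial>?M"
  obtain K where K: "smooth_on UNIV f" "compact K" "K \<subseteq> \<Omega>" "\<And>x. x \<notin> K \<Longrightarrow> f x = 0"
    using test_functionE[OF f(1)] by blast
  obtain \<xi> where \<xi>: "test_function \<Omega> \<xi>" "\<And>x. 0 \<le> \<xi> x" "\<And>x. \<xi> x \<le> 1" "\<And>x. x \<in> K \<Longrightarrow> \<xi> x = 1"
    using test_function_Urysohn[OF K(2) open_domain K(3)] by blast
  have KM: "K \<in> sets ?M"
    using compact_in_sets_restrict_borel[OF K(2,3) open_domain] by (simp add: sets_riesz_measure)
  have fin: "emeasure ?M K < \<infinity>" using emeasure_riesz_compact K by blast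
  have bound: "\<bar>\<Lambda> f - ?I f\<bar> \<le> (\<Lambda> \<xi> + ?I \<xi> + measure ?M K) / N" if N: "N > 0" for N :: nat
  proof -
    have "\<exists>S. smooth_on UNIV S \<and> (\<forall>s. 0 \<le> S s \<and> S s \<le> (1::real)) \<and>
      (\<forall>s. s \<le> i / N \<longrightarrow> S s = 0) \<and> (\<forall>s. Suc i / N \<le> s \<longrightarrow> S s = 1)" for i
    proof -
      have "i / N < Suc i / N" using N by (simp add: divide_strict_right_mono)
      from smooth_step_exists[OF this] show ?thesis by metis
    qed
    then obtain S :: "nat \<Rightarrow> real \<Rightarrow> real" where S: "\<And>i. smooth_on UNIV (S i)" "\<And>i s. 0 \<le> S i s" "\<And>i s. S i s \<le> 1"
      "\<And>i s. s \<le> i / N \<Longrightarrow> S i s = 0" "\<And>i s. Suc i / N \<le> s \<Longrightarrow> S i s = 1"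
      by metis
    define g where "g i x = S i (f x)" for i x
    have g: "test_function \<Omega> (g i)" for i
    proof (rule test_functionI[of _ K])
      show "smooth_on UNIV (g i)"
        unfolding g_def by (rule smooth_on_compose[OF open_UNIV open_UNIV S(1) K(1)]) simp
      show "g i x = 0" if "x \<notin> K" for x using S(4)[of 0 i] K(4)[OF that] by (simp add: g_def)
    qed (use K in auto)
    define A where "A i = {x. i / N < f x}" for i :: nat
    have AK: "A i \<subseteq> K" for i
    proof
      fix x assume "x \<in> A i"
      then have "f x > 0" using N by (auto simp: A_def intro: le_less_trans[rotated])
      then show "x \<in> K" using K(4) by force
    qed
    have AM: "A i \<in> sets ?M" for i
    proof -
      have "open (A i)" unfolding A_def using test_function_continuous[OF f(1)]
        by (intro open_Collect_less continuous_intros)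
      moreover have "A i \<subseteq> \<Omega>" using AK K(3) by blast
      ultimately show ?thesis
        unfolding sets_riesz_measure sets_restrict_borel_open[OF open_domain] by blast
    qed
    have Afin: "emeasure ?M (A i) < \<infinity>" for i
      using emeasure_mono[OF AK KM] fin by (rule le_less_trans)
    have sw: "\<bar>\<Lambda> (g i) - ?I (g i)\<bar> \<le> measure ?M (A i) - measure ?M (A (Suc i))" for i
    proof (rule sandwich[OF g])
      show "A (Suc i) \<subseteq> A i"
        unfolding A_def using N by (auto elim!: le_less_trans[rotated] intro!: divide_right_mono)
      show "g i x = 0" if "x \<notin> A i" for x using that S(4) by (simp add: A_def g_def)
      show "g i x = 1" if "x \<in> A (Suc i)" for x
        using that S(5)[of i "f x"] by (simp add: A_def g_def)
    qed (use S AM Afin in \<open>auto simp: g_def\<close>)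
    define F where "F x = (\<Sum>i<N. g i x) / N" for x
    have F_eq: "F = (\<lambda>x. (1 / N) * (\<Sum>i<N. g i x))" by (auto simp: F_def)
    have F: "test_function \<Omega> F"
      unfolding F_eq by (intro test_function_scale test_function_sum g)
    have \<Lambda>F: "\<Lambda> F = (\<Sum>i<N. \<Lambda> (g i)) / N"
      unfolding F_eq by (subst scale) (auto simp: sum test_function_sum g)
    have IF: "?I F = (\<Sum>i<N. ?I (g i)) / N"
      unfolding F_def using riesz_integrable[OF g] by simp
    have "\<bar>\<Lambda> F - ?I F\<bar> = \<bar>\<Sum>i<N. \<Lambda> (g i) - ?I (g i)\<bar> / N"
      by (simp add: \<Lambda>F IF sum_subtractf diff_divide_distrib[symmetric])
    also have "\<dots> \<le> (\<Sum>i<N. measure ?M (A i) - measure ?M (A (Suc i))) / N"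
      by (intro divide_right_mono order_trans[OF sum_abs] sum_mono sw) auto
    also have "\<dots> = (measure ?M (A 0) - measure ?M (A N)) / N"
      using sum_lessThan_telescope'[of "\<lambda>i. measure ?M (A i)" N] by simp
    also have "\<dots> \<le> measure ?M K / N"
    proof -
      have "measure ?M (A 0) \<le> measure ?M K"
        unfolding measure_def using emeasure_mono[OF AK KM, of 0] fin by (intro enn2real_mono) auto
      then show ?thesis by (intro divide_right_mono) (auto intro: order_trans[of _ "measure ?M (A 0)"])
    qed
    finally have 1: "\<bar>\<Lambda> F - ?I F\<bar> \<le> measure ?M K / N" .
    \<comment> \<open>The uniform error 1/N is multiplied by the cutoff \<xi> so that the bound is
      itself a test function.\<close>
    have pt: "\<bar>f x - F x\<bar> \<le> (1 / N) * \<xi> x" for x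
    proof (cases "x \<in> K")
      case True
      then show ?thesis
        using sum_of_steps[of "f x" N "\<lambda>i. g i x"] f(2,3) N S \<xi>(4) by (simp add: F_def g_def)
    next
      case False
      then have "g i x = 0" for i using S(4)[of 0 i] K(4) by (simp add: g_def)
      then show ?thesis using K(4)[OF False] \<xi>(2) by (simp add: F_def)
    qed
    have t\<xi>: "test_function \<Omega> (\<lambda>x. (1 / N) * \<xi> x)" by (intro test_function_scale \<xi>)
    have pt': "f x \<le> F x + (1 / N) * \<xi> x" "F x \<le> f x + (1 / N) * \<xi> x" for x
      using pt[of x] by linarith+
    have "\<Lambda> f \<le> \<Lambda> (\<lambda>x. F x + (1 / N) * \<xi> x)" "\<Lambda> F \<le> \<Lambda> (\<lambda>x. f x + (1 / N) * \<xi> x)"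
      using pt' by (intro mono test_function_add f F t\<xi>; simp)+
    then have 2: "\<bar>\<Lambda> f - \<Lambda> F\<bar> \<le> \<Lambda> \<xi> / N"
      by (simp only: add f F t\<xi> scale \<xi>) (simp add: abs_le_iff)
    note int = riesz_integrable[OF f(1)] riesz_integrable[OF F] riesz_integrable[OF t\<xi>] riesz_integrable[OF \<xi>(1)]
    have "?I f \<le> ?I (\<lambda>x. F x + (1 / N) * \<xi> x)" "?I F \<le> ?I (\<lambda>x. f x + (1 / N) * \<xi> x)"
      using pt' by (intro integral_mono Bochner_Integration.integrable_add int; simp)+
    then have 3: "\<bar>?I f - ?I F\<bar> \<le> ?I \<xi> / N"
      using int by (simp add: abs_le_iff)
    have "\<bar>\<Lambda> f - ?I f\<bar> \<le> measure ?M K / N + \<Lambda> \<xi> / N + ?I \<xi> / N" using 1 2 3 by linarith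
    then show ?thesis by (simp add: add_divide_distrib)
  qed
  have "\<bar>\<Lambda> f - ?I f\<bar> \<le> 0"
  proof (rule LIMSEQ_le_const[OF lim_const_over_n])
    show "\<exists>N. \<forall>n\<ge>N. \<bar>\<Lambda> f - ?I f\<bar> \<le> (\<Lambda> \<xi> + ?I \<xi> + measure ?M K) / real n"
      using bound by (intro exI[of _ 1]) auto
  qed
  then show ?thesis by simp
qed

lemma integral_riesz:
  assumes f: "test_function \<Omega> f"
  shows "(\<integral>x. f x \<partial>riesz_measure) = \<Lambda> f"
proof -
  let ?I = "\<lambda>f. \<integral>x. f x \<partial>riesz_measure"
  obtain K where K: "smooth_on UNIV f" "compact K" "K \<subseteq> \<Omega>" "\<And>x. x \<notin> K \<Longrightarrow> f x = 0"
    using test_functionE[OF f(1)] by blast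
  obtain \<xi> where \<xi>: "test_function \<Omega> \<xi>" "\<And>x. 0 \<le> \<xi> x" "\<And>x. \<xi> x \<le> 1" "\<And>x. x \<in> K \<Longrightarrow> \<xi> x = 1"
    using test_function_Urysohn[OF K(2) open_domain K(3)] by blast
  obtain B where B: "B > 0" "\<And>x. \<bar>f x\<bar> \<le> B"
    using test_function_bound[OF f] by blast
  \<comment> \<open>The affine normalisation of \<open>f\<close> into [0,1], with \<xi> standing in
    for the constant 1.\<close>
  define g where "g x = (1 / (2 * B)) * (f x + B * \<xi> x)" for x
  have t: "test_function \<Omega> (\<lambda>x. f x + B * \<xi> x)" by (intro test_function_add test_function_scale f \<xi>)
  have g: "test_function \<Omega> g"
    unfolding g_def by (intro test_function_scale t)
  have "0 \<le> g x \<and> g x \<le> 1" for x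
  proof (cases "x \<in> K")
    case True
    then show ?thesis using B(1) B(2)[of x] \<xi>(4)[OF True] by (simp add: g_def abs_le_iff field_simps)
  next
    case False
    then show ?thesis using B(1) \<xi>(2,3)[of x] K(4)[OF False] by (simp add: g_def field_simps)
  qed
  then have Ig: "?I g = \<Lambda> g" using integral_riesz_unit[OF g] by blast
  have I\<xi>: "?I \<xi> = \<Lambda> \<xi>" using integral_riesz_unit \<xi> by blast
  have "\<Lambda> g = (1 / (2 * B)) * (\<Lambda> f + B * \<Lambda> \<xi>)"
    unfolding g_def using t f \<xi> by (simp only: scale add test_function_scale)
  moreover have "?I g = (1 / (2 * B)) * (?I f + B * ?I \<xi>)"
    unfolding g_def using riesz_integrable[OF f] riesz_integrable[OF \<xi>(1)] by simp
  ultimately show ?thesis using Ig I\<xi> B(1) by simp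
qed

theorem riesz_representation:
  "\<exists>!\<mu>. sets \<mu> = sets (restrict_space borel \<Omega>) \<and>
     (\<forall>K. compact K \<and> K \<subseteq> \<Omega> \<longrightarrow> emeasure \<mu> K < \<infinity>) \<and>
     (\<forall>f. test_function \<Omega> f \<longrightarrow> (\<integral>x. f x \<partial>\<mu>) = \<Lambda> f)"
proof (rule ex1I[of _ riesz_measure])
  show "sets riesz_measure = sets (restrict_space borel \<Omega>) \<and>
     (\<forall>K. compact K \<and> K \<subseteq> \<Omega> \<longrightarrow> emeasure riesz_measure K < \<infinity>) \<and>
     (\<forall>f. test_function \<Omega> f \<longrightarrow> (\<integral>x. f x \<partial>riesz_measure) = \<Lambda> f)"
    using sets_riesz_measure emeasure_riesz_compact integral_riesz by blast
  fix \<mu> assume "sets \<mu> = sets (restrict_space borel \<Omega>) \<and>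
     (\<forall>K. compact K \<and> K \<subseteq> \<Omega> \<longrightarrow> emeasure \<mu> K < \<infinity>) \<and>
     (\<forall>f. test_function \<Omega> f \<longrightarrow> (\<integral>x. f x \<partial>\<mu>) = \<Lambda> f)"
  then show "\<mu> = riesz_measure"
    by (intro radon_measure_eqI[OF open_domain _ _ sets_riesz_measure emeasure_riesz_compact])
       (auto simp: integral_riesz)
qed

end

section \<open>Alternating sums and wedge products\<close>

definition alt :: "nat \<Rightarrow> ((nat \<Rightarrow> 'a) \<Rightarrow> complex) \<Rightarrow> (nat \<Rightarrow> 'a) \<Rightarrow> complex" where
  "alt k T v = (\<Sum>\<sigma> | \<sigma> permutes {..<k}. of_int (sign \<sigma>) * T (\<lambda>i. v (\<sigma> i)))"

lemma alt_0: "alt 0 T v = T v"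
proof -
  have "{\<sigma>. \<sigma> permutes {..<0::nat}} = {id}" by simp
  then show ?thesis unfolding alt_def by (simp add: sign_id)
qed

lemma permutes_lessThan_permutation: "p permutes {..<k::nat} \<Longrightarrow> permutation p"
  by (auto simp: permutation_permutes)

lemma of_int_sign_square: "of_int (sign p) * of_int (sign p) = (1 :: complex)"
  by (metis of_int_1 of_int_mult sign_idempotent)

lemma alt_permute_vectors:
  assumes p: "p permutes {..<k}"
  shows "alt k T (\<lambda>i. v (p i)) = of_int (sign p) * alt k T v"
proof -
  have "alt k T v = (\<Sum>\<sigma> | \<sigma> permutes {..<k}. of_int (sign (p \<circ> \<sigma>)) * T (\<lambda>i. v ((p \<circ> \<sigma>) i)))"
    unfolding alt_def by (rule setum_permutations_compose_left[OF p])
  also have "\<dots> = (\<Sum>\<sigma> | \<sigma> permutes {..<k}. of_int (sign p) * (of_int (sign \<sigma>) * T (\<lambda>i. v (p (\<sigma> i)))))"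
    using p by (intro sum.cong refl) (simp add: sign_compose permutes_lessThan_permutation)
  also have "\<dots> = of_int (sign p) * alt k T (\<lambda>i. v (p i))" by (simp add: alt_def sum_distrib_left)
  finally show ?thesis by (simp add: mult.assoc[symmetric] of_int_sign_square)
qed

lemma alt_permute_args:
  assumes p: "p permutes {..<k}"
  shows "alt k (\<lambda>v. T (\<lambda>i. v (p i))) v = of_int (sign p) * alt k T v"
proof -
  have "alt k T v = (\<Sum>\<sigma> | \<sigma> permutes {..<k}. of_int (sign (\<sigma> \<circ> p)) * T (\<lambda>i. v ((\<sigma> \<circ> p) i)))"
    unfolding alt_def by (rule sum_permutations_compose_right[OF p])
  also have "\<dots> = (\<Sum>\<sigma> | \<sigma> permutes {..<k}. of_int (sign p) * (of_int (sign \<sigma>) * T (\<lambda>i. v (\<sigma> (p i)))))"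
    using p by (intro sum.cong refl) (simp add: sign_compose permutes_lessThan_permutation)
  also have "\<dots> = of_int (sign p) * alt k (\<lambda>v. T (\<lambda>i. v (p i))) v" by (simp add: alt_def sum_distrib_left)
  finally show ?thesis by (simp add: mult.assoc[symmetric] of_int_sign_square)
qed

lemma alt_cong: "(\<And>v. T v = T' v) \<Longrightarrow> alt k T v = alt k T' v"
  by (simp add: alt_def)

lemma alt_add: "alt k (\<lambda>v. T v + T' v) v = alt k T v + alt k T' v"
  by (simp add: alt_def sum.distrib algebra_simps)

lemma alt_cmult: "alt k (\<lambda>v. c * T v) v = c * alt k T v"
  by (simp add: alt_def sum_distrib_left mult.left_commute)

lemma alt_uminus: "alt k (\<lambda>v. - T v) v = - alt k T v"
  using alt_cmult[of k "-1" T v] by simp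

lemma alt_diff: "alt k (\<lambda>v. T v - T' v) v = alt k T v - alt k T' v"
  using alt_add[of k T "\<lambda>v. - T' v" v] alt_uminus[of k T' v] by simp

lemma alt_zero: "alt k (\<lambda>v. 0) v = 0"
  by (simp add: alt_def)

lemma alt_sum: "alt k (\<lambda>v. \<Sum>i\<in>I. T i v) v = (\<Sum>i\<in>I. alt k (T i) v)"
  by (induction I rule: infinite_finite_induct) (simp_all add: alt_zero alt_add)

lemma alt_swap:
  assumes "a < k" "b < k" "a \<noteq> b" "\<And>v. T (\<lambda>i. v (Transposition.transpose a b i)) = T' v"
  shows "alt k T' v = - alt k T v"
proof -
  have "Transposition.transpose a b permutes {..<k}" using assms by (intro permutes_swap_id) auto
  from alt_permute_args[OF this, of T v] show ?thesis using assms by (simp add: sign_swap_id)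
qed

lemma alt_eq_0:
  assumes "a < k" "b < k" "a \<noteq> b" "\<And>v. T (\<lambda>i. v (Transposition.transpose a b i)) = T v"
  shows "alt k T v = 0"
  using alt_swap[of a k b T T v] assms by simp

lemma permutes_lessThan_mono: "p permutes {..<k} \<Longrightarrow> k \<le> n \<Longrightarrow> p permutes {..<n::nat}"
  by (erule permutes_subset) auto

text \<open>Permuting the first \<open>k\<close> slots leaves the second factor alone and costs only
  a sign. The inner alternation thus contributes k! equal terms, which cancel one of the two
  factorials in \<open>wedge\<close>.\<close>

lemma wedge_alt:
  fixes \<eta> :: "'n::finite covec"
  shows "wedge k l (alt k T) \<eta> v = alt (k + l) (\<lambda>v. T v * \<eta> (\<lambda>i. v (k + i))) v / fact l"
proof -
  let ?U = "\<lambda>v. T v * \<eta> (\<lambda>i. v (k + i))"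
  have "(\<Sum>\<sigma> | \<sigma> permutes {..<k+l}. of_int (sign \<sigma>) * alt k T (\<lambda>i. v (\<sigma> i)) * \<eta> (\<lambda>i. v (\<sigma> (k + i)))) =
      alt (k + l) (\<lambda>v. alt k T v * \<eta> (\<lambda>i. v (k + i))) v"
    by (simp add: alt_def mult.assoc)
  also have "\<dots> = alt (k + l) (\<lambda>v. \<Sum>\<tau> | \<tau> permutes {..<k}. of_int (sign \<tau>) * ?U (\<lambda>i. v (\<tau> i))) v"
  proof (rule alt_cong)
    fix v
    have shift: "\<tau> (k + i) = k + i" if "\<tau> permutes {..<k}" for \<tau> i
      using permutes_not_in[OF that, of "k + i"] by simp
    have "\<eta> (\<lambda>i. v (\<tau> (k + i))) = \<eta> (\<lambda>i. v (k + i))" if "\<tau> permutes {..<k}" for \<tau>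
      by (simp add: shift[OF that])
    then show "alt k T v * \<eta> (\<lambda>i. v (k + i)) = (\<Sum>\<tau> | \<tau> permutes {..<k}. of_int (sign \<tau>) * ?U (\<lambda>i. v (\<tau> i)))"
      unfolding alt_def sum_distrib_right by (intro sum.cong refl) (simp add: mult.assoc)
  qed
  also have "\<dots> = (\<Sum>\<tau> | \<tau> permutes {..<k}. of_int (sign \<tau>) * (of_int (sign \<tau>) * alt (k + l) ?U v))"
    unfolding alt_sum alt_cmult
  proof (rule sum.cong[OF refl])
    fix \<tau> assume "\<tau> \<in> {\<tau>. \<tau> permutes {..<k}}"
    then have "\<tau> permutes {..<k + l}" by (auto intro: permutes_lessThan_mono)
    from alt_permute_args[OF this, of ?U v]
    show "of_int (sign \<tau>) * alt (k + l) (\<lambda>v. T (\<lambda>i. v (\<tau> i)) * \<eta> (\<lambda>i. v (\<tau> (k + i)))) v =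
        of_int (sign \<tau>) * (of_int (sign \<tau>) * alt (k + l) ?U v)"
      by (rule arg_cong)
  qed
  also have "\<dots> = (\<Sum>\<tau> | \<tau> permutes {..<k}. alt (k + l) ?U v)"
    by (intro sum.cong refl) (simp add: mult.assoc[symmetric] of_int_mult[symmetric] del: of_int_mult)
  also have "\<dots> = fact k * alt (k + l) ?U v"
    using card_permutations[of "{..<k}" k] by simp
  finally show ?thesis unfolding wedge_def by simp
qed

section \<open>Exterior products of bilinear forms\<close>

definition pair_prod :: "nat \<Rightarrow> (nat \<Rightarrow> 'a \<Rightarrow> 'a \<Rightarrow> complex) \<Rightarrow> (nat \<Rightarrow> 'a) \<Rightarrow> complex" where
  "pair_prod k A v = (\<Prod>j<k. A j (v (2 * j)) (v (2 * j + 1)))"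

text \<open>The exterior product of the 2-covectors A j a b - A j b a. The factors may be arbitrary
  bilinear forms; symmetric parts disappear in the alternation.\<close>

definition wedge_forms :: "nat \<Rightarrow> (nat \<Rightarrow> 'a \<Rightarrow> 'a \<Rightarrow> complex) \<Rightarrow> (nat \<Rightarrow> 'a) \<Rightarrow> complex" where
  "wedge_forms k A = alt (2 * k) (pair_prod k A)"

lemma wedge_seq_eq_wedge_forms:
  fixes c :: "nat \<Rightarrow> 'n::finite covec"
  assumes "\<And>j v. j < k \<Longrightarrow> c j v = \<i> * (A j (v 0) (v 1) - A j (v 1) (v 0))"
  shows "wedge_seq 2 c k = (\<lambda>v. \<i> ^ k * wedge_forms k A v)"
  using assms
proof (induction k)
  case 0
  show ?case by (simp add: wedge_forms_def pair_prod_def alt_0)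
next
  case (Suc k)
  let ?T = "\<lambda>v. \<i> ^ k * pair_prod k A v"
  let ?V = "\<lambda>v. pair_prod k A v * A k (v (2 * k + 1)) (v (2 * k))"
  have IH: "wedge_seq 2 c k = alt (2 * k) ?T"
    using Suc by (simp add: wedge_forms_def alt_cmult fun_eq_iff)
  show ?case
  proof
    fix v
    \<comment> \<open>Exchanging the two vectors of the last factor reverses the sign, so both
      halves of the antisymmetrised factor contribute equally and cancel the 2! of
      \<open>wedge\<close>.\<close>
    have sw: "alt (2 * k + 2) ?V v = - alt (2 * k + 2) (pair_prod (Suc k) A) v"
      by (rule alt_swap[of "2 * k" _ "2 * k + 1"])
         (auto simp: pair_prod_def Transposition.transpose_def intro!: prod.cong)
    have "wedge_seq 2 c (Suc k) v = alt (2 * k + 2) (\<lambda>v. ?T v * c k (\<lambda>i. v (2 * k + i))) v / 2"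
      by (simp add: IH wedge_alt)
    also have "alt (2 * k + 2) (\<lambda>v. ?T v * c k (\<lambda>i. v (2 * k + i))) v =
        alt (2 * k + 2) (\<lambda>v. \<i> ^ Suc k * (pair_prod (Suc k) A v - ?V v)) v"
    proof (rule alt_cong)
      fix w :: "nat \<Rightarrow> complex ^ 'n"
      have ck: "c k (\<lambda>i. w (2 * k + i)) = \<i> * (A k (w (2 * k)) (w (2 * k + 1)) - A k (w (2 * k + 1)) (w (2 * k)))"
        using Suc.prems[of k "\<lambda>i. w (2 * k + i)"] by simp
      show "?T w * c k (\<lambda>i. w (2 * k + i)) = \<i> ^ Suc k * (pair_prod (Suc k) A w - ?V w)"
        unfolding ck by (simp add: pair_prod_def algebra_simps)
    qed
    also have "\<dots> = \<i> ^ Suc k * (alt (2 * k + 2) (pair_prod (Suc k) A) v - alt (2 * k + 2) ?V v)"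
      by (simp only: alt_cmult alt_diff)
    also have "\<dots> = 2 * (\<i> ^ Suc k * wedge_forms (Suc k) A v)"
      unfolding sw by (simp add: wedge_forms_def)
    finally show "wedge_seq 2 c (Suc k) v = \<i> ^ Suc k * wedge_forms (Suc k) A v" by simp
  qed
qed

text \<open>Up to the factor i^k both sides are the same product of 2-covectors. This is what allows
  a form convenient for positivity to be exchanged for one convenient for exactness.\<close>

lemma wedge_forms_cong_antisym:
  fixes A :: "nat \<Rightarrow> complex ^ 'n::finite \<Rightarrow> complex ^ 'n \<Rightarrow> complex"
  assumes "\<And>j a b. j < k \<Longrightarrow> A j a b - A j b a = B j a b - B j b a"
  shows "wedge_forms k A v = wedge_forms k B v"
proof -
  let ?c = "\<lambda>A j v. \<i> * (A j (v 0) (v 1) - A j (v 1) (v 0)) :: complex"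
  have "wedge_seq 2 (?c A) k = (\<lambda>v. \<i> ^ k * wedge_forms k A v)"
    by (rule wedge_seq_eq_wedge_forms) simp
  moreover have "wedge_seq 2 (?c A) k = (\<lambda>v. \<i> ^ k * wedge_forms k B v)"
    by (rule wedge_seq_eq_wedge_forms) (simp add: assms)
  ultimately show ?thesis by (auto simp: fun_eq_iff)
qed

lemma wedge_forms_cong:
  "(\<And>j a b. j < k \<Longrightarrow> A j a b = B j a b) \<Longrightarrow> wedge_forms k A v = wedge_forms k B v"
  unfolding wedge_forms_def by (intro alt_cong) (auto simp: pair_prod_def intro!: prod.cong)

lemma pair_prod_split:
  assumes "i < k"
  shows "pair_prod k A v = A i (v (2 * i)) (v (2 * i + 1)) *
    (\<Prod>j\<in>{..<k} - {i}. A j (v (2 * j)) (v (2 * j + 1)))"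
  unfolding pair_prod_def using assms by (subst prod.remove[of _ i]) auto

lemma wedge_forms_slot_add:
  assumes "i < k" "\<And>a b. A i a b = B i a b + C i a b"
    "\<And>j. j \<noteq> i \<Longrightarrow> B j = A j" "\<And>j. j \<noteq> i \<Longrightarrow> C j = A j"
  shows "wedge_forms k A v = wedge_forms k B v + wedge_forms k C v"
  unfolding wedge_forms_def alt_add[symmetric]
  using assms by (intro alt_cong) (simp add: pair_prod_split[OF assms(1)] algebra_simps)

lemma wedge_forms_slot_sum:
  assumes "i < k" "finite I"
  shows "wedge_forms k (A(i := \<lambda>a b. \<Sum>s\<in>I. B s a b)) v = (\<Sum>s\<in>I. wedge_forms k (A(i := B s)) v)"
  unfolding wedge_forms_def alt_sum[symmetric]
  using assms by (intro alt_cong) (simp add: pair_prod_split[OF assms(1)] sum_distrib_right)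

lemma wedge_forms_expand:
  assumes "finite I"
  shows "wedge_forms k (\<lambda>_ a b. \<Sum>s\<in>I. of_real (b' s) * B s a b) v =
    (\<Sum>f\<in>{..<k} \<rightarrow>\<^sub>E I. of_real (\<Prod>j<k. b' (f j)) * wedge_forms k (\<lambda>j. B (f j)) v)"
proof -
  have "pair_prod k (\<lambda>_ a b. \<Sum>s\<in>I. of_real (b' s) * B s a b) w =
      (\<Sum>f\<in>{..<k} \<rightarrow>\<^sub>E I. of_real (\<Prod>j<k. b' (f j)) * pair_prod k (\<lambda>j. B (f j)) w)" for w
    unfolding pair_prod_def using assms
    by (subst prod_sum_PiE) (auto simp: prod.distrib)
  then show ?thesis
    unfolding wedge_forms_def by (subst alt_cong, assumption) (simp add: alt_sum alt_cmult)
qed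

lemma wedge_forms_scale:
  "wedge_forms k (\<lambda>_ a b. c * A a b) v = c ^ k * wedge_forms k (\<lambda>_. A) v"
  unfolding wedge_forms_def alt_cmult[symmetric]
  by (intro alt_cong) (simp add: pair_prod_def prod.distrib)

text \<open>Forms of even degree commute: exchanging two factors exchanges two pairs of slots, an
  even permutation.\<close>

lemma wedge_forms_swap:
  assumes "i < k" "j < k"
  shows "wedge_forms k (\<lambda>l. A (Transposition.transpose i j l)) v = wedge_forms k A v"
proof (cases "i = j")
  case False
  define p where "p = Transposition.transpose (2 * i) (2 * j) \<circ> Transposition.transpose (2 * i + 1) (2 * j + 1)"
  have p: "p permutes {..<2 * k}"
    unfolding p_def using assms by (intro permutes_compose permutes_swap_id) auto
  have s: "sign p = 1"
    unfolding p_def using False by (subst sign_compose) (auto simp: permutation_swap_id sign_swap_id)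
  have p_eq: "p (2 * l) = 2 * Transposition.transpose i j l" "p (2 * l + 1) = 2 * Transposition.transpose i j l + 1" for l
    using False by (auto simp: p_def Transposition.transpose_def)
  have "pair_prod k A (\<lambda>l. w (p l)) = pair_prod k (\<lambda>l. A (Transposition.transpose i j l)) w" for w
  proof -
    have "pair_prod k A (\<lambda>l. w (p l)) = (\<Prod>l<k. A l (w (2 * Transposition.transpose i j l)) (w (2 * Transposition.transpose i j l + 1)))"
      by (simp add: pair_prod_def p_eq[simplified] flip: p_eq(2)[simplified])
    also have "\<dots> = (\<Prod>l<k. A (Transposition.transpose i j l) (w (2 * l)) (w (2 * l + 1)))"
      using assms by (intro prod.reindex_bij_witness[of _ "Transposition.transpose i j" "Transposition.transpose i j"])
        (auto simp: Transposition.transpose_def)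
    finally show ?thesis by (simp add: pair_prod_def)
  qed
  then show ?thesis
    unfolding wedge_forms_def using alt_permute_args[OF p, of "pair_prod k A" v] s by simp
qed simp

text \<open>Exchanging the first arguments of two equal factors f(a) g(b) leaves the product
  unchanged but is an odd permutation.\<close>

lemma wedge_forms_rank_one_repeat:
  assumes "i < k" "j < k" "i \<noteq> j" "A i = (\<lambda>a b. f a * g b)" "A j = (\<lambda>a b. f a * g b)"
  shows "wedge_forms k A v = 0"
  unfolding wedge_forms_def
proof (rule alt_eq_0[of "2 * i" _ "2 * j"])
  fix w
  have "pair_prod k A w = A i (w (2 * i)) (w (2 * i + 1)) * (A j (w (2 * j)) (w (2 * j + 1)) *
      (\<Prod>l\<in>{..<k} - {i} - {j}. A l (w (2 * l)) (w (2 * l + 1))))" for w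
    unfolding pair_prod_split[OF assms(1)] using assms by (subst prod.remove[of _ j]) auto
  moreover have "(\<Prod>l\<in>{..<k} - {i} - {j}. A l (w (Transposition.transpose (2 * i) (2 * j) (2 * l)))
      (w (Transposition.transpose (2 * i) (2 * j) (2 * l + 1)))) =
      (\<Prod>l\<in>{..<k} - {i} - {j}. A l (w (2 * l)) (w (2 * l + 1)))"
    by (intro prod.cong refl) (auto simp: Transposition.transpose_def)
  moreover have "Transposition.transpose (2 * i) (2 * j) (2 * i + 1) = 2 * i + 1"
    "Transposition.transpose (2 * i) (2 * j) (2 * j + 1) = 2 * j + 1"
    by (auto simp: Transposition.transpose_def)
  ultimately show "pair_prod k A (\<lambda>l. w (Transposition.transpose (2 * i) (2 * j) l)) = pair_prod k A w"
    using assms(4,5) by simp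
qed (use assms in auto)

text \<open>Telescoping as for X^k - Y^k, through products with \<open>X\<close> in the first i
  slots and \<open>Y\<close> in the others. It serves both the exactness of differences of Levi
  powers and the monotonicity of powers.\<close>

lemma wedge_forms_power_diff:
  "wedge_forms k (\<lambda>_. X) v - wedge_forms k (\<lambda>_. Y) v =
    (\<Sum>i<k. wedge_forms k (\<lambda>l. if l < i then X else if l = i then (\<lambda>a b. X a b - Y a b) else Y) v)"
proof -
  define H where "H i = wedge_forms k (\<lambda>l. if l < i then X else Y) v" for i
  have "wedge_forms k (\<lambda>l. if l < i then X else if l = i then (\<lambda>a b. X a b - Y a b) else Y) v = H (Suc i) - H i"
    if "i < k" for i
  proof -
    have "H (Suc i) = wedge_forms k (\<lambda>l. if l < i then X else if l = i then (\<lambda>a b. X a b - Y a b) else Y) v + H i"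
      unfolding H_def using that by (intro wedge_forms_slot_add[of i]) (auto simp: fun_eq_iff)
    then show ?thesis by simp
  qed
  then have "(\<Sum>i<k. wedge_forms k (\<lambda>l. if l < i then X else if l = i then (\<lambda>a b. X a b - Y a b) else Y) v) =
      (\<Sum>i<k. H (Suc i) - H i)" by (intro sum.cong) auto
  also have "\<dots> = H k - H 0" by (rule sum_lessThan_telescope)
  also have "H k = wedge_forms k (\<lambda>_. X) v" unfolding H_def by (intro wedge_forms_cong) auto
  also have "H 0 = wedge_forms k (\<lambda>_. Y) v" unfolding H_def by (intro wedge_forms_cong) auto
  finally show ?thesis by simp
qed

text \<open>The exterior derivative differentiates along the omitted vector; here that vector occupies the last slot.\<close>

lemma alt_Suc:
  assumes dep: "\<And>a w w'. (\<And>j. j < k \<Longrightarrow> w j = w' j) \<Longrightarrow> G a w = G a w'"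
  shows "alt (Suc k) (\<lambda>w. G (w k) w) v =
    (-1) ^ k * (\<Sum>b<Suc k. (-1) ^ b * alt k (G (v b)) (\<lambda>j. v (if j < b then j else Suc j)))"
proof -
  let ?t = "\<lambda>b. Transposition.transpose k b"
  \<comment> \<open>Each permutation is a transposition of k with some b after a permutation fixing
    k; b is the index of the vector that lands in the last slot.\<close>
  have "{\<sigma>. \<sigma> permutes {..<Suc k}} = {\<sigma>. \<sigma> permutes insert k {..<k}}"
    by (simp add: lessThan_Suc)
  then have "alt (Suc k) (\<lambda>w. G (w k) w) v =
      (\<Sum>b\<in>insert k {..<k}. \<Sum>q | q permutes {..<k}.
        of_int (sign (?t b \<circ> q)) * G (v ((?t b \<circ> q) k)) (\<lambda>i. v ((?t b \<circ> q) i)))"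
    unfolding alt_def by (simp only: sum_over_permutations_insert[OF finite_lessThan] lessThan_iff less_irrefl not_False_eq_True)
  also have "\<dots> = (\<Sum>b\<in>insert k {..<k}. (-1) ^ k * ((-1) ^ b * alt k (G (v b)) (\<lambda>j. v (if j < b then j else Suc j))))"
  proof (rule sum.cong[OF refl])
    fix b assume b: "b \<in> insert k {..<k}"
    have "(\<Sum>q | q permutes {..<k}. of_int (sign (?t b \<circ> q)) * G (v ((?t b \<circ> q) k)) (\<lambda>i. v ((?t b \<circ> q) i))) =
        (\<Sum>q | q permutes {..<k}. of_int (sign (?t b)) * (of_int (sign q) * G (v b) (\<lambda>i. v (?t b (q i)))))"
    proof (rule sum.cong[OF refl])
      fix q assume "q \<in> {q. q permutes {..<k}}"
      then have q: "q permutes {..<k}" by simp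
      then have "q k = k" using permutes_not_in by fastforce
      moreover have "permutation q" using q by (auto intro: permutes_lessThan_permutation)
      ultimately show "of_int (sign (?t b \<circ> q)) * G (v ((?t b \<circ> q) k)) (\<lambda>i. v ((?t b \<circ> q) i)) =
          of_int (sign (?t b)) * (of_int (sign q) * G (v b) (\<lambda>i. v (?t b (q i))))"
        by (simp add: sign_compose permutation_swap_id)
    qed
    also have "\<dots> = of_int (sign (?t b)) * alt k (G (v b)) (\<lambda>i. v (?t b i))"
      by (simp add: alt_def sum_distrib_left)
    also have "\<dots> = (-1) ^ k * ((-1) ^ b * alt k (G (v b)) (\<lambda>j. v (if j < b then j else Suc j)))"
    proof (cases "b = k")
      case True
      have "alt k (G (v k)) v = alt k (G (v k)) (\<lambda>j. v (if j < k then j else Suc j))"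
        unfolding alt_def
      proof (intro sum.cong refl arg_cong2[of _ _ _ _ "(*)"] dep)
        fix q j assume "q \<in> {q. q permutes {..<k}}" "j < k"
        then have "q j < k" using permutes_in_image[of q "{..<k}" j] by auto
        then show "v (q j) = v (if q j < k then q j else Suc (q j))" by simp
      qed
      then show ?thesis using True by (simp add: sign_id flip: power_mult_distrib mult.assoc)
    next
      case False
      then have bk: "b < k" using b by simp
      \<comment> \<open>The cycle that sends b to k - 1 and lowers the indices above b. It relates
        the list with v(b) replaced by v(k) to the increasing list that omits v(b).\<close>
      define c where "c b j = (if j < b then j else if j = b then k - 1 else if j < k then j - 1 else j)" for b j
      have c: "c b permutes {..<k} \<and> sign (c b) = (-1) ^ (k - 1 - b)" if "b \<le> k - 1" for b
        using that
      proof (induction rule: inc_induct)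
        case base
        have "c (k - 1) = id" using bk by (auto simp: c_def fun_eq_iff)
        then show ?case by (simp only: permutes_id sign_id diff_self_eq_0 power_0)
      next
        case (step b)
        have eq: "c b = c (Suc b) \<circ> Transposition.transpose b (Suc b)"
          using step by (auto simp: c_def fun_eq_iff Transposition.transpose_def)
        have t: "Transposition.transpose b (Suc b) permutes {..<k}"
          using step by (intro permutes_swap_id) auto
        have "permutation (c (Suc b))" using step by (auto intro: permutes_lessThan_permutation)
        then have "sign (c b) = - ((-1) ^ (k - 1 - Suc b))"
          unfolding eq using step by (simp add: sign_compose permutation_swap_id sign_swap_id)
        also have "\<dots> = (-1) ^ (k - 1 - b)" using step by (metis Suc_diff_Suc power_Suc mult_minus1)
        finally have "sign (c b) = (-1) ^ (k - 1 - b)" .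
        moreover have "c b permutes {..<k}"
          unfolding eq by (rule permutes_compose[OF t]) (use step in simp)
        ultimately show ?case by blast
      qed
      then have cb: "c b permutes {..<k}" "sign (c b) = (-1) ^ (k - 1 - b)" using bk by auto
      let ?u = "\<lambda>j. v (if j < b then j else Suc j)"
      have "alt k (G (v b)) (\<lambda>i. v (?t b i)) = alt k (G (v b)) (\<lambda>i. ?u (c b i))"
        unfolding alt_def
      proof (intro sum.cong refl arg_cong2[of _ _ _ _ "(*)"] dep)
        fix q j assume "q \<in> {q. q permutes {..<k}}" "j < k"
        then have "q j < k" using permutes_in_image[of q "{..<k}" j] by auto
        then show "v (?t b (q j)) = ?u (c b (q j))"
          using bk by (auto simp: c_def Transposition.transpose_def)
      qed
      also have "\<dots> = (-1) ^ (k - 1 - b) * alt k (G (v b)) ?u"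
        using alt_permute_vectors[OF cb(1), of "G (v b)" ?u] cb(2) by simp
      finally have "of_int (sign (?t b)) * alt k (G (v b)) (\<lambda>i. v (?t b i)) =
          - ((-1) ^ (k - 1 - b)) * alt k (G (v b)) ?u"
        using bk by (simp add: sign_swap_id)
      moreover have "- ((-1) ^ (k - 1 - b)) = (-1) ^ k * ((-1) ^ b :: complex)"
      proof -
        have "k = Suc (k - 1 - b) + b" using bk by simp
        then have "(-1) ^ k = - ((-1) ^ (k - 1 - b)) * ((-1) ^ b :: complex)"
          by (metis power_add power_Suc mult_minus1)
        then show ?thesis by (simp flip: power_mult_distrib add: mult.assoc)
      qed
      ultimately show ?thesis by (simp only: mult.assoc)
    qed
    finally show "(\<Sum>q | q permutes {..<k}. of_int (sign (?t b \<circ> q)) * G (v ((?t b \<circ> q) k)) (\<lambda>i. v ((?t b \<circ> q) i))) =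
      (-1) ^ k * ((-1) ^ b * alt k (G (v b)) (\<lambda>j. v (if j < b then j else Suc j)))" .
  qed
  also have "\<dots> = (-1) ^ k * (\<Sum>b<Suc k. (-1) ^ b * alt k (G (v b)) (\<lambda>j. v (if j < b then j else Suc j)))"
    by (simp only: lessThan_Suc sum_distrib_left)
  finally show ?thesis .
qed

lemma alternating_alt:
  fixes T :: "'n::finite covec"
  assumes dep: "\<And>w w'. (\<And>j. j < k \<Longrightarrow> w j = w' j) \<Longrightarrow> T w = T w'"
    and lin: "\<And>w i. i < k \<Longrightarrow> linear (\<lambda>x. T (w(i := x)))"
  shows "alternating k (alt k T)"
  unfolding alternating_def
proof (intro conjI allI impI)
  fix v w :: "nat \<Rightarrow> complex ^ 'n" assume eq: "\<forall>i<k. v i = w i"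
  show "alt k T v = alt k T w"
    unfolding alt_def
  proof (intro sum.cong refl arg_cong2[of _ _ _ _ "(*)"] dep)
    fix q j assume "q \<in> {q. q permutes {..<k}}" "j < k"
    then have "q j < k" using permutes_in_image[of q "{..<k}" j] by auto
    then show "v (q j) = w (q j)" using eq by simp
  qed
next
  fix v :: "nat \<Rightarrow> complex ^ 'n" and i assume i: "i < k"
  show "linear (\<lambda>x. alt k T (v(i := x)))"
    unfolding alt_def
  proof (intro linear_compose_sum ballI)
    fix q assume "q \<in> {q. q permutes {..<k}}"
    then have q: "q permutes {..<k}" by simp
    define j where "j = inv q i"
    have qj: "q l = i \<longleftrightarrow> l = j" for l
      using q by (metis j_def permutes_inverses)
    have "q j = i" using qj by blast
    then have "j < k" using i permutes_in_image[OF q, of j] by simp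
    moreover have "(\<lambda>l. (v(i := x)) (q l)) = (\<lambda>l. v (q l))(j := x)" for x
      using qj by (auto simp: fun_eq_iff)
    ultimately have "linear (\<lambda>x. T (\<lambda>l. (v(i := x)) (q l)))"
      using lin[of j "\<lambda>l. v (q l)"] by simp
    moreover have "linear (\<lambda>z. of_int (sign q) * z :: complex)"
      by (intro linearI) (auto simp: algebra_simps)
    ultimately show "linear (\<lambda>x. of_int (sign q) * T (\<lambda>l. (v(i := x)) (q l)))"
      using linear_compose[of "\<lambda>x. T (\<lambda>l. (v(i := x)) (q l))" "\<lambda>z. of_int (sign q) * z"]
      by (simp add: o_def)
  qed
next
  fix v :: "nat \<Rightarrow> complex ^ 'n" and i j assume "i < k" "j < k" "i \<noteq> j \<and> v i = v j"
  then have t: "Transposition.transpose i j permutes {..<k}" and "i \<noteq> j" "v i = v j"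
    by (auto intro: permutes_swap_id)
  then have "(\<lambda>l. v (Transposition.transpose i j l)) = v"
    by (auto simp: Transposition.transpose_def fun_eq_iff)
  then show "alt k T v = 0"
    using alt_permute_vectors[OF t, of T v] \<open>i \<noteq> j\<close> by (simp add: sign_swap_id)
qed

section \<open>Hermitian forms and strong positivity\<close>

lemma complex_linear_iff:
  "complex_linear \<alpha> \<longleftrightarrow> (\<forall>a b. \<alpha> (a + b) = \<alpha> a + \<alpha> b) \<and> (\<forall>c a. \<alpha> (c *s a) = c * \<alpha> a)"
  unfolding complex_linear_def Vector_Spaces.linear_iff
  using vec.vector_space_axioms vector_space_over_itself.vector_space_axioms by blast

lemma complex_linear_add: "complex_linear \<alpha> \<Longrightarrow> \<alpha> (a + b) = \<alpha> a + \<alpha> b"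
  and complex_linear_scale: "complex_linear \<alpha> \<Longrightarrow> \<alpha> (c *s a) = c * \<alpha> a"
  unfolding complex_linear_iff by blast+

lemma complex_linear_zero: "complex_linear \<alpha> \<Longrightarrow> \<alpha> 0 = 0"
  using complex_linear_scale[of \<alpha> 0 0] by simp

lemma complex_linear_sum: "complex_linear \<alpha> \<Longrightarrow> \<alpha> (\<Sum>i\<in>I. f i) = (\<Sum>i\<in>I. \<alpha> (f i))"
  by (induction I rule: infinite_finite_induct) (auto simp: complex_linear_zero complex_linear_add)

lemma scaleR_eq_vec_scale: "r *\<^sub>R (a :: complex ^ 'n) = complex_of_real r *s a"
  unfolding vec_eq_iff vector_scaleR_component vector_smult_component by (simp add: scaleR_conv_of_real)

lemma complex_linear_scaleR: "complex_linear \<alpha> \<Longrightarrow> \<alpha> (r *\<^sub>R a) = of_real r * \<alpha> a"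
  by (simp add: scaleR_eq_vec_scale complex_linear_scale)

lemma vec_expansion: "(a :: complex ^ 'n::finite) = (\<Sum>i\<in>UNIV. a $ i *s axis i 1)"
  by (simp add: vec_eq_iff axis_def if_distrib cong: if_cong)

definition hermitian_form :: "(complex ^ 'n::finite \<Rightarrow> complex ^ 'n \<Rightarrow> complex) \<Rightarrow> bool" where
  "hermitian_form Q \<longleftrightarrow> (\<forall>b. complex_linear (\<lambda>a. Q a b)) \<and> (\<forall>a b. Q b a = cnj (Q a b))"

definition sum_of_squares :: "(complex ^ 'n::finite \<Rightarrow> complex ^ 'n \<Rightarrow> complex) \<Rightarrow> bool" where
  "sum_of_squares Q \<longleftrightarrow> (\<exists>(N::nat) \<alpha>. (\<forall>s<N. complex_linear (\<alpha> s)) \<and>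
     Q = (\<lambda>a b. \<Sum>s<N. \<alpha> s a * cnj (\<alpha> s b)))"

lemma sum_of_squares_zero: "sum_of_squares (\<lambda>a b. 0)"
  unfolding sum_of_squares_def by (intro exI[of _ 0]) auto

lemma sum_of_squares_add_square:
  assumes "sum_of_squares Q" "complex_linear \<beta>"
  shows "sum_of_squares (\<lambda>a b. Q a b + \<beta> a * cnj (\<beta> b))"
proof -
  obtain N :: nat and \<alpha> where "\<forall>s<N. complex_linear (\<alpha> s)" "Q = (\<lambda>a b. \<Sum>s<N. \<alpha> s a * cnj (\<alpha> s b))"
    using assms(1) unfolding sum_of_squares_def by blast
  then show ?thesis
    unfolding sum_of_squares_def using assms(2)
    by (intro exI[of _ "Suc N"] exI[of _ "\<alpha>(N := \<beta>)"]) (auto simp: less_Suc_eq intro!: sum.cong)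
qed

lemma hermitian_form_left: "hermitian_form Q \<Longrightarrow> complex_linear (\<lambda>a. Q a b)"
  and hermitian_form_cnj: "hermitian_form Q \<Longrightarrow> Q b a = cnj (Q a b)"
  unfolding hermitian_form_def by blast+

lemma hermitian_form_expand:
  assumes "hermitian_form Q"
  shows "Q (a + c *s b) (a + c *s b) = Q a a + c * Q b a + cnj (c * Q b a) + c * cnj c * Q b b"
proof -
  have r: "Q x (a + c *s b) = Q x a + cnj c * Q x b" for x
    using complex_linear_add[OF hermitian_form_left[OF assms]] complex_linear_scale[OF hermitian_form_left[OF assms]]
    by (subst (1 2 3) hermitian_form_cnj[OF assms]) simp
  show ?thesis
    using complex_linear_add[OF hermitian_form_left[OF assms]] complex_linear_scale[OF hermitian_form_left[OF assms]]
    by (simp add: r hermitian_form_cnj[OF assms, of a b] algebra_simps)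
qed

text \<open>If Q(e,e) vanishes, the quadratic form at b + c e has real part Re Q(b,b) + 2 Re (c
  Q(e,b)). This is unbounded below in c unless Q(e,b) = 0.\<close>

lemma hermitian_form_null:
  assumes Q: "hermitian_form Q" and pos: "\<And>a. 0 \<le> Re (Q a a)" and "Re (Q e e) = 0"
  shows "Q e b = 0"
proof (rule ccontr)
  assume "Q e b \<noteq> 0"
  define d where "d = (cmod (Q e b))\<^sup>2"
  have d: "d > 0" using \<open>Q e b \<noteq> 0\<close> by (simp add: d_def)
  \<comment> \<open>Chosen so that the form takes the value -1 at b + c e.\<close>
  define s where "s = (Re (Q b b) + 1) / (2 * d)"
  define c where "c = - of_real s * cnj (Q e b)"
  have im: "Im (Q e e) = 0" using hermitian_form_cnj[OF Q, of e e] by (simp add: complex_eq_iff)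
  have ee: "Q e e = 0" using im assms(3) by (simp add: complex_eq_iff)
  have "c * Q e b = - of_real (s * d)"
    unfolding c_def d_def by (simp add: complex_mult_cnj cmod_power2 mult.commute[of "cnj _"])
  then have "Re (Q (b + c *s e) (b + c *s e)) = Re (Q b b) - 2 * (s * d)"
    unfolding hermitian_form_expand[OF Q] ee by simp
  also have "\<dots> = -1" using d by (simp add: s_def field_simps)
  finally show False using pos[of "b + c *s e"] by simp
qed

text \<open>Lagrange's completion of squares, one basis vector at a time, \<open>S\<close> holding
  those not yet known to lie in the kernel. If Q(e,e) > 0, subtracting one square puts e into the
  kernel and keeps positivity; if Q(e,e) = 0, it is there already.\<close>

lemma positive_hermitian_sum_of_squares_aux:
  assumes "finite S" "hermitian_form Q" "\<And>a. 0 \<le> Re (Q a a)" "\<And>i b. i \<notin> S \<Longrightarrow> Q (axis i 1) b = 0"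
  shows "sum_of_squares Q"
  using assms
proof (induction S arbitrary: Q rule: finite_induct)
  case empty
  have "Q a b = 0" for a b
    by (subst vec_expansion[of a])
      (simp add: complex_linear_sum[OF hermitian_form_left[OF empty.prems(1)]]
        complex_linear_scale[OF hermitian_form_left[OF empty.prems(1)]] empty.prems(3))
  then have "Q = (\<lambda>a b. 0)" by (auto simp: fun_eq_iff)
  then show ?case using sum_of_squares_zero by simp
next
  case (insert k S)
  note Q = insert.prems(1) and pos = insert.prems(2)
  note lin = complex_linear_add[OF hermitian_form_left[OF Q]] complex_linear_scale[OF hermitian_form_left[OF Q]]
  define e :: "complex ^ 'a" where "e = axis k 1"
  show ?case
  proof (cases "Re (Q e e) = 0")
    case True
    then have "Q (axis i 1) b = 0" if "i \<notin> S" for i b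
      using hermitian_form_null[OF Q pos True] insert.prems(3)[of i b] that by (cases "i = k") (auto simp: e_def)
    then show ?thesis using insert.IH[OF Q pos] by blast
  next
    case False
    define d where "d = Re (Q e e)"
    have d: "d > 0" using False pos[of e] by (simp add: d_def)
    have "Im (Q e e) = 0" using hermitian_form_cnj[OF Q, of e e] by (simp add: complex_eq_iff)
    then have ee: "Q e e = of_real d" by (simp add: d_def complex_eq_iff)
    define \<beta> where "\<beta> a = Q a e / of_real (sqrt d)" for a
    have sq: "of_real (sqrt d) * of_real (sqrt d) = (of_real d :: complex)"
      using d by (simp flip: of_real_mult)
    have \<beta>: "complex_linear \<beta>"
      unfolding complex_linear_iff \<beta>_def by (simp add: lin add_divide_distrib)
    have \<beta>2: "\<beta> a * cnj (\<beta> b) = Q a e * cnj (Q b e) / of_real d" for a b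
      by (simp add: \<beta>_def sq)
    define Q' where "Q' a b = Q a b - \<beta> a * cnj (\<beta> b)" for a b
    have "sum_of_squares Q'"
    proof (rule insert.IH)
      show "hermitian_form Q'"
        unfolding hermitian_form_def
      proof (intro conjI allI)
        show "complex_linear (\<lambda>a. Q' a b)" for b
          unfolding complex_linear_iff Q'_def
          by (simp add: lin complex_linear_add[OF \<beta>] complex_linear_scale[OF \<beta>] algebra_simps)
        show "Q' b a = cnj (Q' a b)" for a b
          unfolding Q'_def hermitian_form_cnj[OF Q, of b a] by simp
      qed
      show "0 \<le> Re (Q' a a)" for a
      proof -
        \<comment> \<open>a + c e is where the form is smallest on the complex line through a in
          direction e, and the smallest value is that of Q' at a.\<close>
        define c where "c = - (Q a e / of_real d)"
        have ea: "Q e a = cnj (Q a e)" by (rule hermitian_form_cnj[OF Q])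
        have "Q (a + c *s e) (a + c *s e) = Q' a a"
          unfolding hermitian_form_expand[OF Q] ee ea Q'_def \<beta>2 c_def using d
          by (simp add: field_simps)
        then show ?thesis using pos[of "a + c *s e"] by simp
      qed
      show "Q' (axis i 1) b = 0" if "i \<notin> S" for i b
      proof (cases "i = k")
        case True
        have "Q' e b = Q e b - of_real d * cnj (Q b e) / of_real d"
          unfolding Q'_def \<beta>2 ee ..
        also have "\<dots> = 0" using d hermitian_form_cnj[OF Q, of e b] by simp
        finally show ?thesis using True by (simp add: e_def)
      next
        case False
        then show ?thesis using insert.prems(3)[of i] that by (simp add: Q'_def \<beta>2)
      qed
    qed
    from sum_of_squares_add_square[OF this \<beta>] show ?thesis by (simp add: Q'_def)
  qed
qed

lemma positive_hermitian_sum_of_squares: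
  "hermitian_form Q \<Longrightarrow> (\<And>a. 0 \<le> Re (Q a a)) \<Longrightarrow> sum_of_squares Q"
  by (rule positive_hermitian_sum_of_squares_aux[of UNIV]) auto

section \<open>The cone of strongly positive covectors\<close>

lemma strongly_positive_add:
  fixes \<omega> \<eta> :: "'n::finite covec"
  assumes "strongly_positive k \<omega>" "strongly_positive k \<eta>"
  shows "strongly_positive k (\<lambda>v. \<omega> v + \<eta> v)"
proof -
  obtain N :: nat and c :: "nat \<Rightarrow> real" and \<alpha> :: "nat \<Rightarrow> nat \<Rightarrow> complex ^ 'n \<Rightarrow> complex" where 1: "\<forall>s<N. c s \<ge> (0::real) \<and> (\<forall>j<k. complex_linear (\<alpha> s j))"
    "\<omega> = (\<lambda>v. \<Sum>s<N. complex_of_real (c s) * wedge_seq 2 (\<lambda>j. i_wedge_cnj (\<alpha> s j)) k v)"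
    using assms(1) unfolding strongly_positive_def by blast
  obtain N' :: nat and c' :: "nat \<Rightarrow> real" and \<alpha>' :: "nat \<Rightarrow> nat \<Rightarrow> complex ^ 'n \<Rightarrow> complex" where 2: "\<forall>s<N'. c' s \<ge> (0::real) \<and> (\<forall>j<k. complex_linear (\<alpha>' s j))"
    "\<eta> = (\<lambda>v. \<Sum>s<N'. complex_of_real (c' s) * wedge_seq 2 (\<lambda>j. i_wedge_cnj (\<alpha>' s j)) k v)"
    using assms(2) unfolding strongly_positive_def by blast
  define d where "d s = (if s < N then c s else c' (s - N))" for s
  define \<delta> where "\<delta> s = (if s < N then \<alpha> s else \<alpha>' (s - N))" for s
  have "(\<Sum>s<N + N'. F s) = (\<Sum>s<N. F s) + (\<Sum>s<N'. F (N + s))" for F :: "nat \<Rightarrow> complex"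
    by (induction N') (auto simp: add.assoc)
  then have "(\<Sum>s<N + N'. complex_of_real (d s) * wedge_seq 2 (\<lambda>j. i_wedge_cnj (\<delta> s j)) k v) = \<omega> v + \<eta> v" for v
    unfolding 1 2 by (simp add: d_def \<delta>_def)
  moreover have "\<forall>s<N + N'. d s \<ge> 0 \<and> (\<forall>j<k. complex_linear (\<delta> s j))"
    using 1 2 by (auto simp: d_def \<delta>_def)
  ultimately show ?thesis
    unfolding strongly_positive_def by (intro exI[of _ "N + N'"] exI[of _ d] exI[of _ \<delta>]) auto
qed

lemma strongly_positive_zero: "strongly_positive k (\<lambda>v. 0)"
  unfolding strongly_positive_def by (intro exI[of _ 0]) auto

lemma strongly_positive_scale:
  fixes \<omega> :: "'n::finite covec"
  assumes "strongly_positive k \<omega>" "r \<ge> 0"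
  shows "strongly_positive k (\<lambda>v. complex_of_real r * \<omega> v)"
proof -
  obtain N :: nat and c :: "nat \<Rightarrow> real" and \<alpha> :: "nat \<Rightarrow> nat \<Rightarrow> complex ^ 'n \<Rightarrow> complex" where 1: "\<forall>s<N. c s \<ge> (0::real) \<and> (\<forall>j<k. complex_linear (\<alpha> s j))"
    "\<omega> = (\<lambda>v. \<Sum>s<N. complex_of_real (c s) * wedge_seq 2 (\<lambda>j. i_wedge_cnj (\<alpha> s j)) k v)"
    using assms(1) unfolding strongly_positive_def by blast
  then show ?thesis
    unfolding strongly_positive_def using assms(2)
    by (intro exI[of _ N] exI[of _ "\<lambda>s. r * c s"] exI[of _ \<alpha>]) (auto simp: sum_distrib_left mult.assoc)
qed

lemma strongly_positive_sum:
  "(\<And>i. i \<in> I \<Longrightarrow> strongly_positive k (\<omega> i)) \<Longrightarrow> strongly_positive k (\<lambda>v. \<Sum>i\<in>I. \<omega> i v)"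
  by (induction I rule: infinite_finite_induct) (auto simp: strongly_positive_zero strongly_positive_add)

lemma strongly_positive_rank_one:
  assumes "\<And>j. j < k \<Longrightarrow> complex_linear (\<alpha> j)"
  shows "strongly_positive k (\<lambda>v. \<i> ^ k * wedge_forms k (\<lambda>j a b. \<alpha> j a * cnj (\<alpha> j b)) v)"
proof -
  have "wedge_seq 2 (\<lambda>j. i_wedge_cnj (\<alpha> j)) k = (\<lambda>v. \<i> ^ k * wedge_forms k (\<lambda>j a b. \<alpha> j a * cnj (\<alpha> j b)) v)"
    by (rule wedge_seq_eq_wedge_forms) (simp only: i_wedge_cnj_def wedge_1_1)
  then show ?thesis
    unfolding strongly_positive_def using assms
    by (intro exI[of _ 1] exI[of _ "\<lambda>_. 1"] exI[of _ "\<lambda>_. \<alpha>"]) auto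
qed

text \<open>Multilinearity: \<open>m\<close> counts the leading slots that still hold sums of
  squares. Splitting slot m - 1 into its squares lowers the count, and with none left the product is
  a generator of the cone.\<close>

lemma strongly_positive_wedge_aux:
  assumes "m \<le> k" "\<And>j. j < m \<Longrightarrow> sum_of_squares (A j)"
    "\<And>j. m \<le> j \<Longrightarrow> j < k \<Longrightarrow> \<exists>\<alpha>. complex_linear \<alpha> \<and> A j = (\<lambda>a b. \<alpha> a * cnj (\<alpha> b))"
  shows "strongly_positive k (\<lambda>v. \<i> ^ k * wedge_forms k A v)"
  using assms
proof (induction m arbitrary: A)
  case 0
  then obtain \<alpha> where \<alpha>: "\<And>j. j < k \<Longrightarrow> complex_linear (\<alpha> j) \<and> A j = (\<lambda>a b. \<alpha> j a * cnj (\<alpha> j b))"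
    by (metis le0)
  then have "wedge_forms k A v = wedge_forms k (\<lambda>j a b. \<alpha> j a * cnj (\<alpha> j b)) v" for v
    by (intro wedge_forms_cong) auto
  then show ?case using strongly_positive_rank_one[of k \<alpha>] \<alpha> by simp
next
  case (Suc m)
  obtain N \<alpha> where \<alpha>: "\<forall>s<N. complex_linear (\<alpha> s)" "A m = (\<lambda>a b. \<Sum>s<(N::nat). \<alpha> s a * cnj (\<alpha> s b))"
    using Suc.prems(2)[of m] unfolding sum_of_squares_def by auto
  have eq: "A(m := \<lambda>a b. \<Sum>s<N. \<alpha> s a * cnj (\<alpha> s b)) = A"
    by (rule fun_upd_idem) (rule \<alpha>(2))
  have "m < k" using Suc.prems(1) by simp
  from wedge_forms_slot_sum[OF this finite_lessThan, where A = A and B = "\<lambda>s a b. \<alpha> s a * cnj (\<alpha> s b)"] eq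
  have "wedge_forms k A v = (\<Sum>s<N. wedge_forms k (A(m := \<lambda>a b. \<alpha> s a * cnj (\<alpha> s b))) v)" for v
    by metis
  moreover have "strongly_positive k (\<lambda>v. \<Sum>s<N. \<i> ^ k * wedge_forms k (A(m := \<lambda>a b. \<alpha> s a * cnj (\<alpha> s b))) v)"
  proof (intro strongly_positive_sum Suc.IH)
    fix s j assume s: "s \<in> {..<N}" and "m \<le> j" "j < k"
    then show "\<exists>\<beta>. complex_linear \<beta> \<and> (A(m := \<lambda>a b. \<alpha> s a * cnj (\<alpha> s b))) j = (\<lambda>a b. \<beta> a * cnj (\<beta> b))"
      using Suc.prems(3)[of j] \<alpha>(1) by (cases "j = m") auto
  qed (use Suc.prems in auto)
  ultimately show ?case by (simp add: sum_distrib_left)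
qed

lemma strongly_positive_wedge:
  "(\<And>j. j < k \<Longrightarrow> sum_of_squares (A j)) \<Longrightarrow> strongly_positive k (\<lambda>v. \<i> ^ k * wedge_forms k A v)"
  by (rule strongly_positive_wedge_aux[of k k A]) auto

text \<open>Each term of the telescoped difference is a product with factors X, Y or X - Y, all of
  them sums of squares.\<close>

lemma strongly_positive_power_mono:
  assumes "sum_of_squares X" "sum_of_squares Y" "sum_of_squares (\<lambda>a b. X a b - Y a b)"
  shows "strongly_positive k (\<lambda>v. \<i> ^ k * (wedge_forms k (\<lambda>_. X) v - wedge_forms k (\<lambda>_. Y) v))"
  unfolding wedge_forms_power_diff sum_distrib_left
  using assms by (intro strongly_positive_sum strongly_positive_wedge) auto

section \<open>Lower bounds for powers of Hermitian forms\<close>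

definition frame_form :: "nat \<Rightarrow> (nat \<Rightarrow> complex ^ 'n::finite \<Rightarrow> complex) \<Rightarrow> (nat \<Rightarrow> real) \<Rightarrow>
    complex ^ 'n \<Rightarrow> complex ^ 'n \<Rightarrow> complex" where
  "frame_form n e b = (\<lambda>x y. \<Sum>s<n. of_real (b s) * (e s x * cnj (e s y)))"

lemma hermitian_frame_form:
  assumes "\<And>s. s < n \<Longrightarrow> complex_linear (e s)"
  shows "hermitian_form (frame_form n e b)"
  unfolding hermitian_form_def complex_linear_iff frame_form_def
  using assms by (auto simp: complex_linear_add complex_linear_scale algebra_simps sum.distrib sum_distrib_left)

lemma Re_frame_form: "Re (frame_form n e b a a) = (\<Sum>s<n. b s * (cmod (e s a))\<^sup>2)"
  by (simp add: frame_form_def complex_mult_cnj cmod_power2)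

lemma complex_linear_diff:
  "complex_linear \<alpha> \<Longrightarrow> complex_linear \<beta> \<Longrightarrow> complex_linear (\<lambda>a. \<alpha> a - \<beta> a)"
  unfolding complex_linear_iff by (simp add: algebra_simps)

lemma complex_linear_cmult: "complex_linear \<alpha> \<Longrightarrow> complex_linear (\<lambda>a. c * \<alpha> a)"
  unfolding complex_linear_iff by (simp add: algebra_simps)

lemma hermitian_form_diff:
  assumes "hermitian_form Q" "hermitian_form R"
  shows "hermitian_form (\<lambda>a b. Q a b - R a b)"
  unfolding hermitian_form_def
proof (intro conjI allI)
  show "complex_linear (\<lambda>a. Q a b - R a b)" for b
    by (intro complex_linear_diff hermitian_form_left assms)
  show "Q b a - R b a = cnj (Q a b - R a b)" for a b
    unfolding hermitian_form_cnj[OF assms(1), of b a] hermitian_form_cnj[OF assms(2), of b a] by simp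
qed

lemma hermitian_form_scale:
  assumes "hermitian_form Q"
  shows "hermitian_form (\<lambda>a b. of_real r * Q a b)"
  unfolding hermitian_form_def
proof (intro conjI allI)
  show "complex_linear (\<lambda>a. of_real r * Q a b)" for b
    by (intro complex_linear_cmult hermitian_form_left assms)
  show "of_real r * Q b a = cnj (of_real r * Q a b)" for a b
    unfolding hermitian_form_cnj[OF assms, of b a] by simp
qed

text \<open>Among \<open>n\<close> covectors any \<open>n - 1\<close> distinct ones contain at least \<open>m - 1\<close> of the first \<open>m\<close>, and
  products with a repeated factor vanish.\<close>

lemma frame_form_power_lower:
  fixes e :: "nat \<Rightarrow> complex ^ 'n::finite \<Rightarrow> complex"
  assumes e: "\<And>s. s < Suc k \<Longrightarrow> complex_linear (e s)" and m: "m \<le> Suc k"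
    and b: "\<And>s. 1 \<le> b s" "\<And>s. s < m \<Longrightarrow> \<beta> \<le> b s" and \<beta>: "1 \<le> \<beta>"
  shows "strongly_positive k (\<lambda>v. \<i> ^ k * (wedge_forms k (\<lambda>_. frame_form (Suc k) e b) v -
    of_real (\<beta> ^ (m - 1)) * wedge_forms k (\<lambda>_. frame_form (Suc k) e (\<lambda>_. 1)) v))"
proof -
  let ?F = "{..<k} \<rightarrow>\<^sub>E {..<Suc k}"
  let ?W = "\<lambda>f v. wedge_forms k (\<lambda>j x y. e (f j) x * cnj (e (f j) y)) v"
  have W0: "?W f v = 0" if ninj: "\<not> inj_on f {..<k}" for f v
  proof -
    obtain i j where "i < k" "j < k" "i \<noteq> j" "f i = f j" using ninj by (auto simp: inj_on_def)
    then show ?thesis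
      by (intro wedge_forms_rank_one_repeat[of i k j _ "e (f i)" "\<lambda>y. cnj (e (f i) y)"]) auto
  qed
  have coeff: "\<beta> ^ (m - 1) \<le> (\<Prod>j<k. b (f j))" if f: "f \<in> ?F" "inj_on f {..<k}" for f
  proof -
    define J where "J = {j. j < k \<and> f j < m}"
    have "card (f ` {..<k}) = k" using f(2) by (simp add: card_image)
    have "{..<m} - (f ` {..<k}) \<subseteq> {..<Suc k} - f ` {..<k}" using m by auto
    then have "card ({..<m} - (f ` {..<k})) \<le> card ({..<Suc k} - f ` {..<k})" by (intro card_mono) auto
    also have "\<dots> = Suc k - k"
      using f \<open>card (f ` {..<k}) = k\<close> by (subst card_Diff_subset) auto
    finally have 1: "card ({..<m} - (f ` {..<k})) \<le> 1" by simp
    have "{..<m} \<subseteq> f ` J \<union> ({..<m} - (f ` {..<k}))" by (auto simp: J_def)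
    then have "card {..<m} \<le> card (f ` J \<union> ({..<m} - (f ` {..<k})))" by (intro card_mono) (auto simp: J_def)
    also have "\<dots> \<le> card (f ` J) + card ({..<m} - (f ` {..<k}))" by (rule card_Un_le)
    also have "card (f ` J) \<le> card J" by (intro card_image_le) (simp add: J_def)
    finally have cJ: "m - 1 \<le> card J" using 1 by simp
    have "\<beta> ^ (m - 1) \<le> \<beta> ^ card J" using \<beta> cJ by (rule power_increasing[rotated])
    also have "\<dots> = (\<Prod>j\<in>J. \<beta>)" by simp
    also have "\<dots> \<le> (\<Prod>j\<in>J. b (f j))" using b \<beta> by (intro prod_mono) (auto simp: J_def)
    also have "\<dots> \<le> (\<Prod>j<k. b (f j))"
    proof (rule prod_mono2)
      show "0 \<le> b (f a)" "1 \<le> b (f a)" for a using b(1)[of "f a"] by auto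
    qed (auto simp: J_def)
    finally show ?thesis .
  qed
  \<comment> \<open>Selections with a repeated index contribute nothing, so their coefficients may
    be set to 0; \<open>coeff\<close> bounds those of the injective ones.\<close>
  have eq: "\<i> ^ k * (wedge_forms k (\<lambda>_. frame_form (Suc k) e b) v -
      of_real (\<beta> ^ (m - 1)) * wedge_forms k (\<lambda>_. frame_form (Suc k) e (\<lambda>_. 1)) v) =
      (\<Sum>f\<in>?F. of_real (if inj_on f {..<k} then (\<Prod>j<k. b (f j)) - \<beta> ^ (m - 1) else 0) * (\<i> ^ k * ?W f v))" for v
  proof -
    have "wedge_forms k (\<lambda>_. frame_form (Suc k) e b) v = (\<Sum>f\<in>?F. of_real (\<Prod>j<k. b (f j)) * ?W f v)"
      "wedge_forms k (\<lambda>_. frame_form (Suc k) e (\<lambda>_. 1)) v = (\<Sum>f\<in>?F. ?W f v)"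
      unfolding frame_form_def wedge_forms_expand[OF finite_lessThan] by simp_all
    then have "\<i> ^ k * (wedge_forms k (\<lambda>_. frame_form (Suc k) e b) v -
      of_real (\<beta> ^ (m - 1)) * wedge_forms k (\<lambda>_. frame_form (Suc k) e (\<lambda>_. 1)) v) =
      (\<Sum>f\<in>?F. of_real ((\<Prod>j<k. b (f j)) - \<beta> ^ (m - 1)) * (\<i> ^ k * ?W f v))"
      by (simp only: sum_distrib_left sum_subtractf[symmetric]) (simp add: algebra_simps)
    also have "\<dots> = (\<Sum>f\<in>?F. of_real (if inj_on f {..<k} then (\<Prod>j<k. b (f j)) - \<beta> ^ (m - 1) else 0) * (\<i> ^ k * ?W f v))"
      using W0 by (intro sum.cong refl) auto
    finally show ?thesis .
  qed
  show ?thesis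
    unfolding eq
  proof (intro strongly_positive_sum strongly_positive_scale strongly_positive_rank_one)
    fix f assume f: "f \<in> ?F"
    show "complex_linear (e (f j))" if "j < k" for j using f that e by (auto simp: PiE_iff)
    show "0 \<le> (if inj_on f {..<k} then (\<Prod>j<k. b (f j)) - \<beta> ^ (m - 1) else 0)"
      using coeff[OF f] by simp
  qed
qed

definition std_form :: "complex ^ 'n::finite \<Rightarrow> complex ^ 'n \<Rightarrow> complex" where
  "std_form a b = (\<Sum>i\<in>UNIV. a $ i * cnj (b $ i))"

lemma hermitian_std_form: "hermitian_form std_form"
  unfolding hermitian_form_def complex_linear_iff std_form_def
  by (auto simp: algebra_simps sum.distrib sum_distrib_left)

lemma Re_std_form: "Re (std_form a a) = (norm a)\<^sup>2"
  unfolding std_form_def power2_norm_eq_inner inner_vec_def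
  by (simp add: inner_complex_def)

lemma sum_of_squares_std_form: "sum_of_squares std_form"
  by (rule positive_hermitian_sum_of_squares[OF hermitian_std_form]) (simp add: Re_std_form)

lemma wedge_seq_kahler_form: "wedge_seq 2 (\<lambda>_. kahler_form) k = (\<lambda>v. \<i> ^ k * wedge_forms k (\<lambda>_. std_form) v)"
  by (rule wedge_seq_eq_wedge_forms) (simp add: kahler_form_expand std_form_def sum_subtractf)

text \<open>A chain of three comparisons of k-th powers: \<open>L\<close> against the frame form
  with weight \<beta> on the first m covectors, that form against \<beta>^(m-1) times the unweighted
  frame form, and the latter against c times the standard form. The middle step is not a comparison
  of Hermitian forms but the count in \<open>frame_form_power_lower\<close>.\<close>

lemma hermitian_power_lower:
  fixes L :: "complex ^ 'n::finite \<Rightarrow> complex ^ 'n \<Rightarrow> complex"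
  assumes L: "hermitian_form L" and e: "\<And>s. s < Suc k \<Longrightarrow> complex_linear (e s)" and m: "m \<le> Suc k"
    and \<beta>: "1 \<le> \<beta>" and c: "0 \<le> c"
    and lower: "\<And>a. \<beta> * (\<Sum>s<m. (cmod (e s a))\<^sup>2) + (\<Sum>s=m..<Suc k. (cmod (e s a))\<^sup>2) \<le> Re (L a a)"
    and frame: "\<And>a. c * (norm a)\<^sup>2 \<le> (\<Sum>s<Suc k. (cmod (e s a))\<^sup>2)"
  shows "strongly_positive k (\<lambda>v. \<i> ^ k * (wedge_forms k (\<lambda>_. L) v -
    of_real (\<beta> ^ (m - 1) * c ^ k) * wedge_forms k (\<lambda>_. std_form) v))"
proof -
  define b where "b s = (if s < m then \<beta> else 1)" for s
  let ?R = "frame_form (Suc k) e b" and ?R1 = "frame_form (Suc k) e (\<lambda>_. 1)"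
  let ?c = "\<lambda>x y. of_real c * std_form x y"
  have hR: "hermitian_form (frame_form (Suc k) e b')" for b'
    by (rule hermitian_frame_form) (rule e)
  have bpos: "0 \<le> b s" for s using \<beta> by (simp add: b_def)
  have sR: "sum_of_squares (frame_form (Suc k) e b')" if "\<And>s. 0 \<le> b' s" for b'
    by (rule positive_hermitian_sum_of_squares[OF hR])
      (unfold Re_frame_form, intro sum_nonneg mult_nonneg_nonneg that zero_le_power2)
  have "(\<Sum>s<Suc k. b s * (cmod (e s a))\<^sup>2) = \<beta> * (\<Sum>s<m. (cmod (e s a))\<^sup>2) + (\<Sum>s=m..<Suc k. (cmod (e s a))\<^sup>2)" for a
  proof -
    have "(\<Sum>s<Suc k. b s * (cmod (e s a))\<^sup>2) = (\<Sum>s<m. b s * (cmod (e s a))\<^sup>2) + (\<Sum>s=m..<Suc k. b s * (cmod (e s a))\<^sup>2)"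
      unfolding lessThan_atLeast0 by (rule sum.atLeastLessThan_concat[symmetric]) (use m in auto)
    also have "\<dots> = \<beta> * (\<Sum>s<m. (cmod (e s a))\<^sup>2) + (\<Sum>s=m..<Suc k. (cmod (e s a))\<^sup>2)"
      unfolding sum_distrib_left by (intro arg_cong2[of _ _ _ _ "(+)"] sum.cong refl) (simp_all add: b_def)
    finally show ?thesis .
  qed
  then have low: "Re (?R a a) \<le> Re (L a a)" for a using lower[of a] by (simp only: Re_frame_form)
  have Rnn: "0 \<le> Re (?R a a)" for a unfolding Re_frame_form by (intro sum_nonneg mult_nonneg_nonneg bpos zero_le_power2)
  have sL: "sum_of_squares L"
    by (rule positive_hermitian_sum_of_squares[OF L]) (use low Rnn order_trans in blast)
  have sLR: "sum_of_squares (\<lambda>x y. L x y - ?R x y)"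
    by (rule positive_hermitian_sum_of_squares[OF hermitian_form_diff[OF L hR]]) (use low in simp)
  have sc: "sum_of_squares ?c"
    by (rule positive_hermitian_sum_of_squares[OF hermitian_form_scale[OF hermitian_std_form]])
      (simp add: Re_std_form c)
  have sRc: "sum_of_squares (\<lambda>x y. ?R1 x y - ?c x y)"
    by (rule positive_hermitian_sum_of_squares[OF hermitian_form_diff[OF hR hermitian_form_scale[OF hermitian_std_form]]])
      (use frame in \<open>simp add: Re_frame_form Re_std_form\<close>)
  have 1: "strongly_positive k (\<lambda>v. \<i> ^ k * (wedge_forms k (\<lambda>_. L) v - wedge_forms k (\<lambda>_. ?R) v))"
    by (rule strongly_positive_power_mono[OF sL sR[OF bpos] sLR])
  have 2: "strongly_positive k (\<lambda>v. \<i> ^ k * (wedge_forms k (\<lambda>_. ?R) v -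
      of_real (\<beta> ^ (m - 1)) * wedge_forms k (\<lambda>_. ?R1) v))"
    by (rule frame_form_power_lower[OF e m]) (use \<beta> in \<open>auto simp: b_def\<close>)
  have 3: "strongly_positive k (\<lambda>v. of_real (\<beta> ^ (m - 1)) *
      (\<i> ^ k * (wedge_forms k (\<lambda>_. ?R1) v - wedge_forms k (\<lambda>_. ?c) v)))"
    by (intro strongly_positive_scale strongly_positive_power_mono sR sc sRc) (use \<beta> in auto)
  have "(\<lambda>v. \<i> ^ k * (wedge_forms k (\<lambda>_. L) v - of_real (\<beta> ^ (m - 1) * c ^ k) * wedge_forms k (\<lambda>_. std_form) v)) =
    (\<lambda>v. (\<i> ^ k * (wedge_forms k (\<lambda>_. L) v - wedge_forms k (\<lambda>_. ?R) v) +
      \<i> ^ k * (wedge_forms k (\<lambda>_. ?R) v - of_real (\<beta> ^ (m - 1)) * wedge_forms k (\<lambda>_. ?R1) v)) +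
      of_real (\<beta> ^ (m - 1)) * (\<i> ^ k * (wedge_forms k (\<lambda>_. ?R1) v - wedge_forms k (\<lambda>_. ?c) v)))"
    by (simp add: fun_eq_iff wedge_forms_scale algebra_simps)
  then show ?thesis using strongly_positive_add[OF strongly_positive_add[OF 1 2] 3] by simp
qed

section \<open>Levi forms and exact test forms\<close>

lemma linear_cmult_left: "linear f \<Longrightarrow> linear (\<lambda>x. c * f x :: complex)"
  using linear_compose[of f "(*) c"] bounded_linear.linear[OF bounded_linear_mult_right[of c]]
  by (simp add: o_def)

lemma linear_cmult_right: "linear f \<Longrightarrow> linear (\<lambda>x. f x * c :: complex)"
  using linear_cmult_left[of f c] by (simp add: mult.commute)

lemma linear_complex_of_real: "linear f \<Longrightarrow> linear (\<lambda>x. complex_of_real (f x))"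
  using linear_compose[of f complex_of_real] bounded_linear.linear[OF bounded_linear_of_real]
  by (simp add: o_def)

lemma complex_linear_imp_linear: "complex_linear \<alpha> \<Longrightarrow> linear \<alpha>"
  by (intro linearI) (simp_all add: complex_linear_add complex_linear_scaleR scaleR_conv_of_real[where 'a = complex])

lemma frechet_derivative_linear_arg:
  "smooth_on S f \<Longrightarrow> x \<in> S \<Longrightarrow> linear (frechet_derivative f (at x))"
  using linear_frechet_derivative smooth_on_differentiable by blast

definition hess :: "('a::real_normed_vector \<Rightarrow> real) \<Rightarrow> 'a \<Rightarrow> 'a \<Rightarrow> 'a \<Rightarrow> real" where
  "hess u x a b = frechet_derivative (\<lambda>y. frechet_derivative u (at y) b) (at x) a"

lemma hess_commute: "smooth_on UNIV u \<Longrightarrow> hess u x a b = hess u x b a"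
  unfolding hess_def by (rule smooth_on_second_deriv_commute[of UNIV]) auto

lemma hess_linear_left: "smooth_on UNIV u \<Longrightarrow> linear (\<lambda>a. hess u x a b)"
  unfolding hess_def by (rule frechet_derivative_linear_arg[OF smooth_on_deriv]) auto

lemma hess_linear_right: "smooth_on UNIV u \<Longrightarrow> linear (\<lambda>b. hess u x a b)"
  using hess_linear_left[of u x a] hess_commute[of u x a] by simp

lemma hess_smooth: "smooth_on UNIV u \<Longrightarrow> smooth_on UNIV (\<lambda>x. hess u x a b)"
  unfolding hess_def by (intro smooth_on_deriv)

lemma hess_has_derivative:
  "smooth_on UNIV u \<Longrightarrow> ((\<lambda>y. frechet_derivative u (at y) b) has_derivative (\<lambda>a. hess u x a b)) (at x)"
  unfolding hess_def by (rule smooth_on_has_derivative[OF smooth_on_deriv]) auto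

lemma frechet_derivative_add_fun:
  assumes "f differentiable at x" "g differentiable at x"
  shows "frechet_derivative (\<lambda>y. f y + g y) (at x) = (\<lambda>h. frechet_derivative f (at x) h + frechet_derivative g (at x) h)"
  using assms by (intro frechet_derivative_at[symmetric] has_derivative_add) (auto simp: frechet_derivative_works)

lemma hess_add:
  assumes "smooth_on UNIV u" "smooth_on UNIV w"
  shows "hess (\<lambda>y. u y + w y) x a b = hess u x a b + hess w x a b"
proof -
  have "(\<lambda>y. frechet_derivative (\<lambda>y. u y + w y) (at y) b) =
      (\<lambda>y. frechet_derivative u (at y) b + frechet_derivative w (at y) b)"
    using assms by (simp add: frechet_derivative_add_fun smooth_on_differentiable fun_eq_iff)
  then show ?thesis
    unfolding hess_def using assms
    by (simp add: frechet_derivative_add_fun smooth_on_differentiable[OF smooth_on_deriv])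
qed

lemma hess_scaled_norm_sq:
  "hess (\<lambda>z. c * (norm z)\<^sup>2) x a b = 2 * c * ((a::'a::real_inner) \<bullet> b)"
proof -
  have "((\<lambda>z::'a. c * (norm z)\<^sup>2) has_derivative (\<lambda>h. 2 * c * (y \<bullet> h))) (at y)" for y
    unfolding power2_norm_eq_inner
    by (auto intro!: derivative_eq_intros simp: inner_commute algebra_simps)
  then have 1: "frechet_derivative (\<lambda>z::'a. c * (norm z)\<^sup>2) (at y) = (\<lambda>h. 2 * c * (y \<bullet> h))" for y
    by (rule frechet_derivative_at[symmetric])
  have "((\<lambda>y. 2 * c * (y \<bullet> b)) has_derivative (\<lambda>a. 2 * c * (a \<bullet> b))) (at x)"
    by (auto intro!: derivative_eq_intros)
  then show ?thesis unfolding hess_def 1 by (simp add: frechet_derivative_at[symmetric])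
qed

lemma hess_outside:
  assumes "closed K" "\<And>y. y \<notin> K \<Longrightarrow> u y = 0" "x \<notin> K"
  shows "frechet_derivative u (at x) a = 0" "hess u x a b = 0"
proof -
  have z: "frechet_derivative f (at y) a = 0" if "\<And>y. y \<notin> K \<Longrightarrow> f y = 0" "y \<notin> K" for f :: "'a \<Rightarrow> real" and y a
  proof -
    have "((\<lambda>y. 0 :: real) has_derivative (\<lambda>h. 0)) (at y)" by simp
    then have "(f has_derivative (\<lambda>h. 0)) (at y)"
      by (rule has_derivative_transform_within_open[of _ _ _ _ "- K"]) (use assms(1) that in auto)
    then show ?thesis by (simp add: frechet_derivative_at[symmetric])
  qed
  show "frechet_derivative u (at x) a = 0" by (rule z) (use assms(2,3) in auto)
  show "hess u x a b = 0" unfolding hess_def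
    by (rule z[of "\<lambda>y. frechet_derivative u (at y) b"]) (use assms(2,3) z[of u] in auto)
qed

text \<open>With \<open>\<gamma> = d_form u\<close> one has \<open>d\<gamma> = \<partial>\<partial>\<^bsup>-\<^esup>u\<close>; \<open>dd_form u\<close> is the derivative of \<open>\<gamma>\<close> and differs from the
  Levi form of \<open>u\<close> by a symmetric bilinear form, which wedge products do not see.\<close>

definition d_form :: "(complex ^ 'n \<Rightarrow> real) \<Rightarrow> complex ^ 'n \<Rightarrow> complex ^ 'n::finite \<Rightarrow> complex" where
  "d_form u x b = \<i> / 2 * of_real (frechet_derivative u (at x) (\<i> *s b))"

definition dd_form :: "(complex ^ 'n \<Rightarrow> real) \<Rightarrow> complex ^ 'n \<Rightarrow> complex ^ 'n::finite \<Rightarrow> complex ^ 'n \<Rightarrow> complex" where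
  "dd_form u x a b = \<i> / 2 * of_real (hess u x a (\<i> *s b))"

text \<open>The Hermitian form with coefficients d^2 u / dz_j dzbar_k, expressed through the real
  Hessian. It is normalised so that |z|^2 yields \<open>std_form\<close>.\<close>

definition levi :: "(complex ^ 'n \<Rightarrow> real) \<Rightarrow> complex ^ 'n \<Rightarrow> complex ^ 'n::finite \<Rightarrow> complex ^ 'n \<Rightarrow> complex" where
  "levi u x a b = (of_real (hess u x a b + hess u x (\<i> *s a) (\<i> *s b)) +
     \<i> * of_real (hess u x a (\<i> *s b) - hess u x (\<i> *s a) b)) / 4"

lemma i_scale_linear: "linear (\<lambda>b::complex ^ 'n. \<i> *s b)"
  by (rule linearI) (simp_all add: vector_add_ldistrib scaleR_eq_vec_scale vector_smult_assoc mult.commute)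

lemma i_scale_i_scale: "\<i> *s (\<i> *s a) = - (a :: complex ^ 'n)"
  by (simp add: vec_eq_iff)

text \<open>The part of \<open>levi\<close> without the factor i is symmetric and cancels. On both
  sides i/2 times the difference of the Hessian at (a, ib) and at (b, ia) remains.\<close>

lemma dd_form_antisym:
  "smooth_on UNIV u \<Longrightarrow> dd_form u x a b - dd_form u x b a = levi u x a b - levi u x b a"
  using hess_commute[of u x b a] hess_commute[of u x "\<i> *s b" "\<i> *s a"] hess_commute[of u x b "\<i> *s a"]
    hess_commute[of u x "\<i> *s b" a]
  by (simp add: dd_form_def levi_def field_simps)

lemma levi_diag:
  "smooth_on UNIV u \<Longrightarrow> levi u x a a = of_real ((hess u x a a + hess u x (\<i> *s a) (\<i> *s a)) / 4)"
  using hess_commute[of u x a "\<i> *s a"] by (simp add: levi_def)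

lemma hermitian_levi:
  fixes u :: "complex ^ 'n::finite \<Rightarrow> real"
  assumes u: "smooth_on UNIV u"
  shows "hermitian_form (levi u x)"
  unfolding hermitian_form_def
proof (intro conjI allI)
  note L = linear_add[OF hess_linear_left[OF u]] linear_scale[OF hess_linear_left[OF u]]
    linear_neg[OF hess_linear_left[OF u]]
  fix a b :: "complex ^ 'n"
  show "levi u x b a = cnj (levi u x a b)"
    unfolding levi_def hess_commute[OF u, of x b a] hess_commute[OF u, of x "\<i> *s b" "\<i> *s a"]
      hess_commute[OF u, of x b "\<i> *s a"] hess_commute[OF u, of x "\<i> *s b" a]
    by (simp add: complex_eq_iff)
  show "complex_linear (\<lambda>a. levi u x a b)"
    unfolding complex_linear_iff
  proof (intro conjI allI)
    show add: "levi u x (a + a') b = levi u x a b + levi u x a' b" for a a'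
      by (simp add: levi_def L vector_add_ldistrib add_divide_distrib[symmetric] algebra_simps)
    have I: "levi u x (\<i> *s a) b = \<i> * levi u x a b" for a
      by (simp add: levi_def L i_scale_i_scale field_simps)
    have R: "levi u x (r *\<^sub>R a) b = of_real r * levi u x a b" for r a
    proof -
      have "\<i> *s (r *\<^sub>R a) = r *\<^sub>R (\<i> *s a)" by (rule linear_scale[OF i_scale_linear])
      then show ?thesis by (simp add: levi_def L algebra_simps)
    qed
    show "levi u x (c *s a) b = c * levi u x a b" for c a
    proof -
      have "c *s a = Re c *\<^sub>R a + \<i> *s (Im c *\<^sub>R a)"
        by (simp add: vec_eq_iff complex_eq_iff algebra_simps)
      then have "levi u x (c *s a) b = of_real (Re c) * levi u x a b + \<i> * (of_real (Im c) * levi u x a b)"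
        by (simp only: add I R)
      also have "\<dots> = c * levi u x a b"
        by (simp add: complex_eq_iff algebra_simps)
      finally show ?thesis .
    qed
  qed
qed

lemma levi_scaled_norm_sq:
  fixes x :: "complex ^ 'n::finite"
  shows "levi (\<lambda>z. c * (norm z)\<^sup>2) x = (\<lambda>a b. of_real c * std_form a b)"
proof (intro ext)
  fix a b :: "complex ^ 'n"
  have 1: "a \<bullet> b = Re (std_form a b)" for a b :: "complex ^ 'n"
    unfolding std_form_def inner_vec_def by (simp add: inner_complex_def)
  have 2: "std_form (\<i> *s a) b = \<i> * std_form a b" "std_form a (\<i> *s b) = - \<i> * std_form a b" for a b :: "complex ^ 'n"
    by (simp_all add: std_form_def sum_distrib_left mult.assoc mult.left_commute sum_negf)
  show "levi (\<lambda>z. c * (norm z)\<^sup>2) x a b = of_real c * std_form a b"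
    unfolding levi_def hess_scaled_norm_sq 1 2 by (simp add: complex_eq_iff)
qed

lemma levi_add:
  "smooth_on UNIV u \<Longrightarrow> smooth_on UNIV w \<Longrightarrow>
    levi (\<lambda>y. u y + w y) x a b = levi u x a b + levi w x a b"
  by (simp add: levi_def hess_add field_simps)

section \<open>Construction of test forms\<close>

lemma test_formI:
  assumes "\<And>x. alternating k (\<omega> x)" "\<And>v. smooth_on UNIV (\<lambda>x. \<omega> x v)" "compact K" "K \<subseteq> \<Omega>"
    "\<And>x v. x \<notin> K \<Longrightarrow> \<omega> x v = 0"
  shows "test_form \<Omega> k \<omega>"
proof -
  have "form_support \<omega> \<subseteq> K"
    unfolding form_support_def using assms(3,5) by (intro closure_minimal compact_imp_closed) blast+
  moreover have "closed (form_support \<omega>)" by (simp add: form_support_def)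
  ultimately have "compact (form_support \<omega>)"
    using compact_Int_closed[OF assms(3)] by (metis Int_absorb1)
  then show ?thesis
    unfolding test_form_def using assms \<open>form_support \<omega> \<subseteq> K\<close> by auto
qed

lemma test_formE:
  assumes "test_form \<Omega> k \<omega>"
  obtains K where "\<And>x. alternating k (\<omega> x)" "\<And>v. smooth_on UNIV (\<lambda>x. \<omega> x v)" "compact K" "K \<subseteq> \<Omega>"
    "\<And>x v. x \<notin> K \<Longrightarrow> \<omega> x v = 0"
proof
  show "\<omega> x v = 0" if "x \<notin> form_support \<omega>" for x v
    using that closure_subset[of "{x. \<exists>v. \<omega> x v \<noteq> 0}"] unfolding form_support_def by blast
qed (use assms in \<open>auto simp: test_form_def\<close>)

lemma alternatingD:
  assumes "alternating k \<omega>"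
  shows "(\<And>i. i < k \<Longrightarrow> v i = w i) \<Longrightarrow> \<omega> v = \<omega> w"
    and "i < k \<Longrightarrow> linear (\<lambda>x. \<omega> (v(i := x)))"
    and "i < k \<Longrightarrow> j < k \<Longrightarrow> i \<noteq> j \<Longrightarrow> v i = v j \<Longrightarrow> \<omega> v = 0"
proof -
  note a = assms[unfolded alternating_def]
  show "(\<And>i. i < k \<Longrightarrow> v i = w i) \<Longrightarrow> \<omega> v = \<omega> w"
    by (rule a[THEN conjunct1, rule_format])
  show "i < k \<Longrightarrow> linear (\<lambda>x. \<omega> (v(i := x)))"
    by (rule a[THEN conjunct2, THEN conjunct1, rule_format])
  show "i < k \<Longrightarrow> j < k \<Longrightarrow> i \<noteq> j \<Longrightarrow> v i = v j \<Longrightarrow> \<omega> v = 0"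
    by (rule a[THEN conjunct2, THEN conjunct2, rule_format, OF _ _ conjI])
qed

lemma alternatingI:
  assumes "\<And>v w. (\<And>i. i < k \<Longrightarrow> v i = w i) \<Longrightarrow> \<omega> v = \<omega> w"
    and "\<And>v i. i < k \<Longrightarrow> linear (\<lambda>x. \<omega> (v(i := x)))"
    and "\<And>v i j. i < k \<Longrightarrow> j < k \<Longrightarrow> i \<noteq> j \<Longrightarrow> v i = v j \<Longrightarrow> \<omega> v = 0"
  shows "alternating k \<omega>"
  unfolding alternating_def
proof (intro conjI allI impI)
  show "\<omega> v = \<omega> w" if "\<forall>i<k. v i = w i" for v w
    by (rule assms(1)) (use that in blast)
  show "linear (\<lambda>x. \<omega> (v(i := x)))" if "i < k" for v i by (rule assms(2)[OF that])
  show "\<omega> v = 0" if "i < k" "j < k" "i \<noteq> j \<and> v i = v j" for v i j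
    by (rule assms(3)[of i j]) (use that in blast)+
qed

lemma alternating_add:
  fixes \<omega> \<eta> :: "'a::finite covec"
  assumes "alternating k \<omega>" "alternating k \<eta>"
  shows "alternating k (\<lambda>v. \<omega> v + \<eta> v)"
proof (rule alternatingI)
  show "\<omega> v + \<eta> v = \<omega> w + \<eta> w" if "\<And>i. i < k \<Longrightarrow> v i = w i" for v w
    using alternatingD(1)[OF assms(1) that] alternatingD(1)[OF assms(2) that] by simp
  show "linear (\<lambda>x. \<omega> (v(i := x)) + \<eta> (v(i := x)))" if "i < k" for v i
    by (intro linear_compose_add alternatingD(2)[OF _ that] assms)
  show "\<omega> v + \<eta> v = 0" if "i < k" "j < k" "i \<noteq> j" "v i = v j" for v i j
    using alternatingD(3)[OF assms(1) that] alternatingD(3)[OF assms(2) that] by simp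
qed

lemma alternating_cmult:
  fixes \<omega> :: "'a::finite covec"
  assumes "alternating k \<omega>"
  shows "alternating k (\<lambda>v. c * \<omega> v)"
proof (rule alternatingI)
  show "c * \<omega> v = c * \<omega> w" if "\<And>i. i < k \<Longrightarrow> v i = w i" for v w
    using alternatingD(1)[OF assms that] by simp
  show "linear (\<lambda>x. c * \<omega> (v(i := x)))" if "i < k" for v i
    by (intro linear_cmult_left alternatingD(2)[OF assms that])
  show "c * \<omega> v = 0" if "i < k" "j < k" "i \<noteq> j" "v i = v j" for v i j
    using alternatingD(3)[OF assms that] by simp
qed

lemma test_form_add:
  assumes "test_form \<Omega> k \<omega>" "test_form \<Omega> k \<eta>"
  shows "test_form \<Omega> k (\<lambda>x v. \<omega> x v + \<eta> x v)"
proof -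
  obtain K where K: "\<And>x. alternating k (\<omega> x)" "\<And>v. smooth_on UNIV (\<lambda>x. \<omega> x v)" "compact K" "K \<subseteq> \<Omega>"
    "\<And>x v. x \<notin> K \<Longrightarrow> \<omega> x v = 0" using test_formE[OF assms(1)] by blast
  obtain L where L: "\<And>x. alternating k (\<eta> x)" "\<And>v. smooth_on UNIV (\<lambda>x. \<eta> x v)" "compact L" "L \<subseteq> \<Omega>"
    "\<And>x v. x \<notin> L \<Longrightarrow> \<eta> x v = 0" using test_formE[OF assms(2)] by blast
  show ?thesis
    by (rule test_formI[of _ _ "K \<union> L"])
      (use K L in \<open>auto intro: alternating_add smooth_on_add\<close>)
qed

lemma test_form_cmult:
  assumes "test_form \<Omega> k \<omega>"
  shows "test_form \<Omega> k (\<lambda>x v. c * \<omega> x v)"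
proof -
  obtain K where K: "\<And>x. alternating k (\<omega> x)" "\<And>v. smooth_on UNIV (\<lambda>x. \<omega> x v)" "compact K" "K \<subseteq> \<Omega>"
    "\<And>x v. x \<notin> K \<Longrightarrow> \<omega> x v = 0" using test_formE[OF assms(1)] by blast
  show ?thesis
    by (rule test_formI[of _ _ K])
      (use K in \<open>auto intro: alternating_cmult smooth_on_mult smooth_on_const\<close>)
qed

lemma test_form_zero: "test_form \<Omega> k (\<lambda>x v. 0)"
  by (rule test_formI[of _ _ "{}"]) (auto simp: alternating_def smooth_on_const intro: linear_zero)

lemma test_form_sum:
  "(\<And>i. i \<in> I \<Longrightarrow> test_form \<Omega> k (\<omega> i)) \<Longrightarrow> test_form \<Omega> k (\<lambda>x v. \<Sum>i\<in>I. \<omega> i x v)"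
  by (induction I rule: infinite_finite_induct) (auto simp: test_form_zero intro: test_form_add)

lemma pair_prod_linear:
  fixes A :: "nat \<Rightarrow> complex ^ 'n::finite \<Rightarrow> complex ^ 'n \<Rightarrow> complex"
  assumes "i < 2 * k" and l: "\<And>j b. j < k \<Longrightarrow> linear (\<lambda>a. A j a b)" and r: "\<And>j a. j < k \<Longrightarrow> linear (\<lambda>b. A j a b)"
  shows "linear (\<lambda>x. pair_prod k A (w(i := x)))"
proof -
  define j where "j = i div 2"
  have j: "j < k" using assms(1) by (simp add: j_def)
  have c: "(\<Prod>l\<in>{..<k} - {j}. A l ((w(i := x)) (2 * l)) ((w(i := x)) (2 * l + 1))) =
      (\<Prod>l\<in>{..<k} - {j}. A l (w (2 * l)) (w (2 * l + 1)))" for x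
    by (intro prod.cong refl) (auto simp: j_def)
  have "linear (\<lambda>x. A j ((w(i := x)) (2 * j)) ((w(i := x)) (2 * j + 1)))"
  proof (cases "even i")
    case True
    then have "i = 2 * j" by (simp add: j_def)
    then show ?thesis using l[OF j, of "w (2 * j + 1)"] by simp
  next
    case False
    then have "i = 2 * j + 1" by (simp add: j_def)
    then show ?thesis using r[OF j, of "w (2 * j)"] by simp
  qed
  then show ?thesis
    unfolding pair_prod_split[OF j] c
    by (rule linear_cmult_right)
qed

lemma alternating_wedge_forms:
  fixes A :: "nat \<Rightarrow> complex ^ 'n::finite \<Rightarrow> complex ^ 'n \<Rightarrow> complex"
  assumes "\<And>j b. j < k \<Longrightarrow> linear (\<lambda>a. A j a b)" "\<And>j a. j < k \<Longrightarrow> linear (\<lambda>b. A j a b)"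
  shows "alternating (2 * k) (wedge_forms k A)"
  unfolding wedge_forms_def
proof (rule alternating_alt)
  show "pair_prod k A w = pair_prod k A w'" if "\<And>j. j < 2 * k \<Longrightarrow> w j = w' j" for w w'
    unfolding pair_prod_def using that by (intro prod.cong) auto
qed (rule pair_prod_linear[OF _ assms])

lemma smooth_alt:
  "(\<And>v. smooth_on UNIV (\<lambda>x. T x v)) \<Longrightarrow> smooth_on UNIV (\<lambda>x. alt k (T x) v)"
  unfolding alt_def by (intro smooth_on_sum smooth_on_mult smooth_on_const) auto

lemma smooth_pair_prod:
  "(\<And>j a b. j < k \<Longrightarrow> smooth_on UNIV (\<lambda>x. A x j a b)) \<Longrightarrow> smooth_on UNIV (\<lambda>x. pair_prod k (A x) v)"
  unfolding pair_prod_def by (intro smooth_on_prod) auto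

text \<open>A product vanishes wherever one factor does, so compact support in a single slot
  \<open>i\<close> suffices. In the application only the slot of the compactly supported potential
  qualifies.\<close>

lemma test_form_wedge_forms:
  fixes A :: "complex ^ 'n::finite \<Rightarrow> nat \<Rightarrow> complex ^ 'n \<Rightarrow> complex ^ 'n \<Rightarrow> complex"
  assumes "\<And>x j b. j < k \<Longrightarrow> linear (\<lambda>a. A x j a b)" "\<And>x j a. j < k \<Longrightarrow> linear (\<lambda>b. A x j a b)"
    "\<And>j a b. j < k \<Longrightarrow> smooth_on UNIV (\<lambda>x. A x j a b)"
    "compact K" "K \<subseteq> \<Omega>" "i < k" "\<And>x a b. x \<notin> K \<Longrightarrow> A x i a b = 0"
  shows "test_form \<Omega> (2 * k) (\<lambda>x. wedge_forms k (A x))"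
proof (rule test_formI[OF _ _ assms(4,5)])
  show "alternating (2 * k) (wedge_forms k (A x))" for x
    by (rule alternating_wedge_forms) (use assms in auto)
  show "smooth_on UNIV (\<lambda>x. wedge_forms k (A x) v)" for v
    unfolding wedge_forms_def by (intro smooth_alt smooth_pair_prod assms)
  show "wedge_forms k (A x) v = 0" if "x \<notin> K" for x v
  proof -
    have "pair_prod k (A x) w = 0" for w
      unfolding pair_prod_split[OF assms(6)] by (simp only: assms(7)[OF that] mult_zero_left)
    then show ?thesis unfolding wedge_forms_def alt_def by simp
  qed
qed

lemma std_form_linear:
  fixes a b :: "complex ^ 'n::finite"
  shows "linear (\<lambda>a. std_form a b)" "linear (\<lambda>b. std_form a b)"
proof -
  show 1: "linear (\<lambda>a. std_form a b)" for b :: "complex ^ 'n"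
    by (intro complex_linear_imp_linear hermitian_form_left hermitian_std_form)
  have "linear (\<lambda>b. cnj (std_form b a))"
    using linear_compose[OF 1 bounded_linear.linear[OF bounded_linear_cnj]] by (simp add: o_def)
  then show "linear (\<lambda>b. std_form a b)"
    by (simp add: hermitian_form_cnj[OF hermitian_std_form, of a, symmetric])
qed

lemma test_form_function_std:
  fixes f :: "complex ^ 'n::finite \<Rightarrow> real"
  assumes "test_function \<Omega> f"
  shows "test_form \<Omega> (2 * k) (\<lambda>x v. of_real (f x) * wedge_forms k (\<lambda>_. std_form) v)"
proof -
  obtain K where K: "smooth_on UNIV f" "compact K" "K \<subseteq> \<Omega>" "\<And>x. x \<notin> K \<Longrightarrow> f x = 0"
    using test_functionE[OF assms] by blast
  show ?thesis
    by (rule test_formI[of _ _ K])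
      (use K in \<open>auto intro!: alternating_cmult alternating_wedge_forms std_form_linear smooth_on_mult smooth_on_const smooth_on_of_real\<close>)
qed

lemma d_form_linear: "smooth_on UNIV u \<Longrightarrow> linear (\<lambda>b. d_form u x b)"
  unfolding d_form_def
  using linear_compose[OF i_scale_linear frechet_derivative_linear_arg[of UNIV u x]]
  by (intro linear_cmult_left linear_complex_of_real) (simp add: o_def)

lemma d_form_smooth: "smooth_on UNIV u \<Longrightarrow> smooth_on UNIV (\<lambda>x. d_form u x b)"
  unfolding d_form_def by (intro smooth_on_mult smooth_on_const smooth_on_of_real smooth_on_deriv) auto

lemma dd_form_linear:
  assumes "smooth_on UNIV u"
  shows "linear (\<lambda>a. dd_form u x a b)" "linear (\<lambda>b. dd_form u x a b)"
proof -
  show "linear (\<lambda>a. dd_form u x a b)"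
    unfolding dd_form_def by (intro linear_cmult_left linear_complex_of_real hess_linear_left assms)
  show "linear (\<lambda>b. dd_form u x a b)"
    unfolding dd_form_def using linear_compose[OF i_scale_linear hess_linear_right[OF assms, of x a]]
    by (intro linear_cmult_left linear_complex_of_real) (simp add: o_def)
qed

lemma dd_form_smooth: "smooth_on UNIV u \<Longrightarrow> smooth_on UNIV (\<lambda>x. dd_form u x a b)"
  unfolding dd_form_def by (intro smooth_on_mult smooth_on_const smooth_on_of_real hess_smooth) auto

section \<open>Exterior derivatives of products of potentials\<close>

lemma d_form_has_derivative:
  "smooth_on UNIV u \<Longrightarrow> ((\<lambda>y. d_form u y b) has_derivative (\<lambda>a. dd_form u x a b)) (at x)"
  unfolding d_form_def dd_form_def
  by (intro has_derivative_mult_right has_derivative_of_real hess_has_derivative)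

text \<open>The third derivative, written as the Hessian of a first derivative, so that its symmetry
  in a and b is symmetry of second derivatives.\<close>

definition ddd_form :: "(complex ^ 'n \<Rightarrow> real) \<Rightarrow> complex ^ 'n \<Rightarrow> complex ^ 'n::finite \<Rightarrow> complex ^ 'n \<Rightarrow> complex ^ 'n \<Rightarrow> complex" where
  "ddd_form u x a b c = \<i> / 2 * of_real (hess (\<lambda>y. frechet_derivative u (at y) (\<i> *s c)) x a b)"

lemma dd_form_has_derivative:
  assumes "smooth_on UNIV u"
  shows "((\<lambda>y. dd_form u y b c) has_derivative (\<lambda>a. ddd_form u x a b c)) (at x)"
proof -
  have "((\<lambda>y. hess u y b (\<i> *s c)) has_derivative
      (\<lambda>a. hess (\<lambda>y. frechet_derivative u (at y) (\<i> *s c)) x a b)) (at x)"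
    unfolding hess_def[of u] by (rule hess_has_derivative) (intro smooth_on_deriv assms)
  then show ?thesis
    unfolding dd_form_def ddd_form_def by (intro has_derivative_mult_right has_derivative_of_real)
qed

lemma ddd_form_commute: "smooth_on UNIV u \<Longrightarrow> ddd_form u x a b c = ddd_form u x b a c"
  unfolding ddd_form_def by (subst hess_commute) (auto intro: smooth_on_deriv)

text \<open>A primitive of the product of all \<open>dd_form (u j)\<close> with
  \<open>dd_form \<phi>\<close>. The one-form occupies the last slot, next to the slot that receives
  the direction of differentiation.\<close>

definition potential_form ::
    "nat \<Rightarrow> (complex ^ 'n \<Rightarrow> real) \<Rightarrow> (nat \<Rightarrow> complex ^ 'n \<Rightarrow> real) \<Rightarrow> 'n::finite form" where
  "potential_form l \<phi> u = (\<lambda>x. alt (2 * l + 1) (\<lambda>v. d_form \<phi> x (v (2 * l)) * pair_prod l (\<lambda>j. dd_form (u j) x) v))"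

lemma test_form_potential_form:
  fixes \<phi> :: "complex ^ 'n::finite \<Rightarrow> real"
  assumes \<phi>: "test_function \<Omega> \<phi>" and u: "\<And>j. j < l \<Longrightarrow> smooth_on UNIV (u j)"
  shows "test_form \<Omega> (2 * l + 1) (potential_form l \<phi> u)"
proof -
  obtain K where K: "smooth_on UNIV \<phi>" "compact K" "K \<subseteq> \<Omega>" "\<And>x. x \<notin> K \<Longrightarrow> \<phi> x = 0"
    using test_functionE[OF \<phi>] by blast
  show ?thesis
    unfolding potential_form_def
  proof (rule test_formI[OF _ _ K(2,3)])
    fix x
    show "alternating (2 * l + 1) (alt (2 * l + 1) (\<lambda>v. d_form \<phi> x (v (2 * l)) * pair_prod l (\<lambda>j. dd_form (u j) x) v))"
    proof (rule alternating_alt)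
      fix w w' :: "nat \<Rightarrow> complex ^ 'n" assume eq: "\<And>j. j < 2 * l + 1 \<Longrightarrow> w j = w' j"
      then have "pair_prod l (\<lambda>j. dd_form (u j) x) w = pair_prod l (\<lambda>j. dd_form (u j) x) w'"
        unfolding pair_prod_def by (intro prod.cong) auto
      then show "d_form \<phi> x (w (2 * l)) * pair_prod l (\<lambda>j. dd_form (u j) x) w =
          d_form \<phi> x (w' (2 * l)) * pair_prod l (\<lambda>j. dd_form (u j) x) w'"
        using eq[of "2 * l"] by simp
    next
      fix w :: "nat \<Rightarrow> complex ^ 'n" and i assume i: "i < 2 * l + 1"
      show "linear (\<lambda>y. d_form \<phi> x ((w(i := y)) (2 * l)) * pair_prod l (\<lambda>j. dd_form (u j) x) (w(i := y)))"
      proof (cases "i = 2 * l")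
        case True
        have c: "pair_prod l (\<lambda>j. dd_form (u j) x) (w(i := y)) = pair_prod l (\<lambda>j. dd_form (u j) x) w" for y
          unfolding pair_prod_def by (intro prod.cong refl) (auto simp: True)
        show ?thesis
          unfolding c using True d_form_linear[OF K(1)] by (intro linear_cmult_right) simp
      next
        case False
        then have "linear (\<lambda>y. pair_prod l (\<lambda>j. dd_form (u j) x) (w(i := y)))"
          using i by (intro pair_prod_linear dd_form_linear u) auto
        then show ?thesis
          using False by (simp add: linear_cmult_left)
      qed
    qed
    show "smooth_on UNIV (\<lambda>x. alt (2 * l + 1) (\<lambda>v. d_form \<phi> x (v (2 * l)) * pair_prod l (\<lambda>j. dd_form (u j) x) v) v)" for v
      by (intro smooth_alt smooth_on_mult d_form_smooth smooth_pair_prod dd_form_smooth K u) auto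
    show "alt (2 * l + 1) (\<lambda>v. d_form \<phi> x (v (2 * l)) * pair_prod l (\<lambda>j. dd_form (u j) x) v) v = 0" if "x \<notin> K" for v
      unfolding alt_def d_form_def using hess_outside(1)[OF compact_imp_closed[OF K(2)] K(4) that] by simp
  qed
qed

text \<open>Alternation is a finite sum and commutes with differentiation. The sum over the omitted
  vector then becomes one alternation by \<open>alt_Suc\<close>, with the differentiation direction
  in slot \<open>k\<close>.\<close>

lemma ext_deriv_alt:
  fixes T :: "'n::finite form"
  assumes dep: "\<And>y w w'. (\<And>j. j < k \<Longrightarrow> w j = w' j) \<Longrightarrow> T y w = T y w'"
    and T': "\<And>w. ((\<lambda>y. T y w) has_derivative (\<lambda>a. G a w)) (at x)"
  shows "ext_deriv k (\<lambda>y. alt k (T y)) x v = (-1) ^ k * alt (Suc k) (\<lambda>w. G (w k) w) v"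
proof -
  have G: "frechet_derivative (\<lambda>y. T y w) (at x) = (\<lambda>a. G a w)" for w
    using frechet_derivative_at[OF T'] by simp
  have "((\<lambda>y. alt k (T y) w) has_derivative (\<lambda>a. alt k (G a) w)) (at x)" for w
    unfolding alt_def by (intro has_derivative_sum has_derivative_mult_right T')
  then have D: "frechet_derivative (\<lambda>y. alt k (T y) w) (at x) = (\<lambda>a. alt k (G a) w)" for w
    using frechet_derivative_at by metis
  have "G a w = G a w'" if "\<And>j. j < k \<Longrightarrow> w j = w' j" for a w w'
  proof -
    have "(\<lambda>y. T y w) = (\<lambda>y. T y w')" by (intro ext dep that)
    then show ?thesis using G[of w] G[of w'] by metis
  qed
  from alt_Suc[of k G, OF this]
  have "(-1) ^ k * alt (Suc k) (\<lambda>w. G (w k) w) v =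
      (\<Sum>b<Suc k. (-1) ^ b * alt k (G (v b)) (\<lambda>j. v (if j < b then j else Suc j)))"
    by (simp flip: mult.assoc power_mult_distrib)
  then show ?thesis unfolding ext_deriv_def D by simp
qed

text \<open>The Leibniz rule. A term that differentiates some \<open>dd_form (u i)\<close> contains
  a third derivative symmetric in two alternated slots and vanishes; only the term differentiating
  \<open>d_form \<phi>\<close> survives.\<close>

lemma ext_deriv_potential_form:
  fixes \<phi> :: "complex ^ 'n::finite \<Rightarrow> real"
  assumes \<phi>: "smooth_on UNIV \<phi>" and u: "\<And>j. j < l \<Longrightarrow> smooth_on UNIV (u j)"
  shows "ext_deriv (2 * l + 1) (potential_form l \<phi> u) x v =
    wedge_forms (Suc l) (\<lambda>j. if j < l then dd_form (u j) x else dd_form \<phi> x) v"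
proof -
  let ?P = "\<lambda>y. pair_prod l (\<lambda>j. dd_form (u j) y)"
  let ?R = "\<lambda>i w. \<Prod>j\<in>{..<l} - {i}. dd_form (u j) x (w (2 * j)) (w (2 * j + 1))"
  let ?T = "\<lambda>y w. d_form \<phi> y (w (2 * l)) * ?P y w"
  let ?D = "\<lambda>i a w. ddd_form (u i) x a (w (2 * i)) (w (2 * i + 1)) * ?R i w"
  define G where "G a w = d_form \<phi> x (w (2 * l)) * (\<Sum>i<l. ?D i a w) + dd_form \<phi> x a (w (2 * l)) * ?P x w" for a w
  have "((\<lambda>y. ?T y w) has_derivative (\<lambda>a. G a w)) (at x)" for w
    unfolding G_def pair_prod_def
    by (intro has_derivative_mult has_derivative_prod d_form_has_derivative dd_form_has_derivative \<phi> u) auto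
  then have "ext_deriv (2 * l + 1) (potential_form l \<phi> u) x v =
      (-1) ^ (2 * l + 1) * alt (Suc (2 * l + 1)) (\<lambda>w. G (w (2 * l + 1)) w) v"
    unfolding potential_form_def
  proof (rule ext_deriv_alt[rotated])
    fix y :: "complex ^ 'n" and w w' :: "nat \<Rightarrow> complex ^ 'n" assume eq: "\<And>j. j < 2 * l + 1 \<Longrightarrow> w j = w' j"
    then have "?P y w = ?P y w'"
      unfolding pair_prod_def by (intro prod.cong) auto
    then show "?T y w = ?T y w'" using eq[of "2 * l"] by simp
  qed
  \<comment> \<open>The sign of the odd degree 2l + 1. It is cancelled below, when the last two
    slots are exchanged.\<close>
  also have "\<dots> = - alt (2 * l + 2) (\<lambda>w. G (w (2 * l + 1)) w) v" by simp
  also have "alt (2 * l + 2) (\<lambda>w. G (w (2 * l + 1)) w) v =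
      (\<Sum>i<l. alt (2 * l + 2) (\<lambda>w. d_form \<phi> x (w (2 * l)) * ?D i (w (2 * l + 1)) w) v) +
      alt (2 * l + 2) (\<lambda>w. dd_form \<phi> x (w (2 * l + 1)) (w (2 * l)) * ?P x w) v"
    unfolding G_def alt_add alt_sum[symmetric] sum_distrib_left ..
  also have "(\<Sum>i<l. alt (2 * l + 2) (\<lambda>w. d_form \<phi> x (w (2 * l)) * ?D i (w (2 * l + 1)) w) v) = 0"
  proof (intro sum.neutral ballI)
    fix i assume "i \<in> {..<l}"
    then have i: "i < l" by simp
    show "alt (2 * l + 2) (\<lambda>w. d_form \<phi> x (w (2 * l)) * ?D i (w (2 * l + 1)) w) v = 0"
    proof (rule alt_eq_0[of "2 * l + 1" _ "2 * i"])
      fix w :: "nat \<Rightarrow> complex ^ 'n"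
      let ?t = "Transposition.transpose (2 * l + 1) (2 * i)"
      have t: "?t (2 * l) = 2 * l" "?t (2 * l + 1) = 2 * i" "?t (2 * i) = 2 * l + 1" "?t (2 * i + 1) = 2 * i + 1"
        using i by (auto simp: Transposition.transpose_def)
      have R: "?R i (\<lambda>j. w (?t j)) = ?R i w"
      proof (intro prod.cong refl)
        fix j assume "j \<in> {..<l} - {i}"
        then have "?t (2 * j) = 2 * j" "?t (2 * j + 1) = 2 * j + 1" by (auto simp: Transposition.transpose_def)
        then show "dd_form (u j) x (w (?t (2 * j))) (w (?t (2 * j + 1))) = dd_form (u j) x (w (2 * j)) (w (2 * j + 1))"
          by (simp only:)
      qed
      show "d_form \<phi> x (w (?t (2 * l))) * ?D i (w (?t (2 * l + 1))) (\<lambda>j. w (?t j)) =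
          d_form \<phi> x (w (2 * l)) * ?D i (w (2 * l + 1)) w"
        unfolding R unfolding t using ddd_form_commute[OF u[OF i], of x "w (2 * i)"] by (simp only:)
    qed (use i in auto)
  qed
  also have "alt (2 * l + 2) (\<lambda>w. dd_form \<phi> x (w (2 * l + 1)) (w (2 * l)) * ?P x w) v =
      - alt (2 * l + 2) (\<lambda>w. ?P x w * dd_form \<phi> x (w (2 * l)) (w (2 * l + 1))) v"
  proof (rule alt_swap[of "2 * l" _ "2 * l + 1"])
    fix w :: "nat \<Rightarrow> complex ^ 'n"
    let ?t = "Transposition.transpose (2 * l) (2 * l + 1)"
    have "?P x (\<lambda>i. w (?t i)) = ?P x w"
      unfolding pair_prod_def by (intro prod.cong refl) (auto simp: Transposition.transpose_def)
    then show "?P x (\<lambda>i. w (?t i)) * dd_form \<phi> x (w (?t (2 * l))) (w (?t (2 * l + 1))) =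
        dd_form \<phi> x (w (2 * l + 1)) (w (2 * l)) * ?P x w"
      by simp
  qed auto
  also have "alt (2 * l + 2) (\<lambda>w. ?P x w * dd_form \<phi> x (w (2 * l)) (w (2 * l + 1))) v =
      wedge_forms (Suc l) (\<lambda>j. if j < l then dd_form (u j) x else dd_form \<phi> x) v"
  proof -
    have "?P x w = pair_prod l (\<lambda>j. if j < l then dd_form (u j) x else dd_form \<phi> x) w" for w
      unfolding pair_prod_def by (intro prod.cong) auto
    then have "?P x w * dd_form \<phi> x (w (2 * l)) (w (2 * l + 1)) =
        pair_prod (Suc l) (\<lambda>j. if j < l then dd_form (u j) x else dd_form \<phi> x) w" for w
      by (simp add: pair_prod_def)
    then show ?thesis unfolding wedge_forms_def by (simp add: alt_def)
  qed
  finally show ?thesis by simp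
qed

section \<open>Closed positive currents and their trace measures\<close>

definition trace_form :: "('n::finite covec)" where
  "trace_form = (\<lambda>v. wedge_seq 2 (\<lambda>_. kahler_form) (CARD('n) - 1) v / fact (CARD('n) - 1))"

lemma trace_form_eq:
  assumes "CARD('n::finite) = Suc k"
  shows "(trace_form :: 'n covec) = (\<lambda>v. \<i> ^ k * wedge_forms k (\<lambda>_. std_form) v / fact k)"
  unfolding trace_form_def wedge_seq_kahler_form assms by simp

lemma strongly_positive_trace_form:
  assumes "0 \<le> r"
  shows "strongly_positive (CARD('n::finite) - 1) (\<lambda>v. complex_of_real r * (trace_form :: 'n covec) v)"
proof -
  have "strongly_positive (CARD('n) - 1) (\<lambda>v. complex_of_real (r / fact (CARD('n) - 1)) *
      (\<i> ^ (CARD('n) - 1) * wedge_forms (CARD('n) - 1) (\<lambda>_. std_form :: complex ^ 'n \<Rightarrow> _) v))"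
    using assms by (intro strongly_positive_scale strongly_positive_wedge sum_of_squares_std_form) auto
  then show ?thesis by (simp add: trace_form_def wedge_seq_kahler_form)
qed

lemma test_form_trace_form:
  fixes f :: "complex ^ 'n::finite \<Rightarrow> real"
  assumes "test_function \<Omega> f"
  shows "test_form \<Omega> (2 * CARD('n) - 2) (\<lambda>x v. complex_of_real (f x) * trace_form v)"
proof -
  have "2 * CARD('n) - 2 = 2 * (CARD('n) - 1)" by simp
  moreover have "(\<lambda>x v. complex_of_real (f x) * (trace_form :: 'n covec) v) =
    (\<lambda>x v. (\<i> ^ (CARD('n) - 1) / fact (CARD('n) - 1)) *
      (complex_of_real (f x) * wedge_forms (CARD('n) - 1) (\<lambda>_. std_form) v))"
    unfolding trace_form_def wedge_seq_kahler_form by (simp add: fun_eq_iff)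
  ultimately show ?thesis
    using test_form_cmult[OF test_form_function_std[OF assms]] by metis
qed

context
  fixes \<Omega> :: "(complex ^ 'n::finite) set" and \<theta> :: "'n form \<Rightarrow> complex"
  assumes \<theta>: "closed_positive_current11 \<Omega> \<theta>"
begin

lemma current_add:
  "test_form \<Omega> (2 * CARD('n) - 2) \<omega> \<Longrightarrow> test_form \<Omega> (2 * CARD('n) - 2) \<eta> \<Longrightarrow>
    \<theta> (\<lambda>x v. \<omega> x v + \<eta> x v) = \<theta> \<omega> + \<theta> \<eta>"
  using \<theta> unfolding closed_positive_current11_def positive_current11_def current11_def current2_def Let_def
  by blast

lemma current_cmult:
  "test_form \<Omega> (2 * CARD('n) - 2) \<omega> \<Longrightarrow> \<theta> (\<lambda>x v. c * \<omega> x v) = c * \<theta> \<omega>"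
  using \<theta> unfolding closed_positive_current11_def positive_current11_def current11_def current2_def Let_def
  by blast

lemma current_positive:
  "test_form \<Omega> (2 * CARD('n) - 2) \<omega> \<Longrightarrow> (\<And>x. strongly_positive (CARD('n) - 1) (\<omega> x)) \<Longrightarrow> \<theta> \<omega> \<in> \<real>\<^sub>\<ge>\<^sub>0"
  using \<theta> unfolding closed_positive_current11_def positive_current11_def by blast

lemma current_closed:
  "Suc k = 2 * CARD('n) - 2 \<Longrightarrow> test_form \<Omega> k \<eta> \<Longrightarrow> \<theta> (ext_deriv k \<eta>) = 0"
  using \<theta> unfolding closed_positive_current11_def closed_current2_def by blast

lemma current_sum:
  "(\<And>i. i \<in> I \<Longrightarrow> test_form \<Omega> (2 * CARD('n) - 2) (\<omega> i)) \<Longrightarrow>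
    \<theta> (\<lambda>x v. \<Sum>i\<in>I. \<omega> i x v) = (\<Sum>i\<in>I. \<theta> (\<omega> i))"
proof (induction I rule: infinite_finite_induct)
  case (insert i I)
  then show ?case by (simp add: current_add test_form_sum)
qed (use current_cmult[OF test_form_zero, of 0] in simp_all)

definition trace_functional :: "(complex ^ 'n \<Rightarrow> real) \<Rightarrow> complex" where
  "trace_functional f = \<theta> (\<lambda>x v. complex_of_real (f x) * trace_form v)"

lemma trace_functional_add:
  assumes "test_function \<Omega> f" "test_function \<Omega> g"
  shows "trace_functional (\<lambda>x. f x + g x) = trace_functional f + trace_functional g"
  using current_add[OF test_form_trace_form[OF assms(1)] test_form_trace_form[OF assms(2)]]
  unfolding trace_functional_def by (simp add: distrib_right)

lemma trace_functional_scale: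
  assumes "test_function \<Omega> f"
  shows "trace_functional (\<lambda>x. c * f x) = of_real c * trace_functional f"
  using current_cmult[OF test_form_trace_form[OF assms], of "of_real c"]
  unfolding trace_functional_def by (simp add: mult.assoc)

lemma trace_functional_nonneg:
  assumes "test_function \<Omega> f" "\<And>x. 0 \<le> f x"
  shows "trace_functional f \<in> \<real>\<^sub>\<ge>\<^sub>0"
  unfolding trace_functional_def
  by (intro current_positive test_form_trace_form assms strongly_positive_trace_form)

text \<open>Positivity gives real values on nonnegative functions. A general \<open>f\<close> is the
  difference of the nonnegative functions f + B * \<xi> and B * \<xi>, with \<xi> a cutoff equal to
  1 on the support.\<close>

lemma trace_functional_real:
  assumes "open \<Omega>" "test_function \<Omega> f"
  shows "trace_functional f = of_real (Re (trace_functional f))"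
proof -
  obtain K where K: "smooth_on UNIV f" "compact K" "K \<subseteq> \<Omega>" "\<And>x. x \<notin> K \<Longrightarrow> f x = 0"
    using test_functionE[OF assms(2)] by blast
  obtain \<xi> where \<xi>: "test_function \<Omega> \<xi>" "\<And>x. 0 \<le> \<xi> x" "\<And>x. \<xi> x \<le> 1" "\<And>x. x \<in> K \<Longrightarrow> \<xi> x = 1"
    using test_function_Urysohn[OF K(2) assms(1) K(3)] by blast
  obtain B where B: "B > 0" "\<And>x. \<bar>f x\<bar> \<le> B"
    using test_function_bound[OF assms(2)] by blast
  have "0 \<le> f x + B * \<xi> x" for x
    using B(1) B(2)[of x] \<xi>(2)[of x] \<xi>(4)[of x] K(4)[of x] by (cases "x \<in> K") (auto simp: abs_le_iff)
  then have "trace_functional (\<lambda>x. f x + B * \<xi> x) \<in> \<real>\<^sub>\<ge>\<^sub>0"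
    by (intro trace_functional_nonneg test_function_add test_function_scale assms \<xi>)
  moreover have "trace_functional \<xi> \<in> \<real>\<^sub>\<ge>\<^sub>0" by (intro trace_functional_nonneg \<xi>)
  moreover have "trace_functional (\<lambda>x. f x + B * \<xi> x) = trace_functional f + of_real B * trace_functional \<xi>"
    by (simp add: trace_functional_add trace_functional_scale test_function_scale assms \<xi>)
  ultimately have "Im (trace_functional f) = 0"
    by (auto simp: nonneg_Reals_def complex_eq_iff)
  then show ?thesis by (simp add: complex_eq_iff)
qed

text \<open>Since the functional is real on test functions, the complex equation in
  \<open>is_trace_measure\<close> is a real one. Riesz representation then supplies the existence
  and uniqueness that the definite description requires.\<close>

lemma is_trace_measure_trace_measure:
  assumes "open \<Omega>"
  shows "is_trace_measure \<Omega> \<theta> (trace_measure \<Omega> \<theta>)"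
proof -
  interpret positive_functional \<Omega> "\<lambda>f. Re (trace_functional f)"
  proof
    show "Re (trace_functional (\<lambda>x. f x + g x)) = Re (trace_functional f) + Re (trace_functional g)"
      if "test_function \<Omega> f" "test_function \<Omega> g" for f g
      using trace_functional_add[OF that] by simp
    show "Re (trace_functional (\<lambda>x. c * f x)) = c * Re (trace_functional f)" if "test_function \<Omega> f" for f c
      using trace_functional_scale[OF that] by simp
    show "0 \<le> Re (trace_functional f)" if "test_function \<Omega> f" "\<And>x. 0 \<le> f x" for f
      using trace_functional_nonneg[OF that] by (auto simp: nonneg_Reals_def)
  qed (rule assms)
  have "is_trace_measure \<Omega> \<theta> \<mu> \<longleftrightarrow> sets \<mu> = sets (restrict_space borel \<Omega>) \<and>
     (\<forall>K. compact K \<and> K \<subseteq> \<Omega> \<longrightarrow> emeasure \<mu> K < \<infinity>) \<and>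
     (\<forall>f. test_function \<Omega> f \<longrightarrow> (\<integral>x. f x \<partial>\<mu>) = Re (trace_functional f))" for \<mu>
  proof -
    have "complex_of_real (\<integral>x. f x \<partial>\<mu>) = trace_functional f \<longleftrightarrow> (\<integral>x. f x \<partial>\<mu>) = Re (trace_functional f)"
      if "test_function \<Omega> f" for f
      using trace_functional_real[OF assms that] by (metis Re_complex_of_real)
    then show ?thesis
      unfolding is_trace_measure_def trace_functional_def trace_form_def by blast
  qed
  then have "\<exists>!\<mu>. is_trace_measure \<Omega> \<theta> \<mu>" using riesz_representation by simp
  then show ?thesis unfolding trace_measure_def by (rule theI')
qed

text \<open>\<open>(i\<partial>\<partial>\<^bsup>-\<^esup>(q + \<phi>))\<^bsup>k\<^esup> - (i\<partial>\<partial>\<^bsup>-\<^esup>q)\<^bsup>k\<^esup>\<close> is the exterior derivative of a compactly supported form.\<close>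

lemma
  fixes \<phi> q :: "complex ^ 'n \<Rightarrow> real"
  assumes n: "CARD('n) = Suc (Suc l)" and \<phi>: "test_function \<Omega> \<phi>" and q: "smooth_on UNIV q"
  defines "\<omega> \<equiv> (\<lambda>x v. wedge_forms (Suc l) (\<lambda>_. levi (\<lambda>y. q y + \<phi> y) x) v - wedge_forms (Suc l) (\<lambda>_. levi q x) v)"
  shows test_form_levi_power_diff: "test_form \<Omega> (2 * CARD('n) - 2) \<omega>"
    and current_levi_power_diff: "\<theta> \<omega> = 0"
proof -
  define w where "w y = q y + \<phi> y" for y
  have \<phi>s: "smooth_on UNIV \<phi>" using \<phi> by (rule test_function_smooth)
  have w: "smooth_on UNIV w" unfolding w_def by (intro smooth_on_add q \<phi>s) auto
  define u where "u i j = (if j < i then w else q)" for i j :: nat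
  have us: "smooth_on UNIV (u i j)" for i j using w q by (simp add: u_def)
  define \<eta> where "\<eta> i = ext_deriv (2 * l + 1) (potential_form l \<phi> (u i))" for i
  have \<eta>: "\<eta> i x v = wedge_forms (Suc l) (\<lambda>j. if j < l then dd_form (u i j) x else dd_form \<phi> x) v" for i x v
    unfolding \<eta>_def using ext_deriv_potential_form[OF \<phi>s us] .
  have \<omega>: "\<omega> = (\<lambda>x v. \<Sum>i<Suc l. \<eta> i x v)"
  proof (intro ext)
    fix x :: "complex ^ 'n" and v
    let ?S = "\<lambda>i j. if j < i then dd_form w x else if j = i then (\<lambda>a b. dd_form w x a b - dd_form q x a b) else dd_form q x"
    \<comment> \<open>Levi forms are traded for \<open>dd_form\<close>, which has the same
      antisymmetric part and is the derivative of \<open>d_form\<close>.\<close>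
    have "\<omega> x v = wedge_forms (Suc l) (\<lambda>_. dd_form w x) v - wedge_forms (Suc l) (\<lambda>_. dd_form q x) v"
      unfolding \<omega>_def w_def[symmetric]
      using wedge_forms_cong_antisym[of "Suc l" "\<lambda>_. dd_form w x" "\<lambda>_. levi w x" v]
        wedge_forms_cong_antisym[of "Suc l" "\<lambda>_. dd_form q x" "\<lambda>_. levi q x" v]
        dd_form_antisym[OF w] dd_form_antisym[OF q] by simp
    also have "\<dots> = (\<Sum>i<Suc l. wedge_forms (Suc l) (?S i) v)" by (rule wedge_forms_power_diff)
    also have "\<dots> = (\<Sum>i<Suc l. \<eta> i x v)"
    proof (rule sum.cong[OF refl])
      fix i assume "i \<in> {..<Suc l}"
      then have i: "i < Suc l" by simp
      have d: "dd_form w x a b - dd_form q x a b = dd_form \<phi> x a b" for a b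
        unfolding dd_form_def w_def hess_add[OF q \<phi>s] by (simp add: algebra_simps)
      \<comment> \<open>Forms of degree 2 commute, so the slot carrying \<phi> moves to the last
        position, the place where \<open>potential_form\<close> puts it.\<close>
      have "wedge_forms (Suc l) (?S i) v = wedge_forms (Suc l) (\<lambda>j. ?S i (Transposition.transpose i l j)) v"
        using wedge_forms_swap[OF i lessI, of "?S i"] by simp
      also have "\<dots> = \<eta> i x v"
        unfolding \<eta>
      proof (rule wedge_forms_cong)
        fix j a b assume "j < Suc l"
        then show "?S i (Transposition.transpose i l j) a b = (if j < l then dd_form (u i j) x else dd_form \<phi> x) a b"
          using i d by (auto simp: Transposition.transpose_def u_def)
      qed
      finally show "wedge_forms (Suc l) (?S i) v = \<eta> i x v" .
    qed
    finally show "\<omega> x v = (\<Sum>i<Suc l. \<eta> i x v)" .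
  qed
  have deg: "2 * CARD('n) - 2 = 2 * Suc l" "Suc (2 * l + 1) = 2 * CARD('n) - 2" using n by simp_all
  obtain K where K: "smooth_on UNIV \<phi>" "compact K" "K \<subseteq> \<Omega>" "\<And>x. x \<notin> K \<Longrightarrow> \<phi> x = 0"
    using test_functionE[OF \<phi>] by blast
  have t: "test_form \<Omega> (2 * CARD('n) - 2) (\<eta> i)" for i
  proof -
    have "test_form \<Omega> (2 * Suc l) (\<lambda>x. wedge_forms (Suc l) (\<lambda>j. if j < l then dd_form (u i j) x else dd_form \<phi> x))"
    proof (rule test_form_wedge_forms[OF _ _ _ K(2,3)])
      show "(if l < l then dd_form (u i l) x else dd_form \<phi> x) a b = 0" if "x \<notin> K" for x a b
        using hess_outside(2)[OF compact_imp_closed[OF K(2)] K(4) that] by (simp add: dd_form_def)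
      show "smooth_on UNIV (\<lambda>x. (if j < l then dd_form (u i j) x else dd_form \<phi> x) a b)" for j a b
        using dd_form_smooth[OF us] dd_form_smooth[OF \<phi>s] by (cases "j < l") auto
    qed (use dd_form_linear[OF us] dd_form_linear[OF \<phi>s] in auto)
    moreover have "\<eta> i = (\<lambda>x. wedge_forms (Suc l) (\<lambda>j. if j < l then dd_form (u i j) x else dd_form \<phi> x))"
      by (intro ext) (rule \<eta>)
    ultimately show ?thesis unfolding deg(1) by simp
  qed
  show "test_form \<Omega> (2 * CARD('n) - 2) \<omega>" unfolding \<omega> by (intro test_form_sum t)
  have "\<theta> (\<eta> i) = 0" for i
    unfolding \<eta>_def by (rule current_closed[OF deg(2) test_form_potential_form[OF \<phi> us]])
  then show "\<theta> \<omega> = 0" unfolding \<omega> current_sum[OF t] by simp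
qed

text \<open>The difference of the Levi powers with and without \<phi> is annihilated by \<theta> and
  may be added at no cost. The hypothesis \<open>pos\<close> says that adding it makes (f - g) times
  the standard power strongly positive, and evaluating \<theta> leaves only the integral of f -
  g.\<close>

lemma trace_measure_inequality:
  fixes \<phi> f g :: "complex ^ 'n \<Rightarrow> real"
  assumes op: "open \<Omega>" and n: "CARD('n) = Suc (Suc l)" and \<phi>: "test_function \<Omega> \<phi>"
    and f: "test_function \<Omega> f" and g: "test_function \<Omega> g"
    and pos: "\<And>x. strongly_positive (Suc l) (\<lambda>v. \<i> ^ Suc l * (wedge_forms (Suc l) (\<lambda>_. levi (\<lambda>y. A * (norm y)\<^sup>2 + \<phi> y) x) v -
      of_real (A ^ Suc l + g x - f x) * wedge_forms (Suc l) (\<lambda>_. std_form) v))"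
  shows "(\<integral>x. g x \<partial>trace_measure \<Omega> \<theta>) \<le> (\<integral>x. f x \<partial>trace_measure \<Omega> \<theta>)"
proof -
  let ?q = "\<lambda>y::complex ^ 'n. A * (norm y)\<^sup>2"
  let ?\<mu> = "trace_measure \<Omega> \<theta>"
  have q: "smooth_on UNIV ?q"
    using smooth_on_norm_diff_sq[of UNIV "0 :: complex ^ 'n"] by (intro smooth_on_mult smooth_on_const) auto
  define \<omega> where "\<omega> = (\<lambda>x v. wedge_forms (Suc l) (\<lambda>_. levi (\<lambda>y. ?q y + \<phi> y) x) v - wedge_forms (Suc l) (\<lambda>_. levi ?q x) v)"
  have \<omega>: "test_form \<Omega> (2 * CARD('n) - 2) \<omega>" "\<theta> \<omega> = 0"
    unfolding \<omega>_def using test_form_levi_power_diff[OF n \<phi> q] current_levi_power_diff[OF n \<phi> q] by auto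
  \<comment> \<open>The factorial undoes the normalisation of \<open>trace_form\<close>.\<close>
  define h where "h x = fact (Suc l) * (f x - g x)" for x
  have h: "test_function \<Omega> h" unfolding h_def by (intro test_function_scale test_function_diff f g)
  define \<Psi> where "\<Psi> = (\<lambda>x v. \<i> ^ Suc l * \<omega> x v + complex_of_real (h x) * trace_form v)"
  have t\<Psi>: "test_form \<Omega> (2 * CARD('n) - 2) \<Psi>"
    unfolding \<Psi>_def by (intro test_form_add test_form_cmult \<omega> test_form_trace_form h)
  have "\<Psi> x = (\<lambda>v. \<i> ^ Suc l * (wedge_forms (Suc l) (\<lambda>_. levi (\<lambda>y. ?q y + \<phi> y) x) v -
      of_real (A ^ Suc l + g x - f x) * wedge_forms (Suc l) (\<lambda>_. std_form) v))" for x
  proof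
    fix v :: "nat \<Rightarrow> complex ^ 'n"
    have 1: "complex_of_real (h x) * trace_form v = \<i> ^ Suc l * (of_real (f x - g x) * wedge_forms (Suc l) (\<lambda>_. std_form) v)"
      unfolding trace_form_eq[OF n] h_def by (simp del: fact_Suc)
    have 2: "wedge_forms (Suc l) (\<lambda>_. levi ?q x) v = of_real (A ^ Suc l) * wedge_forms (Suc l) (\<lambda>_. std_form) v"
      unfolding levi_scaled_norm_sq wedge_forms_scale by simp
    show "\<Psi> x v = \<i> ^ Suc l * (wedge_forms (Suc l) (\<lambda>_. levi (\<lambda>y. ?q y + \<phi> y) x) v -
      of_real (A ^ Suc l + g x - f x) * wedge_forms (Suc l) (\<lambda>_. std_form) v)"
      unfolding \<Psi>_def \<omega>_def 1 2 by (simp only: of_real_add of_real_diff) (simp only: algebra_simps)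
  qed
  then have "strongly_positive (CARD('n) - 1) (\<Psi> x)" for x using pos[of x] n by simp
  then have "\<theta> \<Psi> \<in> \<real>\<^sub>\<ge>\<^sub>0" by (rule current_positive[OF t\<Psi>])
  moreover have "\<theta> \<Psi> = trace_functional h"
    unfolding \<Psi>_def trace_functional_def
    by (subst current_add[OF test_form_cmult[OF \<omega>(1)] test_form_trace_form[OF h]]) (simp add: current_cmult[OF \<omega>(1)] \<omega>(2))
  moreover note tm = is_trace_measure_trace_measure[OF op]
  have int: "complex_of_real (\<integral>x. f x \<partial>?\<mu>) = trace_functional f" if "test_function \<Omega> f" for f
    using tm that unfolding is_trace_measure_def trace_functional_def trace_form_def by blast
  ultimately have "0 \<le> (\<integral>x. h x \<partial>?\<mu>)"
    using int[OF h] by (metis nonneg_Reals_of_real_iff)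
  also have "(\<integral>x. h x \<partial>?\<mu>) = fact (Suc l) * ((\<integral>x. f x \<partial>?\<mu>) - (\<integral>x. g x \<partial>?\<mu>))"
  proof -
    have "integrable ?\<mu> f" if "test_function \<Omega> f" for f
      using tm that op unfolding is_trace_measure_def by (intro test_function_integrable[of \<Omega>]) auto
    from this[OF f] this[OF g] show ?thesis unfolding h_def by simp
  qed
  finally show ?thesis
    using fact_gt_zero[of "Suc l", where 'a = real] by (simp add: zero_le_mult_iff del: fact_Suc)
qed

end

section \<open>The regularised distance\<close>

lemma test_function_deriv:
  assumes "test_function \<Omega> q"
  shows "test_function \<Omega> (\<lambda>x. frechet_derivative q (at x) a)"
proof -
  obtain K where K: "smooth_on UNIV q" "compact K" "K \<subseteq> \<Omega>" "\<And>x. x \<notin> K \<Longrightarrow> q x = 0"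
    using test_functionE[OF assms] by blast
  show ?thesis
    by (rule test_functionI[OF smooth_on_deriv[OF K(1)] K(2,3)])
      (rule hess_outside(1)[OF compact_imp_closed[OF K(2)] K(4)])
qed

lemma linear_eq_sum_Basis:
  fixes f :: "'a::euclidean_space \<Rightarrow> real"
  assumes "linear f"
  shows "f a = (\<Sum>i\<in>Basis. (a \<bullet> i) * f i)"
proof -
  have "f a = f (\<Sum>i\<in>Basis. (a \<bullet> i) *\<^sub>R i)" by (simp add: euclidean_representation)
  then show ?thesis by (simp add: linear_sum[OF assms] linear_scale[OF assms])
qed

lemma test_function_deriv_bound:
  fixes q :: "'a::euclidean_space \<Rightarrow> real"
  assumes q: "test_function \<Omega> q"
  obtains B where "B > 0" "\<And>x a. \<bar>frechet_derivative q (at x) a\<bar> \<le> B * norm a"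
proof -
  have "\<exists>B>0. \<forall>x. \<bar>frechet_derivative q (at x) i\<bar> \<le> B" for i
    using test_function_bound[OF test_function_deriv[OF q, of i]] by metis
  then obtain b where b: "\<And>i. b i > 0" "\<And>i x. \<bar>frechet_derivative q (at x) i\<bar> \<le> b i" by metis
  show thesis
  proof
    show "0 < (\<Sum>i\<in>(Basis :: 'a set). b i)" using b by (intro sum_pos) auto
    fix x a
    have "linear (frechet_derivative q (at x))"
      by (rule frechet_derivative_linear_arg[OF test_function_smooth[OF q]]) simp
    then have "frechet_derivative q (at x) a = (\<Sum>i\<in>Basis. (a \<bullet> i) * frechet_derivative q (at x) i)"
      by (rule linear_eq_sum_Basis)
    also have "\<bar>\<dots>\<bar> \<le> (\<Sum>i\<in>Basis. \<bar>(a \<bullet> i) * frechet_derivative q (at x) i\<bar>)" by (rule sum_abs)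
    also have "\<dots> \<le> (\<Sum>i\<in>Basis. norm a * b i)"
      unfolding abs_mult using b by (intro sum_mono mult_mono) (auto simp: Basis_le_norm)
    also have "\<dots> = (\<Sum>i\<in>Basis. b i) * norm a" by (simp add: sum_distrib_left mult.commute)
    finally show "\<bar>frechet_derivative q (at x) a\<bar> \<le> (\<Sum>i\<in>Basis. b i) * norm a" .
  qed
qed

lemma test_function_hess_bound:
  fixes q :: "'a::euclidean_space \<Rightarrow> real"
  assumes q: "test_function \<Omega> q"
  obtains B where "B > 0" "\<And>x a. \<bar>hess q x a a\<bar> \<le> B * (norm a)\<^sup>2"
proof -
  have "\<exists>B>0. \<forall>x a. \<bar>hess q x a i\<bar> \<le> B * norm a" for i
    unfolding hess_def using test_function_deriv_bound[OF test_function_deriv[OF q, of i]] by metis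
  then obtain b where b: "\<And>i. b i > 0" "\<And>i x a. \<bar>hess q x a i\<bar> \<le> b i * norm a" by metis
  show thesis
  proof
    show "0 < (\<Sum>i\<in>(Basis :: 'a set). b i)" using b by (intro sum_pos) auto
    fix x a
    have "hess q x a a = (\<Sum>i\<in>Basis. (a \<bullet> i) * hess q x a i)"
      by (rule linear_eq_sum_Basis[OF hess_linear_right[OF test_function_smooth[OF q]]])
    also have "\<bar>\<dots>\<bar> \<le> (\<Sum>i\<in>Basis. \<bar>(a \<bullet> i) * hess q x a i\<bar>)" by (rule sum_abs)
    also have "\<dots> \<le> (\<Sum>i\<in>Basis. norm a * (b i * norm a))"
      unfolding abs_mult using b by (intro sum_mono mult_mono) (auto simp: Basis_le_norm)
    also have "\<dots> = (\<Sum>i\<in>Basis. b i) * (norm a)\<^sup>2"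
      by (simp add: sum_distrib_left power2_eq_square mult.commute mult.left_commute)
    finally show "\<bar>hess q x a a\<bar> \<le> (\<Sum>i\<in>Basis. b i) * (norm a)\<^sup>2" .
  qed
qed

lemma test_function_lipschitz:
  fixes q :: "'a::euclidean_space \<Rightarrow> real"
  assumes q: "test_function \<Omega> q"
  obtains B where "B > 0" "\<And>x y. \<bar>q x - q y\<bar> \<le> B * dist x y"
proof -
  obtain B where B: "B > 0" "\<And>x a. \<bar>frechet_derivative q (at x) a\<bar> \<le> B * norm a"
    using test_function_deriv_bound[OF q] by blast
  have "norm (q x - q y) \<le> B * norm (x - y)" for x y
  proof (rule differentiable_bound[OF convex_UNIV])
    show "(q has_derivative frechet_derivative q (at z)) (at z within UNIV)" for z
      using smooth_on_has_derivative[OF test_function_smooth[OF q], of z] by simp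
    show "onorm (frechet_derivative q (at z)) \<le> B" for z
      using B by (intro onorm_le) auto
  qed auto
  then show thesis using that[OF B(1)] by (simp add: dist_norm)
qed

section \<open>First and second derivatives of the regularised distance\<close>

definition reg_dist :: "nat \<Rightarrow> (nat \<Rightarrow> 'a \<Rightarrow> real) \<Rightarrow> real \<Rightarrow> 'a \<Rightarrow> real" where
  "reg_dist m q t x = sqrt ((\<Sum>j<m. (q j x)\<^sup>2) + t\<^sup>2)"

lemma reg_dist_square: "(reg_dist m q t x)\<^sup>2 = (\<Sum>j<m. (q j x)\<^sup>2) + t\<^sup>2"
  unfolding reg_dist_def by (intro real_sqrt_pow2 add_nonneg_nonneg sum_nonneg) auto

lemma reg_dist_pos: "t > 0 \<Longrightarrow> reg_dist m q t x > 0"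
  unfolding reg_dist_def by (intro real_sqrt_gt_zero add_nonneg_pos sum_nonneg) auto

lemma smooth_reg_dist:
  assumes "\<And>j. j < m \<Longrightarrow> smooth_on UNIV (q j)" "t > 0"
  shows "smooth_on UNIV (reg_dist m q t)"
  unfolding reg_dist_def using assms
  by (intro smooth_on_sqrt smooth_on_add smooth_on_sum smooth_on_power smooth_on_const add_nonneg_pos sum_nonneg) auto

lemma reg_dist_has_derivative:
  assumes q: "\<And>j. j < m \<Longrightarrow> smooth_on UNIV (q j)" and t: "t > 0"
  shows "(reg_dist m q t has_derivative
    (\<lambda>h. (\<Sum>j<m. q j x * frechet_derivative (q j) (at x) h) / reg_dist m q t x)) (at x)"
proof -
  have pos: "(\<Sum>j<m. (q j x)\<^sup>2) + t\<^sup>2 > 0" using t by (intro add_nonneg_pos sum_nonneg) auto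
  have D: "(q j has_derivative frechet_derivative (q j) (at x)) (at x)" if "j < m" for j
    using smooth_on_has_derivative[OF q[OF that]] by simp
  have "((\<lambda>y. (\<Sum>j<m. (q j y)\<^sup>2) + t\<^sup>2) has_derivative
      (\<lambda>h. (\<Sum>j<m. 2 * (q j x * frechet_derivative (q j) (at x) h)) + 0)) (at x)"
    by (intro has_derivative_add has_derivative_sum has_derivative_const)
      (auto intro!: derivative_eq_intros D simp: mult.assoc)
  from has_derivative_compose[OF this] DERIV_real_sqrt[OF pos]
  have "((\<lambda>y. sqrt ((\<Sum>j<m. (q j y)\<^sup>2) + t\<^sup>2)) has_derivative
      (\<lambda>h. inverse (sqrt ((\<Sum>j<m. (q j x)\<^sup>2) + t\<^sup>2)) / 2 *
        ((\<Sum>j<m. 2 * (q j x * frechet_derivative (q j) (at x) h)) + 0))) (at x)"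
    unfolding has_field_derivative_def by blast
  moreover have "inverse (sqrt ((\<Sum>j<m. (q j x)\<^sup>2) + t\<^sup>2)) / 2 *
        ((\<Sum>j<m. 2 * (q j x * frechet_derivative (q j) (at x) h)) + 0) =
      (\<Sum>j<m. q j x * frechet_derivative (q j) (at x) h) / reg_dist m q t x" for h
  proof -
    have "inverse s / 2 * (2 * N + 0) = N / s" for s N :: real by (simp add: inverse_eq_divide)
    then show ?thesis unfolding sum_distrib_left[symmetric] reg_dist_def .
  qed
  ultimately show ?thesis unfolding reg_dist_def by simp
qed

lemma hess_reg_dist:
  assumes q: "\<And>j. j < m \<Longrightarrow> smooth_on UNIV (q j)" and t: "t > 0"
  shows "hess (\<lambda>y. reg_dist m q t y - t) x a a =
    ((\<Sum>j<m. (frechet_derivative (q j) (at x) a)\<^sup>2) + (\<Sum>j<m. q j x * hess (q j) x a a)) / reg_dist m q t x -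
    (\<Sum>j<m. q j x * frechet_derivative (q j) (at x) a)\<^sup>2 / reg_dist m q t x ^ 3"
proof -
  let ?S = "reg_dist m q t"
  let ?N = "\<lambda>y. \<Sum>j<m. q j y * frechet_derivative (q j) (at y) a"
  note S = reg_dist_pos[OF t, of m q]
  have "((\<lambda>y. ?S y - t) has_derivative (\<lambda>h. (\<Sum>j<m. q j y * frechet_derivative (q j) (at y) h) / ?S y)) (at y)" for y
    using has_derivative_diff[OF reg_dist_has_derivative[OF q t] has_derivative_const[of t]] by simp
  then have 1: "frechet_derivative (\<lambda>y. ?S y - t) (at y) = (\<lambda>h. (\<Sum>j<m. q j y * frechet_derivative (q j) (at y) h) / ?S y)" for y
    by (rule frechet_derivative_at[symmetric])
  have "(?N has_derivative (\<lambda>h. \<Sum>j<m. q j x * hess (q j) x h a +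
      frechet_derivative (q j) (at x) h * frechet_derivative (q j) (at x) a)) (at x)"
    using q by (intro has_derivative_sum has_derivative_mult smooth_on_has_derivative[of UNIV] hess_has_derivative) auto
  from has_derivative_divide'[OF this reg_dist_has_derivative[OF q t]]
  have "((\<lambda>y. ?N y / ?S y) has_derivative (\<lambda>h. ((\<Sum>j<m. q j x * hess (q j) x h a +
      frechet_derivative (q j) (at x) h * frechet_derivative (q j) (at x) a) * ?S x -
      ?N x * ((\<Sum>j<m. q j x * frechet_derivative (q j) (at x) h) / ?S x)) / (?S x * ?S x))) (at x)"
    using S[of x] by simp
  then have "hess (\<lambda>y. ?S y - t) x a a = ((\<Sum>j<m. q j x * hess (q j) x a a +
      frechet_derivative (q j) (at x) a * frechet_derivative (q j) (at x) a) * ?S x -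
      ?N x * (?N x / ?S x)) / (?S x * ?S x)"
    unfolding hess_def[of "\<lambda>y. ?S y - t"] 1 by (simp add: frechet_derivative_at[symmetric])
  also have "\<dots> = ((\<Sum>j<m. (frechet_derivative (q j) (at x) a)\<^sup>2) + (\<Sum>j<m. q j x * hess (q j) x a a)) / ?S x -
      (?N x)\<^sup>2 / ?S x ^ 3"
    unfolding sum.distrib using S[of x] by (simp add: field_simps power2_eq_square power3_eq_cube)
  finally show ?thesis .
qed

lemma hess_reg_dist_lower:
  assumes q: "\<And>j. j < m \<Longrightarrow> smooth_on UNIV (q j)" and t: "t > 0"
    and C: "\<And>j. j < m \<Longrightarrow> \<bar>hess (q j) x a a\<bar> \<le> C * (norm a)\<^sup>2" "0 \<le> C"
  shows "t\<^sup>2 / reg_dist m q t x ^ 3 * (\<Sum>j<m. (frechet_derivative (q j) (at x) a)\<^sup>2) - m * C * (norm a)\<^sup>2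
    \<le> hess (\<lambda>y. reg_dist m q t y - t) x a a"
proof -
  define S where "S = reg_dist m q t x"
  define P where "P = (\<Sum>j<m. (frechet_derivative (q j) (at x) a)\<^sup>2)"
  define Q where "Q = (\<Sum>j<m. (q j x)\<^sup>2)"
  define R where "R = (\<Sum>j<m. q j x * hess (q j) x a a)"
  define N where "N = (\<Sum>j<m. q j x * frechet_derivative (q j) (at x) a)"
  have S: "S > 0" "S\<^sup>2 = Q + t\<^sup>2" using reg_dist_pos[OF t] reg_dist_square by (auto simp: S_def Q_def)
  have N2: "N\<^sup>2 \<le> Q * P" unfolding N_def Q_def P_def by (rule Cauchy_Schwarz_ineq_sum)
  \<comment> \<open>This makes the term with the Hessians of the q_j, divided by S, bounded
    independently of t.\<close>
  have "\<bar>q j x\<bar> \<le> S" if "j < m" for j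
  proof (rule power2_le_imp_le)
    have "(q j x)\<^sup>2 \<le> Q" unfolding Q_def using that by (intro member_le_sum) auto
    then show "\<bar>q j x\<bar>\<^sup>2 \<le> S\<^sup>2" using S(2) by (simp add: add_increasing2)
  qed (use S in simp)
  then have "\<bar>R\<bar> \<le> (\<Sum>j<m. S * (C * (norm a)\<^sup>2))"
    unfolding R_def using C S(1) by (intro order_trans[OF sum_abs] sum_mono) (auto simp: abs_mult intro!: mult_mono)
  then have "- (m * C * (norm a)\<^sup>2) * S \<le> R" by (simp add: abs_le_iff algebra_simps)
  then have R: "- (m * C * (norm a)\<^sup>2) \<le> R / S" using S(1) by (simp add: pos_le_divide_eq)
  \<comment> \<open>Because S^2 = Q + t^2, exactly the fraction t^2/S^2 of P/S survives the
    subtraction of the Cauchy-Schwarz bound.\<close>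
  have "t\<^sup>2 / S ^ 3 * P = P / S - Q * P / S ^ 3"
  proof -
    have "P / S = S\<^sup>2 * P / S ^ 3" using S(1) by (simp add: power2_eq_square power3_eq_cube)
    then show ?thesis unfolding S(2) by (simp add: algebra_simps add_divide_distrib)
  qed
  also have "\<dots> \<le> P / S - N\<^sup>2 / S ^ 3" using N2 S(1) by (intro diff_left_mono divide_right_mono) auto
  finally have "t\<^sup>2 / S ^ 3 * P - m * C * (norm a)\<^sup>2 \<le> (P + R) / S - N\<^sup>2 / S ^ 3"
    using R by (simp add: add_divide_distrib)
  moreover have "hess (\<lambda>y. reg_dist m q t y - t) x a a = (P + R) / S - N\<^sup>2 / S ^ 3"
    unfolding S_def P_def R_def N_def by (rule hess_reg_dist[OF q t])
  ultimately show ?thesis by (simp only: S_def P_def)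
qed

text \<open>\<open>del u x\<close> is \<open>\<partial>u\<close>, the complex linear part of \<open>du\<close>, at \<open>x\<close>.\<close>

definition del :: "(complex ^ 'n \<Rightarrow> real) \<Rightarrow> complex ^ 'n \<Rightarrow> complex ^ 'n::finite \<Rightarrow> complex" where
  "del u x a = (of_real (frechet_derivative u (at x) a) - \<i> * of_real (frechet_derivative u (at x) (\<i> *s a))) / 2"

lemma cmod_del: "(cmod (del u x a))\<^sup>2 = ((frechet_derivative u (at x) a)\<^sup>2 + (frechet_derivative u (at x) (\<i> *s a))\<^sup>2) / 4"
  by (simp add: del_def cmod_power2 power_divide field_simps)

lemma norm_i_scale: "norm (\<i> *s (a :: complex ^ 'n::finite)) = norm a"
  by (simp add: norm_vec_def norm_mult)

lemma complex_linear_del: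
  fixes u :: "complex ^ 'n::finite \<Rightarrow> real"
  assumes "u differentiable at x"
  shows "complex_linear (del u x)"
  unfolding complex_linear_iff
proof (intro conjI allI)
  have lin: "linear (frechet_derivative u (at x))" by (rule linear_frechet_derivative[OF assms])
  note L = linear_add[OF lin] linear_scale[OF lin] linear_neg[OF lin]
  show add: "del u x (a + b) = del u x a + del u x b" for a b
    by (simp add: del_def L vector_add_ldistrib field_simps)
  have I: "del u x (\<i> *s a) = \<i> * del u x a" for a
    by (simp add: del_def L i_scale_i_scale field_simps)
  have R: "del u x (r *\<^sub>R a) = of_real r * del u x a" for r a
    by (simp add: del_def L linear_scale[OF i_scale_linear] field_simps)
  show "del u x (c *s a) = c * del u x a" for c a
  proof -
    have "c *s a = Re c *\<^sub>R a + \<i> *s (Im c *\<^sub>R a)"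
      by (simp add: vec_eq_iff complex_eq_iff algebra_simps)
    then have "del u x (c *s a) = of_real (Re c) * del u x a + \<i> * (of_real (Im c) * del u x a)"
      by (simp only: add I R)
    then show ?thesis by (simp add: complex_eq_iff algebra_simps)
  qed
qed

text \<open>The real estimate is added for the directions a and ia, and |\<partial>q(a)|^2 is a
  quarter of dq(a)^2 + dq(ia)^2. The two equal error terms, divided by 4, leave the factor
  1/2.\<close>

lemma levi_reg_dist_lower:
  fixes q :: "nat \<Rightarrow> complex ^ 'n::finite \<Rightarrow> real"
  assumes q: "\<And>j. j < m \<Longrightarrow> smooth_on UNIV (q j)" and t: "t > 0"
    and C: "\<And>j a. j < m \<Longrightarrow> \<bar>hess (q j) x a a\<bar> \<le> C * (norm a)\<^sup>2" "0 \<le> C"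
  shows "t\<^sup>2 / reg_dist m q t x ^ 3 * (\<Sum>j<m. (cmod (del (q j) x a))\<^sup>2) - m * C / 2 * (norm a)\<^sup>2
    \<le> Re (levi (\<lambda>y. reg_dist m q t y - t) x a a)"
proof -
  let ?r = "t\<^sup>2 / reg_dist m q t x ^ 3"
  let ?D = "\<lambda>j a. (frechet_derivative (q j) (at x) a)\<^sup>2"
  have \<phi>: "smooth_on UNIV (\<lambda>y. reg_dist m q t y - t)"
    by (intro smooth_on_diff smooth_reg_dist q t smooth_on_const) auto
  have "?r * (\<Sum>j<m. (cmod (del (q j) x a))\<^sup>2) = (?r * (\<Sum>j<m. ?D j a) + ?r * (\<Sum>j<m. ?D j (\<i> *s a))) / 4"
    unfolding cmod_del by (simp add: sum_divide_distrib[symmetric] sum.distrib algebra_simps add_divide_distrib)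
  then have "?r * (\<Sum>j<m. (cmod (del (q j) x a))\<^sup>2) - m * C / 2 * (norm a)\<^sup>2 =
      ((?r * (\<Sum>j<m. ?D j a) - m * C * (norm a)\<^sup>2) + (?r * (\<Sum>j<m. ?D j (\<i> *s a)) - m * C * (norm (\<i> *s a))\<^sup>2)) / 4"
    by (simp add: norm_i_scale field_simps)
  also have "\<dots> \<le> (hess (\<lambda>y. reg_dist m q t y - t) x a a + hess (\<lambda>y. reg_dist m q t y - t) x (\<i> *s a) (\<i> *s a)) / 4"
    by (intro divide_right_mono add_mono hess_reg_dist_lower q t C) auto
  also have "\<dots> = Re (levi (\<lambda>y. reg_dist m q t y - t) x a a)"
    by (simp add: levi_diag[OF \<phi>])
  finally show ?thesis .
qed

section \<open>Frames along a generating submanifold\<close>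

text \<open>Differentiate \<rho> \<circ> \<gamma>, which vanishes identically near 0.\<close>

lemma tangent_space_in_kernel:
  fixes \<rho> :: "'a::real_normed_vector \<Rightarrow> real"
  assumes v: "v \<in> tangent_space M p" and U: "open U" "p \<in> U"
    and \<rho>: "smooth_on U \<rho>" "\<And>x. x \<in> M \<inter> U \<Longrightarrow> \<rho> x = 0"
  shows "frechet_derivative \<rho> (at p) v = 0"
proof -
  obtain \<gamma> e where \<gamma>: "e > 0" "smooth_on {-e<..<e} \<gamma>" "\<gamma> ` {-e<..<e} \<subseteq> M" "\<gamma> 0 = p"
    "(\<gamma> has_vector_derivative v) (at (0::real))"
    using v unfolding tangent_space_def by blast
  have "isCont \<gamma> 0" using \<gamma>(5) by (rule has_vector_derivative_continuous)
  then obtain W where W: "open W" "0 \<in> W" "\<And>s. s \<in> W \<Longrightarrow> \<gamma> s \<in> U"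
    using continuous_at_open[of 0 \<gamma>] U \<gamma>(4) by auto
  have D: "(\<rho> has_derivative frechet_derivative \<rho> (at p)) (at (\<gamma> 0))"
    using smooth_on_has_derivative[OF \<rho>(1) U(2)] \<gamma>(4) by simp
  have "(\<gamma> has_derivative (\<lambda>h. h *\<^sub>R v)) (at 0)"
    using \<gamma>(5) by (simp add: has_vector_derivative_def)
  from has_derivative_compose[OF this D]
  have 1: "((\<lambda>s. \<rho> (\<gamma> s)) has_derivative (\<lambda>h. frechet_derivative \<rho> (at p) (h *\<^sub>R v))) (at 0)" .
  have "((\<lambda>s. 0 :: real) has_derivative (\<lambda>h. 0)) (at (0::real))" by simp
  then have 2: "((\<lambda>s. \<rho> (\<gamma> s)) has_derivative (\<lambda>h. 0)) (at 0)"
  proof (rule has_derivative_transform_within_open[of _ _ _ _ "W \<inter> {-e<..<e}"])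
    show "0 = \<rho> (\<gamma> s)" if "s \<in> W \<inter> {-e<..<e}" for s
      using that W(3)[of s] \<gamma>(3) \<rho>(2)[of "\<gamma> s"] by (metis IntD1 IntD2 IntI image_subset_iff)
  qed (use W \<gamma>(1) in auto)
  show ?thesis using has_derivative_unique[OF 1 2] by (metis scaleR_one)
qed

text \<open>The real part of the relation says that the sum of Re c_j d\<rho>_j(a) + Im c_j
  d\<rho>_j(ia) vanishes. For tangent a the first half is 0. So the combination of the d\<rho>_j
  with coefficients Im c_j annihilates the tangent space and its image under J, hence every vector,
  as M is generating. Real independence gives Im c_j = 0 and then Re c_j = 0.\<close>

lemma del_independent:
  fixes M :: "(complex ^ 'n::finite) set"
  assumes gen: "generating M" and p: "p \<in> M" and U: "open U" "p \<in> U"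
    and \<rho>: "\<And>j. j < m \<Longrightarrow> smooth_on U (\<rho> j)" "M \<inter> U = {x \<in> U. \<forall>j<m. \<rho> j x = 0}"
    and indep: "\<And>c :: nat \<Rightarrow> real. (\<And>v. (\<Sum>j<m. c j * frechet_derivative (\<rho> j) (at p) v) = 0) \<Longrightarrow> (\<forall>j<m. c j = 0)"
    and c: "\<And>a. (\<Sum>j<m. c j * del (\<rho> j) p a) = 0"
  shows "\<forall>j<m. c j = (0 :: complex)"
proof -
  let ?D = "\<lambda>j. frechet_derivative (\<rho> j) (at p)"
  have ker: "?D j v = 0" if "v \<in> tangent_space M p" "j < m" for v j
    by (rule tangent_space_in_kernel[OF that(1) U \<rho>(1)[OF that(2)]]) (use \<rho>(2) that in blast)
  have lin: "linear (?D j)" if "j < m" for j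
    by (rule frechet_derivative_linear_arg[OF \<rho>(1)[OF that] U(2)])
  have re: "(\<Sum>j<m. Re (c j) * ?D j a) + (\<Sum>j<m. Im (c j) * ?D j (\<i> *s a)) = 0" for a
  proof -
    have "Re (\<Sum>j<m. c j * del (\<rho> j) p a) = (\<Sum>j<m. (Re (c j) * ?D j a + Im (c j) * ?D j (\<i> *s a)) / 2)"
      by (simp add: del_def)
    then have "(\<Sum>j<m. (Re (c j) * ?D j a + Im (c j) * ?D j (\<i> *s a)) / 2) = 0" using c[of a] by simp
    then show ?thesis unfolding sum_divide_distrib[symmetric] sum.distrib by simp
  qed
  have "\<forall>j<m. Im (c j) = 0"
  proof (rule indep)
    fix v :: "complex ^ 'n"
    obtain u w where uw: "v = u + \<i> *s w" "u \<in> tangent_space M p" "w \<in> tangent_space M p"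
      using gen p unfolding generating_def by blast
    have "(\<Sum>j<m. Im (c j) * ?D j v) = (\<Sum>j<m. Im (c j) * ?D j u) + (\<Sum>j<m. Im (c j) * ?D j (\<i> *s w))"
      unfolding uw(1) sum.distrib[symmetric]
      by (intro sum.cong refl) (simp add: linear_add[OF lin] distrib_left)
    also have "(\<Sum>j<m. Im (c j) * ?D j u) = 0" by (intro sum.neutral) (simp add: ker uw)
    also have "(\<Sum>j<m. Im (c j) * ?D j (\<i> *s w)) = - (\<Sum>j<m. Re (c j) * ?D j w)" using re[of w] by simp
    also have "(\<Sum>j<m. Re (c j) * ?D j w) = 0" by (intro sum.neutral) (simp add: ker uw)
    finally show "(\<Sum>j<m. Im (c j) * ?D j v) = 0" by simp
  qed
  moreover from this have "\<forall>j<m. Re (c j) = 0" using re by (intro indep) simp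
  ultimately show ?thesis by (simp add: complex_eq_iff)
qed

section \<open>Complex frames and their stability\<close>

definition cdot :: "complex ^ 'n::finite \<Rightarrow> complex ^ 'n \<Rightarrow> complex" where
  "cdot w a = (\<Sum>k\<in>UNIV. w $ k * a $ k)"

lemma complex_linear_cdot: "complex_linear (cdot w)"
  unfolding complex_linear_iff cdot_def by (simp add: algebra_simps sum.distrib sum_distrib_left)

lemma complex_linear_eq_cdot:
  assumes "complex_linear \<alpha>"
  shows "\<alpha> a = cdot (\<chi> k. \<alpha> (axis k 1)) a"
proof -
  have "\<alpha> a = \<alpha> (\<Sum>i\<in>UNIV. a $ i *s axis i 1)" using vec_expansion[of a] by simp
  then show ?thesis
    by (simp add: complex_linear_sum[OF assms] complex_linear_scale[OF assms] cdot_def mult.commute)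
qed

lemma continuous_complex_linear: "complex_linear \<alpha> \<Longrightarrow> continuous_on S \<alpha>"
  using complex_linear_imp_linear linear_conv_bounded_linear linear_continuous_on by blast

text \<open>Represent the covectors by coefficient vectors through the bilinear pairing
  \<open>cdot\<close> and extend these to a basis of C^n. The resulting sum of squares is positive
  off the origin, so its minimum on the compact unit sphere is a constant c > 0; homogeneity does
  the rest.\<close>

lemma extend_to_frame:
  fixes \<alpha> :: "nat \<Rightarrow> complex ^ 'n::finite \<Rightarrow> complex"
  assumes lin: "\<And>s. s < m \<Longrightarrow> complex_linear (\<alpha> s)"
    and indep: "\<And>c. (\<And>a. (\<Sum>s<m. c s * \<alpha> s a) = 0) \<Longrightarrow> \<forall>s<m. c s = 0"
  obtains e c where "m \<le> CARD('n)" "\<And>s. complex_linear (e s)" "c > 0"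
    "\<And>a. c * (norm a)\<^sup>2 \<le> (\<Sum>s<m. (cmod (\<alpha> s a))\<^sup>2) + (\<Sum>s=m..<CARD('n). (cmod (e s a))\<^sup>2)"
proof -
  define w where "w s = (\<chi> k. \<alpha> s (axis k 1))" for s
  have \<alpha>: "\<alpha> s a = cdot (w s) a" if "s < m" for s a
    unfolding w_def by (rule complex_linear_eq_cdot[OF lin[OF that]])
  let ?W = "w ` {..<m}"
  have zero: "\<forall>s<m. c s = 0" if "(\<Sum>s<m. c s *s w s) = 0" for c
  proof (rule indep)
    fix a
    have "(\<Sum>s<m. c s * \<alpha> s a) = (\<Sum>s<m. \<Sum>k\<in>UNIV. c s * (w s $ k * a $ k))"
      by (intro sum.cong refl) (simp add: \<alpha> cdot_def sum_distrib_left)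
    also have "\<dots> = (\<Sum>k\<in>UNIV. (\<Sum>s<m. c s *s w s) $ k * a $ k)"
      by (subst sum.swap) (simp add: sum_distrib_right mult.assoc)
    finally show "(\<Sum>s<m. c s * \<alpha> s a) = 0" using that by simp
  qed
  have inj: "inj_on w {..<m}"
  proof (rule inj_onI, rule ccontr)
    fix i j assume ij: "i \<in> {..<m}" "j \<in> {..<m}" "w i = w j" "i \<noteq> j"
    have "(\<Sum>s<m. (if s = i then 1 else if s = j then - 1 else 0) *s w s) =
        (\<Sum>s<m. (if s = i then w i else 0) - (if s = j then w j else 0))"
      using ij by (intro sum.cong) auto
    also have "\<dots> = 0" using ij by (simp add: sum_subtractf)
    finally show False using zero[of "\<lambda>s. if s = i then 1 else if s = j then - 1 else 0"] ij by auto
  qed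
  have ind: "vec.independent ?W"
  proof
    assume "vec.dependent ?W"
    then obtain u where u: "\<exists>v\<in>?W. u v \<noteq> 0" "(\<Sum>v\<in>?W. u v *s v) = 0"
      by (subst (asm) vec.dependent_finite) auto
    have "(\<Sum>s<m. u (w s) *s w s) = 0" using u(2) by (simp add: sum.reindex[OF inj])
    from zero[OF this] u(1) show False by auto
  qed
  define B where "B = vec.extend_basis ?W"
  have B: "?W \<subseteq> B" "vec.independent B" "vec.span B = UNIV"
    unfolding B_def using ind by (simp_all add: vec.extend_basis_superset vec.independent_extend_basis)
  have finB: "finite B" using B(2) by (rule vec.finiteI_independent)
  have cardB: "card B = CARD('n)"
    using vec.basis_card_eq_dim[of B UNIV] B(2,3) by (simp add: card_cart_basis vec.dim_UNIV vec.dimension_def)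
  have cardW: "card ?W = m" using card_image[OF inj] by simp
  have m: "m \<le> CARD('n)" using card_mono[OF finB B(1)] cardB cardW by simp
  have "card (B - ?W) = card {m..<CARD('n)}"
    using card_Diff_subset[of ?W B] B(1) cardB cardW by simp
  then obtain g where g: "bij_betw g {m..<CARD('n)} (B - ?W)"
    using finB by (metis finite_same_card_bij finite_Diff finite_atLeastLessThan)
  define e where "e s = cdot (g s)" for s
  define F where "F a = (\<Sum>s<m. (cmod (\<alpha> s a))\<^sup>2) + (\<Sum>s=m..<CARD('n). (cmod (e s a))\<^sup>2)" for a
  have nz: "F a > 0" if a: "a \<noteq> 0" for a
  proof (rule ccontr)
    assume "\<not> F a > 0"
    moreover have nn: "0 \<le> (\<Sum>s<m. (cmod (\<alpha> s a))\<^sup>2)" "0 \<le> (\<Sum>s=m..<CARD('n). (cmod (e s a))\<^sup>2)"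
      by (simp_all add: sum_nonneg)
    ultimately have z: "(\<Sum>s<m. (cmod (\<alpha> s a))\<^sup>2) = 0" "(\<Sum>s=m..<CARD('n). (cmod (e s a))\<^sup>2) = 0"
      unfolding F_def by linarith+
    have W0: "cdot (w s) a = 0" if "s < m" for s
      using z(1) that \<alpha> by (subst (asm) sum_nonneg_eq_0_iff) auto
    have G0: "cdot (g s) a = 0" if "s \<in> {m..<CARD('n)}" for s
      using z(2) that unfolding e_def by (subst (asm) sum_nonneg_eq_0_iff) auto
    have "cdot b a = 0" if "b \<in> B" for b
    proof (cases "b \<in> ?W")
      case False
      then have "b \<in> g ` {m..<CARD('n)}" using g that by (simp add: bij_betw_def)
      then show ?thesis using G0 by blast
    qed (use W0 in auto)
    then have "vec.span B \<subseteq> {b. cdot b a = 0}"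
      by (intro vec.span_minimal)
        (auto simp: vec.subspace_def cdot_def algebra_simps sum.distrib sum_distrib_left[symmetric])
    then have "cdot (axis k 1) a = 0" for k using B(3) by auto
    then have "a $ k = 0" for k by (simp add: cdot_def axis_def if_distrib if_distribR cong: if_cong)
    then show False using a by (simp add: vec_eq_iff)
  qed
  have cont: "continuous_on (sphere 0 1) F"
    unfolding F_def e_def
    by (intro continuous_intros continuous_complex_linear lin complex_linear_cdot) auto
  obtain u where u: "u \<in> sphere 0 1" "\<And>a. a \<in> sphere 0 1 \<Longrightarrow> F u \<le> F a"
    using continuous_attains_inf[OF compact_sphere _ cont] by auto
  have "u \<noteq> 0" using u(1) by auto
  then have c: "F u > 0" by (rule nz)
  have "F u * (norm a)\<^sup>2 \<le> F a" for a
  proof (cases "a = 0")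
    case False
    define b where "b = (1 / norm a) *\<^sub>R a"
    have "b \<in> sphere 0 1" using False by (simp add: b_def)
    have ab: "a = norm a *\<^sub>R b" using False by (simp add: b_def)
    have "F a = (norm a)\<^sup>2 * F b"
    proof -
      have "(cmod (\<alpha> s a))\<^sup>2 = (norm a)\<^sup>2 * (cmod (\<alpha> s b))\<^sup>2" if "s < m" for s
        by (subst ab) (simp add: complex_linear_scaleR[OF lin[OF that]] norm_mult power_mult_distrib)
      moreover have "(cmod (e s a))\<^sup>2 = (norm a)\<^sup>2 * (cmod (e s b))\<^sup>2" for s
        unfolding e_def by (subst ab) (simp add: complex_linear_scaleR[OF complex_linear_cdot] norm_mult power_mult_distrib)
      ultimately show ?thesis unfolding F_def distrib_left sum_distrib_left by simp
    qed
    then show ?thesis using mult_right_mono[OF u(2)[OF \<open>b \<in> sphere 0 1\<close>], of "(norm a)\<^sup>2"] by (simp add: mult.commute)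
  next
    case True
    have "0 \<le> F 0" unfolding F_def by (simp add: sum_nonneg)
    then show ?thesis using True by simp
  qed
  then show thesis
    using that[of e "F u"] m c unfolding F_def e_def by (simp add: complex_linear_cdot)
qed

lemma complex_linear_bound:
  fixes \<alpha> :: "complex ^ 'n::finite \<Rightarrow> complex" and \<delta> :: real
  assumes "complex_linear \<alpha>" "\<And>k. cmod (\<alpha> (axis k 1)) \<le> \<delta>"
  shows "cmod (\<alpha> a) \<le> CARD('n) * \<delta> * norm a"
proof -
  have "\<alpha> a = (\<Sum>k\<in>UNIV. \<alpha> (axis k 1) * a $ k)"
    using complex_linear_eq_cdot[OF assms(1), of a] by (simp add: cdot_def)
  also have "cmod \<dots> \<le> (\<Sum>k\<in>(UNIV :: 'n set). \<delta> * norm a)"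
  proof (intro order_trans[OF norm_sum] sum_mono)
    fix k :: 'n
    have "cmod (a $ k) \<le> norm a" by (rule Finite_Cartesian_Product.norm_nth_le)
    then show "cmod (\<alpha> (axis k 1) * a $ k) \<le> \<delta> * norm a"
      unfolding norm_mult using assms(2)[of k] by (intro mult_mono) (auto intro: order_trans[OF norm_ge_zero])
  qed
  finally show ?thesis by simp
qed

text \<open>Uniformity in \<open>a\<close> comes from linearity: it is enough to control the n basis
  vectors, each up to \<delta>/n.\<close>

lemma del_continuous:
  fixes \<rho> :: "complex ^ 'n::finite \<Rightarrow> real"
  assumes U: "open U" "p \<in> U" and \<rho>: "smooth_on U \<rho>" and \<delta>: "\<delta> > 0"
  shows "\<forall>\<^sub>F z in nhds p. \<forall>a. cmod (del \<rho> z a - del \<rho> p a) \<le> \<delta> * norm a"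
proof -
  have "\<forall>\<^sub>F z in nhds p. cmod (del \<rho> z (axis k 1) - del \<rho> p (axis k 1)) < \<delta> / CARD('n)" for k
  proof -
    have "isCont (\<lambda>z. del \<rho> z (axis k 1)) p"
      unfolding del_def using \<rho> U
      by (intro continuous_intros smooth_on_isCont[OF smooth_on_deriv]) auto
    then have "((\<lambda>z. del \<rho> z (axis k 1)) \<longlongrightarrow> del \<rho> p (axis k 1)) (nhds p)"
      using tendsto_at_iff_tendsto_nhds[of "\<lambda>z. del \<rho> z (axis k 1)" p] by (simp only: isCont_def)
    from tendstoD[OF this, of "\<delta> / CARD('n)"] \<delta> show ?thesis by (simp add: dist_norm)
  qed
  then have "\<forall>\<^sub>F z in nhds p. \<forall>k\<in>UNIV. cmod (del \<rho> z (axis k 1) - del \<rho> p (axis k 1)) < \<delta> / CARD('n)"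
    by (intro eventually_ball_finite) auto
  moreover have "\<forall>\<^sub>F z in nhds p. z \<in> U" using U by (rule eventually_nhds_in_open)
  ultimately show ?thesis
  proof eventually_elim
    case (elim z)
    have "complex_linear (\<lambda>a. del \<rho> z a - del \<rho> p a)"
      using elim(2) U(2) by (intro complex_linear_diff complex_linear_del smooth_on_differentiable[OF \<rho>])
    from complex_linear_bound[OF this, of "\<delta> / CARD('n)"] elim(1)
    show ?case by (auto simp: less_imp_le)
  qed
qed

text \<open>The completing covectors stay constant while the first m vary continuously with z, so
  the lower bound at p persists nearby with a smaller constant. The upper bound \<Gamma> fixes how
  large a multiple of |z|^2 dominates the whole frame.\<close>

lemma local_frame:
  fixes M :: "(complex ^ 'n::finite) set"
  assumes gen: "generating M" and p: "p \<in> M" and U: "open U" "p \<in> U"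
    and \<rho>: "\<And>j. j < m \<Longrightarrow> smooth_on U (\<rho> j)" "M \<inter> U = {x \<in> U. \<forall>j<m. \<rho> j x = 0}"
    and indep: "\<And>c :: nat \<Rightarrow> real. (\<And>v. (\<Sum>j<m. c j * frechet_derivative (\<rho> j) (at p) v) = 0) \<Longrightarrow> (\<forall>j<m. c j = 0)"
  obtains e c \<Gamma> \<epsilon> where "m \<le> CARD('n)" "\<And>s. complex_linear (e s)" "c > 0" "\<Gamma> > 0" "\<epsilon> > 0"
    "\<And>z a. z \<in> ball p \<epsilon> \<Longrightarrow>
      c * (norm a)\<^sup>2 \<le> (\<Sum>s<m. (cmod (del (\<rho> s) z a))\<^sup>2) + (\<Sum>s=m..<CARD('n). (cmod (e s a))\<^sup>2)"
    "\<And>z a. z \<in> ball p \<epsilon> \<Longrightarrow>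
      (\<Sum>s<m. (cmod (del (\<rho> s) z a))\<^sup>2) + (\<Sum>s=m..<CARD('n). (cmod (e s a))\<^sup>2) \<le> \<Gamma> * (norm a)\<^sup>2"
proof -
  have lin: "complex_linear (del (\<rho> s) p)" if "s < m" for s
    by (rule complex_linear_del[OF smooth_on_differentiable[OF \<rho>(1)[OF that] U(2)]])
  have ind: "\<forall>s<m. c s = 0" if "\<And>a. (\<Sum>s<m. c s * del (\<rho> s) p a) = 0" for c
    by (rule del_independent[OF gen p U, where \<rho> = \<rho>]) (fact \<rho> indep that)+
  obtain e c where e: "m \<le> CARD('n)" "\<And>s. complex_linear (e s)" "c > 0"
    "\<And>a. c * (norm a)\<^sup>2 \<le> (\<Sum>s<m. (cmod (del (\<rho> s) p a))\<^sup>2) + (\<Sum>s=m..<CARD('n). (cmod (e s a))\<^sup>2)"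
    by (rule extend_to_frame[of m "\<lambda>s. del (\<rho> s) p"]) (use lin ind in blast)+
  \<comment> \<open>Passing from the point p to z halves the squares and costs m \<delta>^2, at most
    c/4; of c/2 there remains c/4. The summand 1 keeps the denominator positive for m = 0.\<close>
  define \<delta> where "\<delta> = sqrt (c / (4 * (real m + 1)))"
  have \<delta>: "\<delta> > 0" "\<delta>\<^sup>2 = c / (4 * (real m + 1))" using e(3) by (auto simp: \<delta>_def)
  have "m * \<delta>\<^sup>2 \<le> c / 4" unfolding \<delta>(2) using e(3) by (simp add: field_simps)
  have "\<forall>\<^sub>F z in nhds p. \<forall>s\<in>{..<m}. \<forall>a. cmod (del (\<rho> s) z a - del (\<rho> s) p a) \<le> \<delta> * norm a"
    using del_continuous[OF U \<rho>(1) \<delta>(1)] by (intro eventually_ball_finite) auto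
  then obtain \<epsilon> where \<epsilon>: "\<epsilon> > 0"
    "\<And>z s a. z \<in> ball p \<epsilon> \<Longrightarrow> s < m \<Longrightarrow> cmod (del (\<rho> s) z a - del (\<rho> s) p a) \<le> \<delta> * norm a"
    unfolding eventually_nhds_metric by (auto simp: dist_commute)
  have mem: "f k \<le> (\<Sum>k\<in>UNIV. f k)" if "\<And>k. 0 \<le> f k" for f :: "'n \<Rightarrow> real" and k
    by (rule member_le_sum) (use that in auto)
  define b where "b s = (\<Sum>k\<in>UNIV. cmod (del (\<rho> s) p (axis k 1))) * CARD('n)" for s
  define b' where "b' s = (\<Sum>k\<in>UNIV. cmod (e s (axis k 1))) * CARD('n)" for s
  define \<Gamma> where "\<Gamma> = (\<Sum>s<m. (b s + \<delta>)\<^sup>2) + (\<Sum>s=m..<CARD('n). (b' s)\<^sup>2) + 1"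
  have b: "cmod (del (\<rho> s) p a) \<le> b s * norm a" if "s < m" for s a
    unfolding b_def mult.commute[of _ "real CARD('n)"]
    by (rule complex_linear_bound[OF lin[OF that]], rule mem) simp
  have b': "cmod (e s a) \<le> b' s * norm a" for s a
    unfolding b'_def mult.commute[of _ "real CARD('n)"]
    by (rule complex_linear_bound[OF e(2)], rule mem) simp
  show thesis
  proof (rule that[of e "c / 4" \<Gamma> \<epsilon>, OF e(1,2)])
    show "c / 4 > 0" "\<epsilon> > 0" using e(3) \<epsilon>(1) by auto
    show "\<Gamma> > 0" unfolding \<Gamma>_def by (intro add_nonneg_pos add_nonneg_nonneg sum_nonneg) auto
    fix z a assume z: "z \<in> ball p \<epsilon>"
    have half: "(cmod y)\<^sup>2 / 2 - (cmod (x - y))\<^sup>2 \<le> (cmod x)\<^sup>2" for x y :: complex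
    proof -
      have "cmod y \<le> cmod x + cmod (x - y)"
        using norm_triangle_ineq4[of x "x - y"] by simp
      then have "(cmod y)\<^sup>2 \<le> (cmod x + cmod (x - y))\<^sup>2" by (intro power_mono) auto
      also have "\<dots> \<le> 2 * (cmod x)\<^sup>2 + 2 * (cmod (x - y))\<^sup>2"
        using sum_squares_bound[of "cmod x" "cmod (x - y)"] by (simp add: power2_sum)
      finally show ?thesis by simp
    qed
    have "(\<Sum>s<m. (cmod (del (\<rho> s) p a))\<^sup>2 / 2 - (\<delta> * norm a)\<^sup>2) \<le> (\<Sum>s<m. (cmod (del (\<rho> s) z a))\<^sup>2)"
    proof (rule sum_mono)
      fix s assume "s \<in> {..<m}"
      then have "(cmod (del (\<rho> s) z a - del (\<rho> s) p a))\<^sup>2 \<le> (\<delta> * norm a)\<^sup>2"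
        using \<epsilon>(2)[OF z] by (intro power_mono) auto
      then show "(cmod (del (\<rho> s) p a))\<^sup>2 / 2 - (\<delta> * norm a)\<^sup>2 \<le> (cmod (del (\<rho> s) z a))\<^sup>2"
        using half[of "del (\<rho> s) p a" "del (\<rho> s) z a"] by linarith
    qed
    moreover have "m * (\<delta> * norm a)\<^sup>2 \<le> c / 4 * (norm a)\<^sup>2"
      using mult_right_mono[OF \<open>m * \<delta>\<^sup>2 \<le> c / 4\<close>, of "(norm a)\<^sup>2"] by (simp add: power_mult_distrib mult.assoc)
    moreover have "(\<Sum>s<m. (cmod (del (\<rho> s) p a))\<^sup>2 / 2 - (\<delta> * norm a)\<^sup>2) =
        (\<Sum>s<m. (cmod (del (\<rho> s) p a))\<^sup>2) / 2 - m * (\<delta> * norm a)\<^sup>2"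
      by (simp add: sum_subtractf sum_divide_distrib)
    moreover have "0 \<le> (\<Sum>s=m..<CARD('n). (cmod (e s a))\<^sup>2)" by (simp add: sum_nonneg)
    ultimately show "c / 4 * (norm a)\<^sup>2 \<le> (\<Sum>s<m. (cmod (del (\<rho> s) z a))\<^sup>2) + (\<Sum>s=m..<CARD('n). (cmod (e s a))\<^sup>2)"
      using e(4)[of a] by linarith
    have "cmod (del (\<rho> s) z a) \<le> (b s + \<delta>) * norm a" if "s < m" for s
      using b[OF that, of a] \<epsilon>(2)[OF z that, of a] norm_triangle_ineq2[of "del (\<rho> s) z a" "del (\<rho> s) p a"]
      unfolding distrib_right by linarith
    then have "(cmod (del (\<rho> s) z a))\<^sup>2 \<le> (b s + \<delta>)\<^sup>2 * (norm a)\<^sup>2" if "s < m" for s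
      unfolding power_mult_distrib[symmetric] using that by (intro power_mono) auto
    moreover have "(cmod (e s a))\<^sup>2 \<le> (b' s)\<^sup>2 * (norm a)\<^sup>2" for s
      unfolding power_mult_distrib[symmetric] using b' by (intro power_mono) auto
    ultimately have "(\<Sum>s<m. (cmod (del (\<rho> s) z a))\<^sup>2) + (\<Sum>s=m..<CARD('n). (cmod (e s a))\<^sup>2) \<le>
        (\<Sum>s<m. (b s + \<delta>)\<^sup>2 * (norm a)\<^sup>2) + (\<Sum>s=m..<CARD('n). (b' s)\<^sup>2 * (norm a)\<^sup>2)"
      by (intro add_mono sum_mono) auto
    also have "\<dots> \<le> \<Gamma> * (norm a)\<^sup>2"
      unfolding \<Gamma>_def by (simp add: sum_distrib_right distrib_right)
    finally show "(\<Sum>s<m. (cmod (del (\<rho> s) z a))\<^sup>2) + (\<Sum>s=m..<CARD('n). (cmod (e s a))\<^sup>2) \<le> \<Gamma> * (norm a)\<^sup>2" .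
  qed
qed

section \<open>Mass estimates near a generating submanifold\<close>

lemma open_tube: "open (tube M t)"
proof -
  have "tube M t = (\<Union>p\<in>M. ball p t)" by (auto simp: tube_def dist_commute)
  then show ?thesis by auto
qed

lemma tube_mono: "t \<le> t' \<Longrightarrow> tube M t \<subseteq> tube M t'"
  by (force simp: tube_def)

lemma strongly_positive_weaken:
  assumes "strongly_positive k (\<lambda>v. \<i> ^ k * (W v - of_real x * wedge_forms k (\<lambda>_. std_form) v))" "y \<le> x"
  shows "strongly_positive k (\<lambda>v. \<i> ^ k * (W v - of_real y * wedge_forms k (\<lambda>_. std_form) v))"
proof -
  have "strongly_positive k (\<lambda>v. of_real (x - y) * (\<i> ^ k * wedge_forms k (\<lambda>_. std_form) v))"
    by (intro strongly_positive_scale strongly_positive_wedge sum_of_squares_std_form) (use assms(2) in auto)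
  from strongly_positive_add[OF assms(1) this] show ?thesis
    by (simp add: algebra_simps)
qed

lemma frechet_derivative_eq_on_open:
  assumes "open V" "x \<in> V" "\<And>y. y \<in> V \<Longrightarrow> f y = g y" "g differentiable at x"
  shows "frechet_derivative f (at x) = frechet_derivative g (at x)"
  using frechet_derivative_transform_within_open[OF assms(4,1,2), of f] assms(3) by simp

text \<open>The weight \<open>t\<^sup>2 / reg_dist\<^sup>3\<close> is comparable to \<open>1/t\<close> on the tube and bounds the Levi form of
  \<open>reg_dist\<close> from below in the directions transverse to \<open>M\<close>; the remaining directions are
  controlled by the multiple of \<open>\<bar>z\<bar>\<^sup>2\<close>.\<close>

lemma local_estimate:
  fixes M :: "(complex ^ 'n::finite) set"
  assumes op: "open \<Omega>" and gen: "generating M" and sub: "embedded_submanifold m M" and m: "2 \<le> m"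
    and p: "p \<in> M" "p \<in> \<Omega>" and t0: "t0 > 0"
  shows "\<exists>\<epsilon>>0. ball p \<epsilon> \<subseteq> \<Omega> \<and> (\<exists>C>0. \<forall>\<theta> t. closed_positive_current11 \<Omega> \<theta> \<and> 0 < t \<and> t < \<epsilon> \<longrightarrow>
    emeasure (trace_measure \<Omega> \<theta>) (tube M t \<inter> ball p \<epsilon>) \<le>
      ennreal (C * t ^ (m - 1)) * emeasure (trace_measure \<Omega> \<theta>) (tube M t0 \<inter> \<Omega>))"
proof -
  obtain U and \<rho> :: "nat \<Rightarrow> complex ^ 'n \<Rightarrow> real" where
    U\<rho>: "open U \<and> p \<in> U \<and> (\<forall>j<m. smooth_on U (\<rho> j)) \<and> M \<inter> U = {x \<in> U. \<forall>j<m. \<rho> j x = 0} \<and>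
       (\<forall>c :: nat \<Rightarrow> real. (\<forall>v. (\<Sum>j<m. c j * frechet_derivative (\<rho> j) (at p) v) = 0) \<longrightarrow> (\<forall>j<m. c j = 0))"
    using bspec[OF sub[unfolded embedded_submanifold_def] p(1)] by (elim exE)
  from U\<rho> have U: "open U" "p \<in> U" and \<rho>: "\<And>j. j < m \<Longrightarrow> smooth_on U (\<rho> j)"
    "M \<inter> U = {x \<in> U. \<forall>j<m. \<rho> j x = 0}"
    by simp_all
  have indep: "\<forall>j<m. c j = 0" if "\<And>v. (\<Sum>j<m. c j * frechet_derivative (\<rho> j) (at p) v) = 0" for c :: "nat \<Rightarrow> real"
    using U\<rho> that by simp
  obtain e c \<Gamma> \<epsilon>0 where e: "m \<le> CARD('n)" "\<And>s. complex_linear (e s)" "c > 0" "\<Gamma> > 0" "\<epsilon>0 > 0"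
    "\<And>z a. z \<in> ball p \<epsilon>0 \<Longrightarrow>
      c * (norm a)\<^sup>2 \<le> (\<Sum>s<m. (cmod (del (\<rho> s) z a))\<^sup>2) + (\<Sum>s=m..<CARD('n). (cmod (e s a))\<^sup>2)"
    "\<And>z a. z \<in> ball p \<epsilon>0 \<Longrightarrow>
      (\<Sum>s<m. (cmod (del (\<rho> s) z a))\<^sup>2) + (\<Sum>s=m..<CARD('n). (cmod (e s a))\<^sup>2) \<le> \<Gamma> * (norm a)\<^sup>2"
    by (rule local_frame[OF gen p(1) U, where \<rho> = \<rho> and m = m]) (use \<rho> indep in blast)+
  \<comment> \<open>m >= 2 and m <= n force n >= 2, so there are test forms of degree 2n - 3 against
    which closedness can be used.\<close>
  obtain l where n: "CARD('n) = Suc (Suc l)" using e(1) m by (metis add_2_eq_Suc le_Suc_ex le_trans)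
  define k where "k = Suc l"
  have nk: "CARD('n) = Suc k" using n by (simp add: k_def)
  obtain \<delta> where \<delta>: "\<delta> > 0" "cball p \<delta> \<subseteq> U \<inter> \<Omega>"
    using open_contains_cball[of "U \<inter> \<Omega>"] U p(2) op by blast
  define \<epsilon> where "\<epsilon> = min (min \<epsilon>0 \<delta>) t0 / 8"
  have \<epsilon>: "\<epsilon> > 0" "8 * \<epsilon> \<le> \<epsilon>0" "8 * \<epsilon> \<le> \<delta>" "8 * \<epsilon> \<le> t0"
    using e(5) \<delta>(1) t0 by (auto simp: \<epsilon>_def)
  have sub\<delta>: "cball p s \<subseteq> U" "cball p s \<subseteq> \<Omega>" if "s \<le> 8 * \<epsilon>" for s
    using that \<delta>(2) \<epsilon>(3) subset_cball[of s \<delta> p] by (auto intro: order_trans)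
  \<comment> \<open>Nested cutoffs. The lower bound is localised by \<open>h1\<close> to radius
    2\<epsilon>, where the cut-off defining functions agree with \<rho>; \<open>h\<close> confines
    them to radius 4\<epsilon>; \<xi> is 1 on radius 5\<epsilon>, hence wherever the potential is
    nonzero, and its support of radius 6\<epsilon> still lies in the tube of radius t0.\<close>
  obtain h1 where h1: "smooth_on UNIV h1" "\<And>x. 0 \<le> h1 x" "\<And>x. h1 x \<le> (1::real)"
    "\<And>x. dist p x \<le> \<epsilon> \<Longrightarrow> h1 x = 1" "\<And>x. 2 * \<epsilon> \<le> dist p x \<Longrightarrow> h1 x = 0"
    by (rule smooth_bump_exists[of \<epsilon> "2 * \<epsilon>" p]) (use \<epsilon>(1) in auto)
  obtain h where h: "smooth_on UNIV h" "\<And>x. 0 \<le> h x" "\<And>x. h x \<le> (1::real)"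
    "\<And>x. dist p x \<le> 3 * \<epsilon> \<Longrightarrow> h x = 1" "\<And>x. 4 * \<epsilon> \<le> dist p x \<Longrightarrow> h x = 0"
    by (rule smooth_bump_exists[of "3 * \<epsilon>" "4 * \<epsilon>" p]) (use \<epsilon>(1) in auto)
  obtain \<xi> where \<xi>: "smooth_on UNIV \<xi>" "\<And>x. 0 \<le> \<xi> x" "\<And>x. \<xi> x \<le> (1::real)"
    "\<And>x. dist p x \<le> 5 * \<epsilon> \<Longrightarrow> \<xi> x = 1" "\<And>x. 6 * \<epsilon> \<le> dist p x \<Longrightarrow> \<xi> x = 0"
    by (rule smooth_bump_exists[of "5 * \<epsilon>" "6 * \<epsilon>" p]) (use \<epsilon>(1) in auto)
  have h1t: "test_function \<Omega> h1"
    by (rule test_functionI[OF h1(1) compact_cball sub\<delta>(2)[of "2 * \<epsilon>"]]) (use \<epsilon>(1) h1(5) in auto)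
  have \<xi>t: "test_function \<Omega> \<xi>"
    by (rule test_functionI[OF \<xi>(1) compact_cball sub\<delta>(2)[of "6 * \<epsilon>"]]) (use \<epsilon>(1) \<xi>(5) in auto)
  define q where "q j x = h x * \<rho> j x" for j x
  have q0: "q j x = 0" if "x \<notin> cball p (4 * \<epsilon>)" for j x using h(5)[of x] that by (simp add: q_def)
  have qs: "smooth_on UNIV (q j)" if "j < m" for j
  proof -
    have 1: "smooth_on U (q j)"
      unfolding q_def by (intro smooth_on_mult U \<rho> that smooth_on_subset[OF h(1)]) auto
    have 2: "smooth_on (- cball p (4 * \<epsilon>)) (q j)"
      by (rule smooth_on_cong[OF _ _ smooth_on_const[of _ 0]]) (use q0 in auto)
    have "U \<union> - cball p (4 * \<epsilon>) = UNIV" using sub\<delta>(1)[of "4 * \<epsilon>"] \<epsilon>(1) by auto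
    with smooth_on_Un[OF 1 2] show ?thesis by simp
  qed
  have qt: "test_function \<Omega> (q j)" if "j < m" for j
    by (rule test_functionI[OF qs[OF that] compact_cball sub\<delta>(2)[of "4 * \<epsilon>"] q0]) (use \<epsilon>(1) in auto)
  have delq: "del (q j) z = del (\<rho> j) z" if "j < m" "z \<in> ball p (3 * \<epsilon>)" for j z
  proof -
    have "z \<in> U" using that(2) sub\<delta>(1)[of "3 * \<epsilon>"] \<epsilon>(1) by (auto simp: subset_iff)
    then have "frechet_derivative (q j) (at z) = frechet_derivative (\<rho> j) (at z)"
      using that h(4) by (intro frechet_derivative_eq_on_open[of "ball p (3 * \<epsilon>)"] smooth_on_differentiable[OF \<rho>(1)])
        (auto simp: q_def)
    then show ?thesis by (simp add: del_def fun_eq_iff)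
  qed
  have "\<exists>B>0. \<forall>x a. \<bar>hess (q j) x a a\<bar> \<le> B * (norm a)\<^sup>2" if "j < m" for j
    by (rule test_function_hess_bound[OF qt[OF that]]) blast
  then obtain bh where bh: "\<And>j. j < m \<Longrightarrow> bh j > 0" "\<And>j x a. j < m \<Longrightarrow> \<bar>hess (q j) x a a\<bar> \<le> bh j * (norm a)\<^sup>2"
    by metis
  have "\<exists>B>0. \<forall>x y. \<bar>q j x - q j y\<bar> \<le> B * dist x y" if "j < m" for j
    by (rule test_function_lipschitz[OF qt[OF that]]) blast
  then obtain bl where bl: "\<And>j. j < m \<Longrightarrow> bl j > 0" "\<And>j x y. j < m \<Longrightarrow> \<bar>q j x - q j y\<bar> \<le> bl j * dist x y"
    by metis
  define C0 where "C0 = (\<Sum>j<m. bh j)"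
  have C0: "0 \<le> C0" "\<And>j x a. j < m \<Longrightarrow> \<bar>hess (q j) x a a\<bar> \<le> C0 * (norm a)\<^sup>2"
  proof -
    show "0 \<le> C0" unfolding C0_def using bh(1) by (intro sum_nonneg) (auto simp: less_imp_le)
    fix j x and a :: "complex ^ 'n" assume "j < m"
    then have "bh j \<le> C0" unfolding C0_def using bh(1) by (intro member_le_sum) (auto simp: less_imp_le)
    then show "\<bar>hess (q j) x a a\<bar> \<le> C0 * (norm a)\<^sup>2"
      using bh(2)[OF \<open>j < m\<close>, of x a] mult_right_mono[of "bh j" C0 "(norm a)\<^sup>2"] by simp
  qed
  \<comment> \<open>The first summand absorbs the Hessian loss of \<open>reg_dist\<close>; the
    second remains available to dominate the frame.\<close>
  define A where "A = m * C0 / 2 + \<Gamma>"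
  have A: "A > 0" unfolding A_def using C0(1) e(4) by (intro add_nonneg_pos) auto
  \<comment> \<open>On the tube \<open>reg_dist\<close> is at most D t by the Lipschitz bounds, so
    the weight t^2/S^3 is at least 1/(D^3 t); \<kappa> below collects the resulting
    constants.\<close>
  define D where "D = sqrt ((\<Sum>j<m. (bl j)\<^sup>2) + 1)"
  have D: "D > 0" unfolding D_def by (intro real_sqrt_gt_zero add_nonneg_pos sum_nonneg) auto
  define \<kappa> where "\<kappa> = c ^ k / (D ^ 3) ^ (m - 1)"
  have \<kappa>: "\<kappa> > 0" using e(3) D by (simp add: \<kappa>_def)
  have key: "(\<integral>x. c ^ k * h1 x * (t\<^sup>2 / reg_dist m q t x ^ 3) ^ (m - 1) \<partial>trace_measure \<Omega> \<theta>) \<le>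
      (\<integral>x. A ^ k * \<xi> x \<partial>trace_measure \<Omega> \<theta>)"
    and gt: "test_function \<Omega> (\<lambda>x. c ^ k * h1 x * (t\<^sup>2 / reg_dist m q t x ^ 3) ^ (m - 1))"
    if \<theta>: "closed_positive_current11 \<Omega> \<theta>" and t: "t > 0" for \<theta> t
  proof -
    let ?r = "\<lambda>x. t\<^sup>2 / reg_dist m q t x ^ 3"
    let ?\<phi> = "\<lambda>y. reg_dist m q t y - t"
    let ?g = "\<lambda>x. c ^ k * h1 x * ?r x ^ (m - 1)"
    have rpos: "?r x > 0" for x using reg_dist_pos[OF t, of m q x] t by simp
    have rs: "smooth_on UNIV ?r"
      unfolding divide_inverse power_inverse[symmetric]
      by (intro smooth_on_mult smooth_on_const smooth_on_power smooth_on_inverse smooth_reg_dist qs t reg_dist_pos) auto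
    have "test_function \<Omega> (\<lambda>x. c ^ k * (h1 x * ?r x ^ (m - 1)))"
      by (intro test_function_scale test_function_mult_smooth h1t smooth_on_power rs) auto
    then show g: "test_function \<Omega> ?g" by (simp only: mult.assoc)
    have f: "test_function \<Omega> (\<lambda>x. A ^ k * \<xi> x)" by (intro test_function_scale \<xi>t)
    have \<phi>s: "smooth_on UNIV ?\<phi>"
      by (intro smooth_on_diff smooth_reg_dist qs t smooth_on_const) auto
    have \<phi>0: "?\<phi> x = 0" if "x \<notin> cball p (4 * \<epsilon>)" for x
      using q0[OF that] t by (simp add: reg_dist_def)
    have \<phi>t: "test_function \<Omega> ?\<phi>"
      by (rule test_functionI[OF \<phi>s compact_cball sub\<delta>(2)[of "4 * \<epsilon>"] \<phi>0]) (use \<epsilon>(1) in auto)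
    let ?q = "\<lambda>y :: complex ^ 'n. A * (norm y)\<^sup>2"
    have qqs: "smooth_on UNIV ?q"
      using smooth_on_norm_diff_sq[of UNIV "0 :: complex ^ 'n"] by (intro smooth_on_mult smooth_on_const) auto
    let ?L = "\<lambda>x. levi (\<lambda>y. ?q y + ?\<phi> y) x"
    have L_eq: "?L x a b = of_real A * std_form a b + levi ?\<phi> x a b" for x a b
      using levi_add[OF qqs \<phi>s, of x a b] unfolding levi_scaled_norm_sq .
    have Lh: "hermitian_form (?L x)" for x
      by (intro hermitian_levi smooth_on_add qqs \<phi>s) auto
    have low: "\<Gamma> * (norm a)\<^sup>2 + ?r x * (\<Sum>j<m. (cmod (del (q j) x a))\<^sup>2) \<le> Re (?L x a a)" for x a
    proof -
      have "?r x * (\<Sum>j<m. (cmod (del (q j) x a))\<^sup>2) - m * C0 / 2 * (norm a)\<^sup>2 \<le> Re (levi ?\<phi> x a a)"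
        by (rule levi_reg_dist_lower[OF qs t C0(2,1)])
      moreover have "Re (?L x a a) = A * (norm a)\<^sup>2 + Re (levi ?\<phi> x a a)"
        unfolding L_eq by (simp add: Re_std_form)
      ultimately show ?thesis by (simp add: A_def distrib_right)
    qed
    have Lpos: "0 \<le> Re (?L x a a)" for x a
    proof -
      have "0 \<le> ?r x * (\<Sum>j<m. (cmod (del (q j) x a))\<^sup>2)"
        using rpos[of x] by (intro mult_nonneg_nonneg sum_nonneg) auto
      moreover have "0 \<le> \<Gamma> * (norm a)\<^sup>2" using e(4) by simp
      ultimately show ?thesis using low[of a x] by linarith
    qed
    show "(\<integral>x. ?g x \<partial>trace_measure \<Omega> \<theta>) \<le> (\<integral>x. A ^ k * \<xi> x \<partial>trace_measure \<Omega> \<theta>)"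
    proof (rule trace_measure_inequality[OF \<theta> op n \<phi>t f g, of A, folded k_def])
      fix x
      show "strongly_positive k (\<lambda>v. \<i> ^ k * (wedge_forms k (\<lambda>_. ?L x) v -
          of_real (A ^ k + ?g x - A ^ k * \<xi> x) * wedge_forms k (\<lambda>_. std_form) v))"
      \<comment> \<open>Far from p the potential vanishes and the Levi power is A^k times the
        standard one, so A^k \<xi>, which is nonnegative, is left. Near p, \<xi> = 1 cancels A^k and
        the Levi power itself has to dominate the localised weight.\<close>
      proof (cases "dist p x \<le> 5 * \<epsilon>")
        case False
        then have x: "x \<notin> cball p (4 * \<epsilon>)" using \<epsilon>(1) by auto
        have "levi ?\<phi> x a b = 0" for a b
          unfolding levi_def using hess_outside(2)[OF closed_cball \<phi>0 x] by simp
        then have "?L x = (\<lambda>a b. of_real A * std_form a b)" by (simp add: L_eq fun_eq_iff)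
        then have W: "wedge_forms k (\<lambda>_. ?L x) v = of_real (A ^ k) * wedge_forms k (\<lambda>_. std_form) v" for v
          by (simp only: wedge_forms_scale of_real_power)
        have h10: "h1 x = 0" using h1(5)[of x] False \<epsilon>(1) by simp
        have "strongly_positive k (\<lambda>v. of_real (A ^ k * \<xi> x) * (\<i> ^ k * wedge_forms k (\<lambda>_. std_form) v))"
          using A \<xi>(2) by (intro strongly_positive_scale strongly_positive_wedge sum_of_squares_std_form) auto
        then show ?thesis unfolding W by (simp add: h10 algebra_simps)
      next
        case True
        then have coeff: "A ^ k + ?g x - A ^ k * \<xi> x = ?g x" using \<xi>(4)[of x] by simp
        show ?thesis
          unfolding coeff
        proof (cases "h1 x = 0")
          case True
          have "strongly_positive k (\<lambda>v. \<i> ^ k * wedge_forms k (\<lambda>_. ?L x) v)"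
            by (intro strongly_positive_wedge positive_hermitian_sum_of_squares Lh Lpos)
          then show "strongly_positive k (\<lambda>v. \<i> ^ k * (wedge_forms k (\<lambda>_. ?L x) v -
              of_real (?g x) * wedge_forms k (\<lambda>_. std_form) v))" using True by simp
        next
          case False
          then have dx: "dist p x < 2 * \<epsilon>" using h1(5)[of x] by force
          then have x0: "x \<in> ball p \<epsilon>0" and x3: "x \<in> ball p (3 * \<epsilon>)" using \<epsilon>(1,2) by auto
          define e' where "e' s = (if s < m then del (\<rho> s) x else e s)" for s
          have xU: "x \<in> U" using x3 sub\<delta>(1)[of "3 * \<epsilon>"] \<epsilon>(1) by (auto simp: subset_iff)
          have e': "complex_linear (e' s)" for s
            unfolding e'_def using e(2) complex_linear_del[OF smooth_on_differentiable[OF \<rho>(1) xU]] by auto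
          have s1: "(\<Sum>s<m. (cmod (e' s a))\<^sup>2) = (\<Sum>s<m. (cmod (del (\<rho> s) x a))\<^sup>2)" for a
            by (intro sum.cong) (auto simp: e'_def)
          have s2: "(\<Sum>s=m..<Suc k. (cmod (e' s a))\<^sup>2) = (\<Sum>s=m..<CARD('n). (cmod (e s a))\<^sup>2)" for a
            unfolding nk by (intro sum.cong) (auto simp: e'_def)
          have mk: "m \<le> Suc k" using e(1) nk by simp
          have s3: "(\<Sum>s<Suc k. (cmod (e' s a))\<^sup>2) = (\<Sum>s<m. (cmod (e' s a))\<^sup>2) + (\<Sum>s=m..<Suc k. (cmod (e' s a))\<^sup>2)" for a
            unfolding lessThan_atLeast0 by (rule sum.atLeastLessThan_concat[symmetric]) (use mk in auto)
          \<comment> \<open>In the weight 1 + t^2/S^3 the 1 comes from \<Gamma>, which dominates the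
            entire frame, and t^2/S^3 from the Levi form of \<open>reg_dist\<close>, which sees only
            the first m covectors.\<close>
          have "strongly_positive k (\<lambda>v. \<i> ^ k * (wedge_forms k (\<lambda>_. ?L x) v -
              of_real ((1 + ?r x) ^ (m - 1) * c ^ k) * wedge_forms k (\<lambda>_. std_form) v))"
          proof (rule hermitian_power_lower[OF Lh e' mk])
            fix a
            have eq: "(\<Sum>j<m. (cmod (del (q j) x a))\<^sup>2) = (\<Sum>s<m. (cmod (del (\<rho> s) x a))\<^sup>2)"
              by (intro sum.cong) (auto simp: delq[OF _ x3])
            show "(1 + ?r x) * (\<Sum>s<m. (cmod (e' s a))\<^sup>2) + (\<Sum>s=m..<Suc k. (cmod (e' s a))\<^sup>2) \<le> Re (?L x a a)"
              using low[of a x, unfolded eq] e(7)[OF x0, of a] unfolding s1 s2 distrib_right by linarith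
            show "c * (norm a)\<^sup>2 \<le> (\<Sum>s<Suc k. (cmod (e' s a))\<^sup>2)"
              using e(6)[OF x0, of a] unfolding s3 s1 s2 .
          qed (use e(3) rpos[of x] in auto)
          then show "strongly_positive k (\<lambda>v. \<i> ^ k * (wedge_forms k (\<lambda>_. ?L x) v -
              of_real (?g x) * wedge_forms k (\<lambda>_. std_form) v))"
          proof (rule strongly_positive_weaken)
            have "h1 x * ?r x ^ (m - 1) \<le> 1 * (1 + ?r x) ^ (m - 1)"
              using h1(2,3)[of x] rpos[of x] by (intro mult_mono power_mono) auto
            then have "c ^ k * (h1 x * ?r x ^ (m - 1)) \<le> c ^ k * (1 + ?r x) ^ (m - 1)"
              using e(3) by (intro mult_left_mono) auto
            then show "?g x \<le> (1 + ?r x) ^ (m - 1) * c ^ k" by (simp only: mult.assoc mult.commute[of "(1 + ?r x) ^ (m - 1)"])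
          qed
        qed
      qed
    qed
  qed
  have ball\<Omega>: "ball p \<epsilon> \<subseteq> \<Omega>" using sub\<delta>(2)[of \<epsilon>] \<epsilon>(1) ball_subset_cball[of p \<epsilon>] by auto
  have est: "emeasure (trace_measure \<Omega> \<theta>) (tube M t \<inter> ball p \<epsilon>) \<le>
      ennreal (A ^ k / \<kappa> * t ^ (m - 1)) * emeasure (trace_measure \<Omega> \<theta>) (tube M t0 \<inter> \<Omega>)"
    if \<theta>: "closed_positive_current11 \<Omega> \<theta>" and t: "t > 0" "t < \<epsilon>" for \<theta> t
  proof -
    let ?\<mu> = "trace_measure \<Omega> \<theta>"
    let ?g = "\<lambda>x. c ^ k * h1 x * (t\<^sup>2 / reg_dist m q t x ^ 3) ^ (m - 1)"
    let ?f = "\<lambda>x. A ^ k * \<xi> x"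
    let ?S = "tube M t \<inter> ball p \<epsilon>"
    have tm: "sets ?\<mu> = sets (restrict_space borel \<Omega>)" "\<And>K. compact K \<Longrightarrow> K \<subseteq> \<Omega> \<Longrightarrow> emeasure ?\<mu> K < \<infinity>"
      using is_trace_measure_trace_measure[OF \<theta> op] unfolding is_trace_measure_def by blast+
    have opens: "G \<in> sets ?\<mu>" if "open G" "G \<subseteq> \<Omega>" for G
      unfolding tm(1) sets_restrict_borel_open[OF op] using that by blast
    have S: "?S \<in> sets ?\<mu>" using ball\<Omega> by (intro opens open_Int open_tube) auto
    have T: "tube M t0 \<inter> \<Omega> \<in> sets ?\<mu>" by (intro opens open_Int open_tube op) auto
    have gi: "integrable ?\<mu> ?g" by (rule test_function_integrable[OF op tm gt[OF \<theta> t(1)]])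
    have fi: "integrable ?\<mu> ?f"
      by (rule test_function_integrable[OF op tm]) (auto intro: test_function_scale \<xi>t)
    have gnn: "0 \<le> ?g x" for x
      using e(3) h1(2)[of x] reg_dist_pos[OF t(1), of m q x] by simp
    have fnn: "0 \<le> ?f x" for x using A \<xi>(2)[of x] by simp
    have g_low: "\<kappa> / t ^ (m - 1) \<le> ?g z" if z: "z \<in> ?S" for z
    proof -
      obtain p' where p': "p' \<in> M" "dist z p' < t" using z by (auto simp: tube_def)
      have zp: "dist p z < \<epsilon>" using z by simp
      have "dist p p' \<le> dist p z + dist z p'" by (rule dist_triangle)
      then have "dist p p' < 2 * \<epsilon>" using p'(2) t(2) zp by linarith
      \<comment> \<open>Since t < \<epsilon>, the nearby point p' of M is still in the chart, where
        M is the zero set of the \<rho>_j. The Lipschitz bound can thus start from q_j(p') =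
        0.\<close>
      then have "p' \<in> U" using sub\<delta>(1)[of "2 * \<epsilon>"] \<epsilon>(1) by (auto simp: subset_iff)
      then have "\<rho> j p' = 0" if "j < m" for j using \<rho>(2) p'(1) that by blast
      then have qp': "q j p' = 0" if "j < m" for j using that by (simp add: q_def)
      have "(q j z)\<^sup>2 \<le> (bl j)\<^sup>2 * t\<^sup>2" if "j < m" for j
      proof -
        have "\<bar>q j z\<bar> \<le> bl j * dist z p'" using bl(2)[OF that, of z p'] qp'[OF that] by simp
        also have "\<dots> \<le> bl j * t" using p'(2) bl(1)[OF that] by (intro mult_left_mono) auto
        finally have "\<bar>q j z\<bar>\<^sup>2 \<le> (bl j * t)\<^sup>2" by (intro power_mono) auto
        then show ?thesis by (simp add: power_mult_distrib)
      qed
      then have "(\<Sum>j<m. (q j z)\<^sup>2) \<le> (\<Sum>j<m. (bl j)\<^sup>2 * t\<^sup>2)" by (intro sum_mono) auto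
      then have "reg_dist m q t z \<le> sqrt (((\<Sum>j<m. (bl j)\<^sup>2) + 1) * t\<^sup>2)"
        unfolding reg_dist_def by (intro real_sqrt_le_mono) (simp add: distrib_right sum_distrib_right)
      also have "\<dots> = D * t" using t by (simp add: real_sqrt_mult D_def)
      finally have RD: "reg_dist m q t z \<le> D * t" .
      note Rp = reg_dist_pos[OF t(1), of m q z]
      have "1 / (D ^ 3 * t) = t\<^sup>2 / (D * t) ^ 3" using t D by (simp add: power2_eq_square power3_eq_cube)
      also have "\<dots> \<le> t\<^sup>2 / reg_dist m q t z ^ 3"
        using RD Rp D t by (intro divide_left_mono power_mono mult_pos_pos zero_less_power) auto
      finally have "(1 / (D ^ 3 * t)) ^ (m - 1) \<le> (t\<^sup>2 / reg_dist m q t z ^ 3) ^ (m - 1)"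
        using D t by (intro power_mono) auto
      then have "c ^ k * (1 / (D ^ 3 * t)) ^ (m - 1) \<le> c ^ k * (t\<^sup>2 / reg_dist m q t z ^ 3) ^ (m - 1)"
        using e(3) by (intro mult_left_mono) auto
      moreover have "h1 z = 1" using h1(4)[of z] zp by simp
      moreover have "\<kappa> / t ^ (m - 1) = c ^ k * (1 / (D ^ 3 * t)) ^ (m - 1)"
        by (simp add: \<kappa>_def power_divide power_mult_distrib)
      ultimately show ?thesis by simp
    qed
    have \<kappa>t: "\<kappa> / t ^ (m - 1) > 0" using \<kappa> t by simp
    have "ennreal (\<kappa> / t ^ (m - 1)) * emeasure ?\<mu> ?S = (\<integral>\<^sup>+x. ennreal (\<kappa> / t ^ (m - 1)) * indicator ?S x \<partial>?\<mu>)"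
      by (rule nn_integral_cmult_indicator[OF S, symmetric])
    also have "\<dots> \<le> (\<integral>\<^sup>+x. ennreal (?g x) \<partial>?\<mu>)"
      using g_low by (intro nn_integral_mono) (auto simp: indicator_def intro!: ennreal_leI)
    also have "\<dots> = ennreal (\<integral>x. ?g x \<partial>?\<mu>)" using gnn by (intro nn_integral_eq_integral gi) auto
    also have "\<dots> \<le> ennreal (\<integral>x. ?f x \<partial>?\<mu>)" by (intro ennreal_leI key \<theta> t)
    also have "\<dots> = (\<integral>\<^sup>+x. ennreal (?f x) \<partial>?\<mu>)" using fnn by (intro nn_integral_eq_integral[symmetric] fi) auto
    also have "\<dots> \<le> (\<integral>\<^sup>+x. ennreal (A ^ k) * indicator (tube M t0 \<inter> \<Omega>) x \<partial>?\<mu>)"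
    proof (rule nn_integral_mono)
      fix x
      show "ennreal (?f x) \<le> ennreal (A ^ k) * indicator (tube M t0 \<inter> \<Omega>) x"
      proof (cases "x \<in> tube M t0 \<inter> \<Omega>")
        case True
        then show ?thesis using A \<xi>(3)[of x] by (auto simp: indicator_def intro!: ennreal_leI mult_left_le)
      next
        case False
        \<comment> \<open>The support of \<xi> is within t0 of p, itself a point of M.\<close>
        have "\<not> dist p x < 6 * \<epsilon>"
        proof
          assume "dist p x < 6 * \<epsilon>"
          then have "x \<in> tube M t0" "x \<in> \<Omega>"
            using p(1) \<epsilon>(1,4) sub\<delta>(2)[of "6 * \<epsilon>"] by (auto simp: tube_def dist_commute subset_iff intro!: bexI[of _ p])
          then show False using False by simp
        qed
        then show ?thesis using \<xi>(5)[of x] by simp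
      qed
    qed
    also have "\<dots> = ennreal (A ^ k) * emeasure ?\<mu> (tube M t0 \<inter> \<Omega>)"
      by (rule nn_integral_cmult_indicator[OF T])
    finally have main: "ennreal (\<kappa> / t ^ (m - 1)) * emeasure ?\<mu> ?S \<le> ennreal (A ^ k) * emeasure ?\<mu> (tube M t0 \<inter> \<Omega>)" .
    \<comment> \<open>The masses may be infinite, so the factor is removed by multiplying with its
      inverse rather than by cancellation.\<close>
    have one: "ennreal (t ^ (m - 1) / \<kappa>) * ennreal (\<kappa> / t ^ (m - 1)) = 1"
      using \<kappa> t by (simp add: ennreal_mult[symmetric])
    have "emeasure ?\<mu> ?S = ennreal (t ^ (m - 1) / \<kappa>) * (ennreal (\<kappa> / t ^ (m - 1)) * emeasure ?\<mu> ?S)"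
      by (simp only: mult.assoc[symmetric] one mult_1_left)
    also have "\<dots> \<le> ennreal (t ^ (m - 1) / \<kappa>) * (ennreal (A ^ k) * emeasure ?\<mu> (tube M t0 \<inter> \<Omega>))"
      by (rule mult_left_mono[OF main]) simp
    also have "\<dots> = ennreal (A ^ k / \<kappa> * t ^ (m - 1)) * emeasure ?\<mu> (tube M t0 \<inter> \<Omega>)"
      using A \<kappa> t by (simp add: mult.assoc[symmetric] ennreal_mult[symmetric] mult.commute)
    finally show ?thesis .
  qed
  have "A ^ k / \<kappa> > 0" using A \<kappa> by simp
  then show ?thesis using \<epsilon>(1) ball\<Omega> est by blast
qed

section \<open>From local estimates to the ball of radius r by compactness\<close>

theorem theorem1p1:
  fixes M :: "(complex ^ 'n::finite) set" and m :: nat and r :: real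
  assumes "M \<subseteq> ball 0 1"
    and "properly_embedded_submanifold (ball 0 1) m M"
    and "generating M"
    and "0 < r" and "r < 1"
  shows "\<exists>\<tau>>0. \<forall>t0. 0 < t0 \<and> t0 \<le> \<tau> \<longrightarrow>
           (\<exists>C>0. \<forall>\<theta> t. closed_positive_current11 (ball 0 1) \<theta> \<and> 0 < t \<and> t \<le> t0 \<longrightarrow>
              emeasure (trace_measure (ball 0 1) \<theta>) (tube M t \<inter> ball 0 r)
              \<le> ennreal C * emeasure (trace_measure (ball 0 1) \<theta>) (tube M t0 \<inter> ball 0 1)
                  * ennreal (t powr (real m - 1)))"
proof (rule exI[of _ 1], intro conjI allI impI)
  \<comment> \<open>The constant may depend on t0. For t below a radius determined by M, r and t0
    the local estimates apply, and for larger t monotonicity does; hence \<tau> = 1 is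
    admissible.\<close>
  fix t0 :: real assume "0 < t0 \<and> t0 \<le> 1"
  then have t0: "0 < t0" by simp
  let ?\<Omega> = "ball 0 1 :: (complex ^ 'n) set"
  let ?E = "\<lambda>\<theta>. emeasure (trace_measure ?\<Omega> \<theta>)"
  have mono: "?E \<theta> (tube M t \<inter> ball 0 r) \<le> ?E \<theta> (tube M t0 \<inter> ?\<Omega>)"
    if \<theta>: "closed_positive_current11 ?\<Omega> \<theta>" and t: "t \<le> t0" for \<theta> t
  proof (rule emeasure_mono)
    show "tube M t \<inter> ball 0 r \<subseteq> tube M t0 \<inter> ?\<Omega>"
      using tube_mono[OF t, of M] assms(5) by auto
    have "sets (trace_measure ?\<Omega> \<theta>) = sets (restrict_space borel ?\<Omega>)"
      using is_trace_measure_trace_measure[OF \<theta>] unfolding is_trace_measure_def by blast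
    then show "tube M t0 \<inter> ?\<Omega> \<in> sets (trace_measure ?\<Omega> \<theta>)"
      unfolding sets_restrict_borel_open[OF open_ball] using open_tube[of M t0] by (auto intro!: sigma_sets.Basic)
  qed
  have trivial: "?E \<theta> (tube M t \<inter> ball 0 r) \<le> ennreal C * ?E \<theta> (tube M t0 \<inter> ?\<Omega>) * ennreal (t powr (real m - 1))"
    if "closed_positive_current11 ?\<Omega> \<theta>" "t \<le> t0" "0 \<le> C" "1 \<le> C * t powr (real m - 1)" for \<theta> t C
  proof -
    have "?E \<theta> (tube M t \<inter> ball 0 r) \<le> ennreal 1 * ?E \<theta> (tube M t0 \<inter> ?\<Omega>)" using mono[OF that(1,2)] by simp
    also have "\<dots> \<le> ennreal (C * t powr (real m - 1)) * ?E \<theta> (tube M t0 \<inter> ?\<Omega>)"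
      using that(4) by (intro mult_right_mono ennreal_leI) auto
    also have "\<dots> = ennreal C * ?E \<theta> (tube M t0 \<inter> ?\<Omega>) * ennreal (t powr (real m - 1))"
      using that(3) by (simp add: ennreal_mult mult.assoc mult.left_commute mult.commute)
    finally show ?thesis .
  qed
  show "\<exists>C>0. \<forall>\<theta> t. closed_positive_current11 ?\<Omega> \<theta> \<and> 0 < t \<and> t \<le> t0 \<longrightarrow>
      ?E \<theta> (tube M t \<inter> ball 0 r) \<le> ennreal C * ?E \<theta> (tube M t0 \<inter> ?\<Omega>) * ennreal (t powr (real m - 1))"
  proof (cases "m \<le> 1")
    case True
    \<comment> \<open>For m = 0 the power is 1/t, so the constant must be at least t, hence t0; for
      m = 1 the power is 1.\<close>
    have "1 \<le> max 1 t0 * t powr (real m - 1)" if t: "0 < t" "t \<le> t0" for t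
    proof (cases "m = 0")
      case True
      then have "max 1 t0 * t powr (real m - 1) = max 1 t0 / t" using t by (simp add: powr_minus_divide)
      then show ?thesis using t by simp
    next
      case False
      then have "m = 1" using \<open>m \<le> 1\<close> by simp
      then show ?thesis using t by simp
    qed
    then show ?thesis
      by (intro exI[of _ "max 1 t0"] conjI allI impI trivial) auto
  next
    case False
    then have m: "2 \<le> m" by simp
    have sub: "embedded_submanifold m M" "closedin (top_of_set ?\<Omega>) M"
      using assms(2) unfolding properly_embedded_submanifold_def by auto
    \<comment> \<open>A radius strictly between r and 1: for small t, points of the tube in the ball
      of radius r have their companions on M inside the closed ball of radius R.\<close>
    define R where "R = (1 + r) / 2"
    have R: "r < R" "R < 1" using assms(5) by (auto simp: R_def)
    obtain T where T: "closed T" "M = ?\<Omega> \<inter> T" using sub(2) unfolding closedin_closed by blast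
    \<comment> \<open>Properness of the embedding enters here: M is relatively closed in the open
      ball, so its part in a smaller closed ball is compact.\<close>
    have "M \<inter> cball 0 R = cball 0 R \<inter> T" using T(2) R(2) by auto
    then have K: "compact (M \<inter> cball 0 R)" using T(1) compact_Int_closed[OF compact_cball] by simp
    have "\<exists>\<epsilon>>0. ball p \<epsilon> \<subseteq> ?\<Omega> \<and> (\<exists>C>0. \<forall>\<theta> t. closed_positive_current11 ?\<Omega> \<theta> \<and> 0 < t \<and> t < \<epsilon> \<longrightarrow>
        ?E \<theta> (tube M t \<inter> ball p \<epsilon>) \<le> ennreal (C * t ^ (m - 1)) * ?E \<theta> (tube M t0 \<inter> ?\<Omega>))"
      if "p \<in> M \<inter> cball 0 R" for p
      using that assms(1) by (intro local_estimate assms(3) sub(1) m t0) auto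
    then obtain \<epsilon> C where \<epsilon>C: "\<And>p. p \<in> M \<inter> cball 0 R \<Longrightarrow> \<epsilon> p > 0 \<and> ball p (\<epsilon> p) \<subseteq> ?\<Omega> \<and> C p > 0 \<and>
        (\<forall>\<theta> t. closed_positive_current11 ?\<Omega> \<theta> \<and> 0 < t \<and> t < \<epsilon> p \<longrightarrow>
          ?E \<theta> (tube M t \<inter> ball p (\<epsilon> p)) \<le> ennreal (C p * t ^ (m - 1)) * ?E \<theta> (tube M t0 \<inter> ?\<Omega>))"
      by metis
    \<comment> \<open>Half radii leave room to move from a point of M to a point of the tube within
      the same ball.\<close>
    have "M \<inter> cball 0 R \<subseteq> (\<Union>p\<in>M \<inter> cball 0 R. ball p (\<epsilon> p / 2))"
      using \<epsilon>C by (force intro: half_gt_zero)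
    then obtain D where D: "D \<subseteq> M \<inter> cball 0 R" "finite D" "M \<inter> cball 0 R \<subseteq> (\<Union>p\<in>D. ball p (\<epsilon> p / 2))"
      using compactE_image[OF K, of "M \<inter> cball 0 R" "\<lambda>p. ball p (\<epsilon> p / 2)"] by auto
    \<comment> \<open>R - r keeps the companion point inside the closed ball of radius R, and half
      of \<epsilon>(p) keeps the tube point inside the ball about p. The entry R - r also makes the
      minimum meaningful when \<open>D\<close> is empty.\<close>
    define \<delta> where "\<delta> = Min (insert (R - r) ((\<lambda>p. \<epsilon> p / 2) ` D))"
    have fin: "finite (insert (R - r) ((\<lambda>p. \<epsilon> p / 2) ` D))" using D(2) by simp
    have "\<epsilon> p > 0" if "p \<in> D" for p using \<epsilon>C D(1) that by blast
    then have \<delta>: "\<delta> > 0" "\<delta> \<le> R - r"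
      unfolding \<delta>_def using R(1) fin by (auto intro: Min_le)
    have \<delta>3: "\<delta> \<le> \<epsilon> p / 2" if "p \<in> D" for p
      unfolding \<delta>_def by (rule Min_le[OF fin]) (use that in blast)
    \<comment> \<open>The sum serves t < \<delta> through the finite cover; the last summand serves
      t >= \<delta> through monotonicity alone.\<close>
    define C' where "C' = (\<Sum>p\<in>D. C p) + 1 / \<delta> ^ (m - 1)"
    have Cnn: "0 \<le> C p" if "p \<in> D" for p using \<epsilon>C D(1) that by (force simp: less_imp_le)
    have C': "C' > 0" unfolding C'_def using \<delta>(1) Cnn by (intro add_nonneg_pos sum_nonneg) auto
    have powr: "t powr (real m - 1) = t ^ (m - 1)" if "t > 0" for t
    proof -
      have eq: "real m - 1 = real (m - 1)" using m by simp
      show ?thesis unfolding eq by (rule powr_realpow[OF that])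
    qed
    have "?E \<theta> (tube M t \<inter> ball 0 r) \<le> ennreal C' * ?E \<theta> (tube M t0 \<inter> ?\<Omega>) * ennreal (t powr (real m - 1))"
      if \<theta>: "closed_positive_current11 ?\<Omega> \<theta>" and t: "0 < t" "t \<le> t0" for \<theta> t
    proof (cases "t < \<delta>")
      case False
      have "\<delta> ^ (m - 1) \<le> t ^ (m - 1)" using False \<delta>(1) by (intro power_mono) auto
      then have "1 \<le> 1 / \<delta> ^ (m - 1) * t ^ (m - 1)" using \<delta>(1) by (simp add: field_simps)
      also have "\<dots> \<le> C' * t ^ (m - 1)"
        unfolding C'_def using Cnn t(1) by (intro mult_right_mono) (auto intro: sum_nonneg)
      finally show ?thesis using C' powr[OF t(1)] by (intro trivial \<theta> t) auto
    next
      case True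
      let ?\<mu> = "trace_measure ?\<Omega> \<theta>"
      have sets: "G \<in> sets ?\<mu>" if "open G" "G \<subseteq> ?\<Omega>" for G
      proof -
        have "sets ?\<mu> = sets (restrict_space borel ?\<Omega>)"
          using is_trace_measure_trace_measure[OF \<theta>] unfolding is_trace_measure_def by blast
        then show ?thesis unfolding sets_restrict_borel_open[OF open_ball] using that by blast
      qed
      let ?S = "\<lambda>p. tube M t \<inter> ball p (\<epsilon> p)"
      have cover: "tube M t \<inter> ball 0 r \<subseteq> (\<Union>p\<in>D. ?S p)"
      proof
        fix z assume z: "z \<in> tube M t \<inter> ball 0 r"
        then obtain p' where p': "p' \<in> M" "dist z p' < t" by (auto simp: tube_def)
        have "norm p' \<le> norm z + dist z p'"
          using norm_triangle_ineq4[of z "z - p'"] by (simp add: dist_norm)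
        then have "p' \<in> M \<inter> cball 0 R" using p' z True \<delta>(2) by simp
        then obtain p where p: "p \<in> D" "dist p p' < \<epsilon> p / 2" using D(3) by auto
        have "dist p z \<le> dist p p' + dist z p'" by (metis dist_commute dist_triangle)
        then have "dist p z < \<epsilon> p" using p(2) p'(2) True \<delta>3[OF p(1)] by linarith
        then show "z \<in> (\<Union>p\<in>D. ?S p)" using p(1) z assms(5) by auto
      qed
      have S: "?S p \<in> sets ?\<mu>" if "p \<in> D" for p
      proof (intro sets open_Int open_tube open_ball)
        have "ball p (\<epsilon> p) \<subseteq> ?\<Omega>" using \<epsilon>C D(1) that by blast
        then show "?S p \<subseteq> ?\<Omega>" by blast
      qed
      have "?E \<theta> (tube M t \<inter> ball 0 r) \<le> ?E \<theta> (\<Union>p\<in>D. ?S p)"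
        by (rule emeasure_mono[OF cover]) (intro sets.finite_UN D(2) S)
      also have "\<dots> \<le> (\<Sum>p\<in>D. ?E \<theta> (?S p))"
        by (rule emeasure_subadditive_finite[OF D(2)]) (use S in blast)
      also have "\<dots> \<le> (\<Sum>p\<in>D. ennreal (C p * t ^ (m - 1)) * ?E \<theta> (tube M t0 \<inter> ?\<Omega>))"
      proof (rule sum_mono)
        fix p assume p: "p \<in> D"
        then have pK: "p \<in> M \<inter> cball 0 R" using D(1) by blast
        have te: "t < \<epsilon> p" using True \<delta>3[OF p] \<delta>(1) \<epsilon>C[OF pK] by linarith
        show "?E \<theta> (?S p) \<le> ennreal (C p * t ^ (m - 1)) * ?E \<theta> (tube M t0 \<inter> ?\<Omega>)"
          using \<epsilon>C[OF pK] \<theta> t(1) te by blast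
      qed
      also have "\<dots> = ennreal (\<Sum>p\<in>D. C p * t ^ (m - 1)) * ?E \<theta> (tube M t0 \<inter> ?\<Omega>)"
      proof -
        have "(\<Sum>p\<in>D. ennreal (C p * t ^ (m - 1))) = ennreal (\<Sum>p\<in>D. C p * t ^ (m - 1))"
          by (rule sum_ennreal) (use Cnn t(1) in auto)
        then show ?thesis by (simp only: sum_distrib_right[symmetric])
      qed
      also have "\<dots> \<le> ennreal (C' * t ^ (m - 1)) * ?E \<theta> (tube M t0 \<inter> ?\<Omega>)"
        unfolding C'_def sum_distrib_right[symmetric] using \<delta>(1) t(1)
        by (intro mult_right_mono ennreal_leI) auto
      also have "\<dots> = ennreal C' * ?E \<theta> (tube M t0 \<inter> ?\<Omega>) * ennreal (t powr (real m - 1))"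
        unfolding powr[OF t(1)] using C' t(1)
        by (simp add: ennreal_mult mult.assoc mult.left_commute mult.commute)
      finally show ?thesis .
    qed
    then show ?thesis using C' by blast
  qed
qed simp

end
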